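(* Let $\{X,X_n;n\ge1\}$ be i.i.d. random variables with $\mathbb E X=0$ and $\mathbb E X^2=\sigma^2\in(0,\infty)$, let $(a_n)$ be a real sequence with $a_n=O(1/\log\log n)$, and let $b>-1$. Then $$\lim_{\epsilon\searrow0}\epsilon^{2(b+1)}\sum_{n=1}^\infty\frac{(\log\log n)^b}{n\log n}\,\mathbb P\big\{M_n\ge\sigma\phi(n)(\epsilon+a_n)\big\}=\frac{2}{(b+1)\sqrt\pi}\,\Gamma(b+3/2)\sum_{k=0}^\infty\frac{(-1)^k}{(2k+1)^{2b+2}}$$ and $$\lim_{\epsilon\searrow0}\epsilon^{2(b+1)}\sum_{n=1}^\infty\frac{(\log\log n)^b}{n\log n}\,\mathbb P\big\{|S_n|\ge\sigma\phi(n)(\epsilon+a_n)\big\}=\frac{1}{(b+1)\sqrt\pi}\,\Gamma(b+3/2).$$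
   Context: Conventions: $\log x=\ln(x\vee e)$, $\log\log x=\log(\log x)$, $\phi(x)=\sqrt{2x\log\log x}$. For i.i.d. $X_1,X_2,\dots$, $S_n=X_1+\dots+X_n$ and $M_n=\max_{k\le n}|S_k|$. $\Gamma$ is the Gamma function. *)

theory Defs
  imports "HOL-Probability.Probability" "HOL-Library.Landau_Symbols"
begin

definition Lg :: "real \<Rightarrow> real" where
  "Lg x = ln (max x (exp 1))"

definition LLg :: "real \<Rightarrow> real" where
  "LLg x = Lg (Lg x)"

definition phi :: "real \<Rightarrow> real" where
  "phi x = sqrt (2 * x * LLg x)"

text \<open>Partial sums S_n = X_1 + ... + X_n, where X_i is represented by X (i-1).\<close>
definition psum :: "(nat \<Rightarrow> 'a \<Rightarrow> real) \<Rightarrow> nat \<Rightarrow> 'a \<Rightarrow> real" where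
  "psum X n \<omega> = (\<Sum>i<n. X i \<omega>)"

definition maxpsum :: "(nat \<Rightarrow> 'a \<Rightarrow> real) \<Rightarrow> nat \<Rightarrow> 'a \<Rightarrow> real" where
  "maxpsum X n \<omega> = Max ((\<lambda>k. \<bar>psum X k \<omega>\<bar>) ` {1..n})"

end

theory Submission
  imports Defs "HOL-Real_Asymp.Real_Asymp"
begin

text \<open>
  Let \<open>p = b + 1\<close> and \<open>w\<^sub>n = (log log n)\<^sup>b / (n log n)\<close>. Since \<open>w\<^sub>n\<close> is asymptotically the increment of
  \<open>(log log n)\<^sup>p / p\<close>, replacing \<open>S\<^sub>n\<close> by a Gaussian turns the sum into \<open>E W(N\<^sup>2 / 2\<epsilon>\<^sup>2)\<close> with
  \<open>W(u) = \<Sum>w\<^sub>n\<close> over \<open>log log n \<le> u\<close>, and \<open>W(u) ~ u\<^sup>p / p\<close> gives the limit by dominated convergence.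
  The limit law of \<open>M\<^sub>n\<close> has tail \<open>2 \<Sum> (-1)\<^sup>k P(|N| \<ge> (2k+1)x)\<close>, an alternating series whose partial
  sums enclose it, so its limit follows from the Gaussian one.

  The replacement is harmless where \<open>\<epsilon>\<^sup>2 log log n\<close> stays in a compact subset of \<open>(0, \<infinity>)\<close>, because the
  convergence in law is locally uniform there; the remaining terms are small by an exponential bound for the
  truncated walk. The convergence in law of \<open>M\<^sub>n\<close> (Erdos and Kac) is obtained without Brownian motion: the
  probability of staying in an interval satisfies a one-step recursion, which is compared with explicit
  trigonometric solutions of the heat equation that vanish at the endpoints.
\<close>

section \<open>Weights\<close>

text \<open>Only a second moment is available. Chebyshev's bound, of order 1 / (\<epsilon>^2 log log
  n), is not summable against the weights once b \<ge> 0. Truncation at sqrt n gives exponential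
  decay at the price of n P(X^2 > n). The weights contain a factor 1/n, so this price sums to at
  most a multiple of E X^2, and the power of \<epsilon> in front removes it.

  The perturbation a_n enters as sqrt(2 log log n) a_n, which tends to 0 and is absorbed by locally
  uniform convergence; where \<epsilon>^2 log log n is large, it is at most \<epsilon>/2 in absolute
  value. Indices with \<epsilon>^2 log log n below a small \<theta> have total weight at most a
  multiple of \<theta>^p \<epsilon>^(-2p) and need no limit law.

  A walk leaves an interval by overshooting an endpoint, so a comparison function has to be
  controlled just outside as well. Trigonometric polynomials live on the whole line and are bounded
  and Lipschitz uniformly in time, hence stay near 0 slightly beyond an endpoint where they vanish.
  They approximate a clamped multiple of the cosine. For growing slope the clamp tends to a square
  wave, which is the constant 1 on the interval reflected oddly in the endpoints.\<close>

definition loglog :: "nat \<Rightarrow> real" where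
  "loglog m = LLg (real (Suc m))"

definition weight :: "real \<Rightarrow> nat \<Rightarrow> real" where
  "weight b m = loglog m powr b / (real (Suc m) * Lg (real (Suc m)))"

lemma Lg_ge_1: "1 \<le> Lg x"
proof -
  have "ln (exp 1) \<le> ln (max x (exp 1))"
    by (subst ln_le_cancel_iff) (auto simp: less_max_iff_disj)
  then show ?thesis by (simp add: Lg_def)
qed

lemma Lg_mono: "x \<le> y \<Longrightarrow> Lg x \<le> Lg y"
  unfolding Lg_def by (subst ln_le_cancel_iff) (auto simp: less_max_iff_disj)

lemma loglog_ge_1: "1 \<le> loglog m"
  by (simp add: loglog_def LLg_def Lg_ge_1)

lemma loglog_pos [simp]: "0 < loglog m"
  using loglog_ge_1[of m] by linarith

lemma loglog_nonneg [simp]: "0 \<le> loglog m"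
  by (simp add: less_imp_le)

lemma loglog_mono: "m \<le> n \<Longrightarrow> loglog m \<le> loglog n"
  unfolding loglog_def LLg_def by (intro Lg_mono) auto

lemma weight_nonneg [simp]: "0 \<le> weight b m"
  using Lg_ge_1[of "real (Suc m)"] by (auto simp: weight_def intro!: divide_nonneg_nonneg mult_nonneg_nonneg)

lemma eventually_Lg: "\<forall>\<^sub>F x in at_top. Lg x = ln x \<and> LLg x = ln (ln x)"
proof -
  have "\<forall>\<^sub>F x::real in at_top. x \<ge> exp 1" "\<forall>\<^sub>F x::real in at_top. ln x \<ge> exp 1"
    by real_asymp+
  then show ?thesis
    by eventually_elim (auto simp: LLg_def Lg_def max_def)
qed

lemma filterlim_Suc_real: "filterlim (\<lambda>m. real (Suc m)) at_top sequentially"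
  by real_asymp

lemma loglog_at_top: "filterlim loglog at_top sequentially"
proof -
  have "filterlim LLg at_top at_top"
  proof (rule filterlim_cong[THEN iffD1, OF refl refl])
    show "\<forall>\<^sub>F x in at_top. ln (ln x) = LLg x"
      using eventually_Lg by eventually_elim simp
    show "filterlim (\<lambda>x::real. ln (ln x)) at_top at_top" by real_asymp
  qed
  from filterlim_compose[OF this filterlim_Suc_real] show ?thesis
    by (simp add: loglog_def[abs_def])
qed

text \<open>The derivative of \<open>ln (ln x) powr (b + 1)\<close> is \<open>b + 1\<close> times
  the continuous weight, so over a unit step the increment behaves like the derivative. The
  asymptotics are computed for a real variable and pulled back along \<open>Suc\<close>; the
  truncation inside \<open>Lg\<close> is eventually inactive.\<close>

lemma weight_increment_ratio:
  assumes "b > -1"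
  shows "(\<lambda>m. weight b m / (loglog (Suc m) powr (b + 1) - loglog m powr (b + 1))) \<longlonglongrightarrow> 1 / (b + 1)"
proof -
  have "((\<lambda>x::real. (ln (ln x) powr b / (x * ln x)) / (ln (ln (x+1)) powr (b+1) - ln (ln x) powr (b+1))) \<longlongrightarrow> inverse (b+1)) at_top"
    using assms by real_asymp
  from filterlim_compose[OF this filterlim_Suc_real]
  show ?thesis
    unfolding inverse_eq_divide
  proof (rule Lim_transform_eventually)
    have e: "\<forall>\<^sub>F m in sequentially. Lg (real (Suc m)) = ln (real (Suc m)) \<and> LLg (real (Suc m)) = ln (ln (real (Suc m)))"
      using eventually_compose_filterlim[OF eventually_Lg filterlim_Suc_real] .
    then have e': "\<forall>\<^sub>F m in sequentially. LLg (real (Suc (Suc m))) = ln (ln (real (Suc (Suc m))))"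
      by (subst eventually_sequentially_Suc) (auto elim: eventually_mono)
    show "\<forall>\<^sub>F m in sequentially. (ln (ln (real (Suc m))) powr b / (real (Suc m) * ln (real (Suc m)))) /
        (ln (ln (real (Suc m) + 1)) powr (b + 1) - ln (ln (real (Suc m))) powr (b + 1)) =
       weight b m / (loglog (Suc m) powr (b + 1) - loglog m powr (b + 1))"
      using e e' by eventually_elim (auto simp: weight_def loglog_def add_ac)
  qed
qed

text \<open>The exponent \<open>-(b + 2)\<close> cancels \<open>b\<close>: what remains is the
  derivative of \<open>- 1 / ln (ln x)\<close>, whose increments telescope. This is the decay rate
  demanded of all tail bounds below.\<close>

lemma weight_tail_ratio:
  "(\<lambda>m. weight b m * loglog m powr (-(b + 2)) / (1 / loglog m - 1 / loglog (Suc m))) \<longlonglongrightarrow> 1"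
proof -
  have "((\<lambda>x::real. (ln (ln x) powr (-2) / (x * ln x)) / (1 / ln (ln x) - 1 / ln (ln (x+1)))) \<longlongrightarrow> 1) at_top"
    by real_asymp
  from filterlim_compose[OF this filterlim_Suc_real]
  show ?thesis
  proof (rule Lim_transform_eventually)
    have e: "\<forall>\<^sub>F m in sequentially. Lg (real (Suc m)) = ln (real (Suc m)) \<and> LLg (real (Suc m)) = ln (ln (real (Suc m)))"
      using eventually_compose_filterlim[OF eventually_Lg filterlim_Suc_real] .
    then have e': "\<forall>\<^sub>F m in sequentially. LLg (real (Suc (Suc m))) = ln (ln (real (Suc (Suc m))))"
      by (subst eventually_sequentially_Suc) (auto elim: eventually_mono)
    have *: "weight b m * loglog m powr (-(b+2)) = loglog m powr (-2) / (real (Suc m) * Lg (real (Suc m)))" for m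
      by (simp add: weight_def powr_add[symmetric])
    show "\<forall>\<^sub>F m in sequentially. (ln (ln (real (Suc m))) powr (-2) / (real (Suc m) * ln (real (Suc m)))) /
        (1 / ln (ln (real (Suc m))) - 1 / ln (ln (real (Suc m) + 1))) =
       weight b m * loglog m powr (-(b + 2)) / (1 / loglog m - 1 / loglog (Suc m))"
      unfolding * using e e' by eventually_elim (auto simp: weight_def loglog_def add_ac)
  qed
qed

text \<open>Strictness makes the increments positive, so that ratios can be cleared; it fails at the
  start, where the truncated logarithm is constant. The crude gap 1 suffices because
  \<open>(u + 1) powr p\<close> and \<open>u powr p\<close> are asymptotically equal.\<close>

lemma loglog_less_Suc: "\<forall>\<^sub>F m in sequentially. loglog m < loglog (Suc m) \<and> loglog (Suc m) \<le> loglog m + 1"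
proof -
  have 1: "\<forall>\<^sub>F x::real in at_top. ln (ln x) < ln (ln (x+1)) \<and> ln (ln (x+1)) \<le> ln (ln x) + 1"
    by (intro eventually_conj; real_asymp)
  have e: "\<forall>\<^sub>F m in sequentially. LLg (real (Suc m)) = ln (ln (real (Suc m)))"
    using eventually_compose_filterlim[OF eventually_Lg filterlim_Suc_real] by (auto elim: eventually_mono)
  then have e': "\<forall>\<^sub>F m in sequentially. LLg (real (Suc (Suc m))) = ln (ln (real (Suc (Suc m))))"
    by (subst eventually_sequentially_Suc) (auto elim: eventually_mono)
  show ?thesis
    using eventually_compose_filterlim[OF 1 filterlim_Suc_real] e e'
    by eventually_elim (auto simp: loglog_def add_ac)
qed

section \<open>Growth of the accumulated weights and their tails\<close>

lemma finite_loglog_le [simp]: "finite {m. loglog m \<le> u}"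
proof -
  obtain N where "\<And>m. m \<ge> N \<Longrightarrow> u < loglog m"
    using loglog_at_top unfolding filterlim_at_top_dense eventually_sequentially by blast
  then have "{m. loglog m \<le> u} \<subseteq> {..<N}" by (force simp: not_le[symmetric])
  then show ?thesis using finite_subset by blast
qed

definition cum_weight :: "real \<Rightarrow> real \<Rightarrow> real" where
  "cum_weight b u = (\<Sum>m | loglog m \<le> u. weight b m)"

lemma loglog_le_initial_segment:
  assumes "u \<ge> loglog 0"
  obtains N where "{m. loglog m \<le> u} = {..<Suc N}" "loglog N \<le> u" "u < loglog (Suc N)"
proof -
  have ne: "{m. loglog m \<le> u} \<noteq> {}" using assms by auto
  define N where "N = Max {m. loglog m \<le> u}"
  have N: "loglog N \<le> u" using Max_in[OF finite_loglog_le ne] by (simp add: N_def)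
  have gt: "m \<le> N" if "loglog m \<le> u" for m using that by (auto simp: N_def)
  have eq: "{m. loglog m \<le> u} = {..<Suc N}"
    using order_trans[OF loglog_mono N] gt by (auto simp: less_Suc_eq_le)
  moreover have "u < loglog (Suc N)" using gt[of "Suc N"] by force
  ultimately show ?thesis using N that by blast
qed

text \<open>A Stolz-Cesaro argument: beyond some \<open>n0\<close> every weight lies between
  \<open>1/p - d\<close> and \<open>1/p + d\<close> times a telescoping increment, and the finitely
  many earlier weights form a constant \<open>K\<close> that is negligible against
  \<open>u powr p\<close>.\<close>

lemma cum_weight_asymp:
  assumes b: "b > -1"
  shows "((\<lambda>u. cum_weight b u / u powr (b + 1)) \<longlongrightarrow> 1 / (b + 1)) at_top"
proof (rule tendstoI)
  fix e :: real assume e: "e > 0"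
  define p where "p = b + 1"
  have p: "p > 0" using b by (simp add: p_def)
  define d where "d = e / 2"
  have d: "d > 0" using e by (simp add: d_def)
  define D where "D m = loglog (Suc m) powr p - loglog m powr p" for m
  have "\<forall>\<^sub>F m in sequentially. \<bar>weight b m / D m - 1 / p\<bar> < d"
    using tendstoD[OF weight_increment_ratio[OF b] d] by (simp add: D_def p_def dist_real_def)
  with loglog_less_Suc have "\<forall>\<^sub>F m in sequentially. (1/p - d) * D m \<le> weight b m \<and> weight b m \<le> (1/p + d) * D m \<and> loglog (Suc m) \<le> loglog m + 1"
  proof eventually_elim
    case (elim m)
    then have "D m > 0" using p by (simp add: D_def powr_less_mono2 less_imp_le)
    moreover have "1/p - d \<le> weight b m / D m" "weight b m / D m \<le> 1/p + d" using elim by (auto simp: abs_if split: if_splits)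
    ultimately show ?case using elim by (auto simp: field_simps)
  qed
  then obtain n0 where n0: "\<And>m. m \<ge> n0 \<Longrightarrow> (1/p - d) * D m \<le> weight b m"
      "\<And>m. m \<ge> n0 \<Longrightarrow> weight b m \<le> (1/p + d) * D m" "\<And>m. m \<ge> n0 \<Longrightarrow> loglog (Suc m) \<le> loglog m + 1"
    unfolding eventually_sequentially by blast
  define K where "K = (\<Sum>m<n0. weight b m)"
  define c where "c = loglog n0 powr p"
  have sum_D: "(\<Sum>m\<in>{n0..<Suc N}. D m) = loglog (Suc N) powr p - c" if "N \<ge> n0" for N
    using that sum_Suc_diff'[of n0 "Suc N" "\<lambda>m. loglog m powr p"] by (simp add: D_def c_def)
  have bnd: "K + (1/p - d) * (loglog (Suc N) powr p - c) \<le> (\<Sum>m<Suc N. weight b m) \<and>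
     (\<Sum>m<Suc N. weight b m) \<le> K + (1/p + d) * (loglog (Suc N) powr p - c)" if "N \<ge> n0" for N
  proof -
    have "(\<Sum>m<Suc N. weight b m) = K + (\<Sum>m\<in>{n0..<Suc N}. weight b m)"
      unfolding K_def using sum.atLeastLessThan_concat[of 0 n0 "Suc N" "weight b"] that by (simp add: lessThan_atLeast0)
    moreover have "(\<Sum>m\<in>{n0..<Suc N}. (1/p - d) * D m) \<le> (\<Sum>m\<in>{n0..<Suc N}. weight b m)"
      "(\<Sum>m\<in>{n0..<Suc N}. weight b m) \<le> (\<Sum>m\<in>{n0..<Suc N}. (1/p + d) * D m)"
      using n0 by (auto intro!: sum_mono simp del: sum.op_ivl_Suc)
    ultimately show ?thesis using sum_D[OF that] by (simp add: sum_distrib_left[symmetric])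
  qed
  define ub where "ub u = (K + (1/p + d) * ((u + 1) powr p - c)) / u powr p" for u
  define lb where "lb u = (K + (1/p - d) * (u powr p - c)) / u powr p" for u
  \<comment> \<open>The factor \<open>1/p - d\<close> may be negative when \<open>e\<close> is
    large. Then the upper estimate of \<open>loglog (Suc N)\<close> yields the lower bound, which is
    why there are two candidates with the same limit.\<close>
  define lb2 where "lb2 u = (K + (1/p - d) * ((u + 1) powr p - c)) / u powr p" for u
  have "(ub \<longlongrightarrow> 1/p + d) at_top" unfolding ub_def using p by real_asymp
  moreover have "(lb \<longlongrightarrow> 1/p - d) at_top" unfolding lb_def using p by real_asymp
  moreover have "(lb2 \<longlongrightarrow> 1/p - d) at_top" unfolding lb2_def using p by real_asymp
  ultimately have "\<forall>\<^sub>F u in at_top. ub u < 1/p + e" "\<forall>\<^sub>F u in at_top. lb u > 1/p - e" "\<forall>\<^sub>F u in at_top. lb2 u > 1/p - e"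
    using e by (auto intro!: order_tendstoD simp: d_def)
  with eventually_gt_at_top[of "max 1 (loglog n0)"]
  show "\<forall>\<^sub>F u in at_top. dist (cum_weight b u / u powr (b + 1)) (1 / (b + 1)) < e"
  proof eventually_elim
    case (elim u)
    have u: "u \<ge> loglog 0" "u > 0" using elim loglog_mono[of 0 n0] by auto
    obtain N where N: "{m. loglog m \<le> u} = {..<Suc N}" "loglog N \<le> u" "u < loglog (Suc N)"
      using loglog_le_initial_segment[OF u(1)] by blast
    have Nn: "N \<ge> n0"
    proof (rule ccontr)
      assume "\<not> N \<ge> n0"
      then have "loglog (Suc N) \<le> loglog n0" by (intro loglog_mono) simp
      then show False using N elim by simp
    qed
    have c: "cum_weight b u = (\<Sum>m<Suc N. weight b m)" by (simp add: cum_weight_def N)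
    have L1: "u powr p \<le> loglog (Suc N) powr p" using N u p by (intro powr_mono2) auto
    have L2: "loglog (Suc N) powr p \<le> (u + 1) powr p"
      using N n0(3)[OF Nn] loglog_pos[of "Suc N"] p by (intro powr_mono2) (auto simp del: loglog_pos)
    have "cum_weight b u \<le> K + (1/p + d) * ((u+1) powr p - c)"
    proof -
      have "(1/p + d) * (loglog (Suc N) powr p - c) \<le> (1/p + d) * ((u+1) powr p - c)"
        using L2 p d by (intro mult_left_mono) auto
      then show ?thesis using bnd[OF Nn] c by linarith
    qed
    then have "cum_weight b u / u powr p \<le> ub u" unfolding ub_def using u by (intro divide_right_mono) auto
    moreover have "min (lb u) (lb2 u) \<le> cum_weight b u / u powr p"
    proof (cases "1/p - d \<ge> 0")
      case True
      then have "(1/p - d) * (u powr p - c) \<le> (1/p - d) * (loglog (Suc N) powr p - c)"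
        using L1 by (intro mult_left_mono) auto
      then have "K + (1/p - d) * (u powr p - c) \<le> cum_weight b u" using bnd[OF Nn] c by linarith
      then have "lb u \<le> cum_weight b u / u powr p" unfolding lb_def using u by (intro divide_right_mono) auto
      then show ?thesis by simp
    next
      case False
      then have "(1/p - d) * ((u+1) powr p - c) \<le> (1/p - d) * (loglog (Suc N) powr p - c)"
        using L2 by (intro mult_left_mono_neg) auto
      then have "K + (1/p - d) * ((u+1) powr p - c) \<le> cum_weight b u" using bnd[OF Nn] c by linarith
      then have "lb2 u \<le> cum_weight b u / u powr p" unfolding lb2_def using u by (intro divide_right_mono) auto
      then show ?thesis by simp
    qed
    ultimately show ?case using elim unfolding p_def[symmetric] dist_real_def by (auto simp: abs_if min_def split: if_splits)
  qed
qed

lemma cum_weight_nonneg: "0 \<le> cum_weight b u"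
  by (auto simp: cum_weight_def intro: sum_nonneg)

lemma cum_weight_eq_0: "u < 1 \<Longrightarrow> cum_weight b u = 0"
proof -
  assume "u < 1"
  then have "{m. loglog m \<le> u} = {}" using loglog_ge_1 by (auto simp: not_le intro: less_le_trans)
  then show ?thesis by (simp add: cum_weight_def)
qed

lemma cum_weight_mono: "u \<le> v \<Longrightarrow> cum_weight b u \<le> cum_weight b v"
  unfolding cum_weight_def by (rule sum_mono2) auto

text \<open>A bound for all \<open>u\<close>, including small ones, supplies the integrable majorant
  for dominated convergence. It can hold near 0 because no index has \<open>loglog\<close> below
  1.\<close>

lemma cum_weight_bound:
  assumes b: "b > -1"
  obtains C where "C > 0" "\<And>u. cum_weight b u \<le> C * u powr (b + 1)"
proof -
  have "\<forall>\<^sub>F u in at_top. cum_weight b u / u powr (b + 1) < 1 / (b+1) + 1"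
    using cum_weight_asymp[OF b] by (rule order_tendstoD) simp
  then obtain u0 where u0: "\<And>u. u \<ge> u0 \<Longrightarrow> cum_weight b u / u powr (b + 1) < 1 / (b+1) + 1"
    by (auto simp: eventually_at_top_linorder)
  \<comment> \<open>The last summand covers the range from 1 to \<open>u0\<close>, where the power
    is at least 1 and monotonicity bounds the accumulated weight.\<close>
  define C where "C = 1 / (b+1) + 1 + cum_weight b u0"
  have bp: "1/(b+1) > 0" using b by simp
  have C: "C > 0" using bp cum_weight_nonneg[of b u0] unfolding C_def by linarith
  have "cum_weight b u \<le> C * u powr (b + 1)" for u
  proof (cases "u < 1")
    case True then show ?thesis using C by (simp add: cum_weight_eq_0)
  next
    case False
    then have p: "u powr (b+1) \<ge> 1" using b by (intro ge_one_powr_ge_zero) auto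
    show ?thesis
    proof (cases "u \<ge> u0")
      case True
      have "cum_weight b u \<le> (1 / (b+1) + 1) * u powr (b+1)" using u0[OF True] False by (simp add: divide_less_eq)
      also have "\<dots> \<le> C * u powr (b+1)" using cum_weight_nonneg[of b u0] by (intro mult_right_mono) (auto simp: C_def)
      finally show ?thesis .
    next
      case False
      then have "cum_weight b u \<le> cum_weight b u0" by (intro cum_weight_mono) simp
      also have "\<dots> \<le> C * 1" using bp by (simp add: C_def)
      also have "\<dots> \<le> C * u powr (b+1)" using C p by (intro mult_left_mono) auto
      finally show ?thesis .
    qed
  qed
  with C show ?thesis using that by blast
qed

text \<open>Eventually each term is at most twice an increment of \<open>- 1 / loglog\<close>, so
  the tail beyond level \<open>U\<close> telescopes to at most twice the reciprocal of the first
  \<open>loglog\<close> value exceeding \<open>U\<close>.\<close>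

lemma weight_tail:
  shows "summable (\<lambda>m. weight b m * loglog m powr (-(b + 2)))"
    and "\<forall>\<^sub>F U in at_top. (\<Sum>m. (if loglog m > U then weight b m * loglog m powr (-(b + 2)) else 0)) \<le> 2 / U"
proof -
  let ?f = "\<lambda>m. weight b m * loglog m powr (-(b + 2))"
  have "\<forall>\<^sub>F m in sequentially. ?f m / (1 / loglog m - 1 / loglog (Suc m)) < 2"
    using weight_tail_ratio by (rule order_tendstoD) simp
  with loglog_less_Suc have "\<forall>\<^sub>F m in sequentially. ?f m \<le> 2 * (1 / loglog m - 1 / loglog (Suc m))"
  proof eventually_elim
    case (elim m)
    then have "1 / loglog m - 1 / loglog (Suc m) > 0" by (simp add: frac_less2)
    then show ?case using elim by (simp add: divide_less_eq)
  qed
  then obtain n0 where n0: "\<And>m. m \<ge> n0 \<Longrightarrow> ?f m \<le> 2 * (1 / loglog m - 1 / loglog (Suc m))"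
    unfolding eventually_sequentially by blast
  have lim: "(\<lambda>m. 1 / loglog m) \<longlonglongrightarrow> 0"
    using loglog_at_top by (intro tendsto_divide_0[OF tendsto_const] filterlim_at_top_imp_at_infinity)
  have tel: "(\<lambda>m. 1 / loglog (m + N) - 1 / loglog (Suc (m + N))) sums (1 / loglog N)" for N
    using telescope_sums'[OF LIMSEQ_ignore_initial_segment[OF lim, of N]] by simp
  have sm: "summable (\<lambda>m. ?f (m + n0))"
    by (rule summable_comparison_test'[OF summable_mult[OF sums_summable[OF tel[of n0]], of 2], of 0]) (use n0 in auto)
  then show s: "summable ?f" using summable_iff_shift[of ?f n0] by blast
  show "\<forall>\<^sub>F U in at_top. (\<Sum>m. (if loglog m > U then ?f m else 0)) \<le> 2 / U"
    using eventually_gt_at_top[of "max 1 (loglog n0)"]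
  proof eventually_elim
    case (elim U)
    have u: "U \<ge> loglog 0" "U > 0" using elim loglog_mono[of 0 n0] by auto
    obtain N where N: "{m. loglog m \<le> U} = {..<Suc N}" "loglog N \<le> U" "U < loglog (Suc N)"
      using loglog_le_initial_segment[OF u(1)] by blast
    have Nn: "Suc N \<ge> n0"
    proof (rule ccontr)
      assume "\<not> Suc N \<ge> n0"
      then have "loglog (Suc N) \<le> loglog n0" by (intro loglog_mono) simp
      then show False using N elim by simp
    qed
    let ?g = "\<lambda>m. if loglog m > U then ?f m else 0"
    have iff: "loglog m > U \<longleftrightarrow> m \<ge> Suc N" for m
    proof -
      have "m \<in> {m. loglog m \<le> U} \<longleftrightarrow> m \<in> {..<Suc N}" using N(1) by simp
      then show ?thesis by (simp add: not_le[symmetric] not_less_eq_eq less_Suc_eq_le)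
    qed
    have sg: "summable ?g" by (rule summable_comparison_test'[OF s, of 0]) auto
    have "(\<Sum>m. ?g m) = (\<Sum>m. ?g (m + Suc N)) + (\<Sum>m<Suc N. ?g m)"
      by (rule suminf_split_initial_segment[OF sg])
    also have "(\<Sum>m<Suc N. ?g m) = 0" by (rule sum.neutral) (auto simp: iff)
    also have "(\<Sum>m. ?g (m + Suc N)) \<le> (\<Sum>m. 2 * (1 / loglog (m + Suc N) - 1 / loglog (Suc (m + Suc N))))"
    proof (rule suminf_le)
      show "summable (\<lambda>m. ?g (m + Suc N))" using summable_iff_shift[of ?g "Suc N"] sg by blast
      show "summable (\<lambda>m. 2 * (1 / loglog (m + Suc N) - 1 / loglog (Suc (m + Suc N))))"
        by (rule summable_mult[OF sums_summable[OF tel]])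
      show "?g (m + Suc N) \<le> 2 * (1 / loglog (m + Suc N) - 1 / loglog (Suc (m + Suc N)))" for m
        using n0[of "m + Suc N"] Nn iff[of "m + Suc N"] by (auto simp del: add_Suc_right)
    qed
    also have "\<dots> = 2 * (1 / loglog (Suc N))"
      using tel[of "Suc N"] sums_unique[OF sums_mult[OF tel[of "Suc N"], of 2]] by simp
    also have "\<dots> \<le> 2 / U" using N u by (simp add: frac_le)
    finally show ?case by simp
  qed
qed

section \<open>Gaussian sums\<close>

interpretation gauss: real_distribution std_normal_distribution
  by (rule real_dist_normal_dist)

text \<open>The substitution t = x^2/2 in Euler's integral for \<open>Gamma (p + 1/2)\<close>. It is
  injective only on a half line; evenness of the density supplies the other half.\<close>

lemma gauss_abs_moment:
  fixes p :: real assumes p: "p > 0"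
  shows "integrable std_normal_distribution (\<lambda>x. (x\<^sup>2 / 2) powr p)"
    and "(\<integral>x. (x\<^sup>2 / 2) powr p \<partial>std_normal_distribution) = Gamma (p + 1/2) / sqrt pi"
proof -
  define s where "s = p + 1/2"
  have s: "s > 0" using p by (simp add: s_def)
  let ?f = "\<lambda>t. t powr (s - 1) / exp t"
  let ?g = "\<lambda>x::real. x\<^sup>2 / 2"
  have "(?f has_integral Gamma s) {0..}" by (rule Gamma_integral_real[OF s])
  \<comment> \<open>The endpoint is discarded because the substitution maps the open half line onto
    itself.\<close>
  then have "((\<lambda>t. if t \<in> {0<..} then ?f t else 0) has_integral Gamma s) {0..}"
    by (rule has_integral_spike[of "{0}", rotated 2]) auto
  then have g: "(?f has_integral Gamma s) {0<..}"
    by (subst (asm) has_integral_restrict) auto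
  have im: "?g ` {0<..} = {0<..}"
  proof (intro equalityI subsetI)
    fix x :: real assume "x \<in> {0<..}"
    then show "x \<in> ?g ` {0<..}" by (intro image_eqI[of _ _ "sqrt (2 * x)"]) auto
  qed auto
  have "?f absolutely_integrable_on {0<..}"
    using g by (intro nonnegative_absolutely_integrable_1) (auto simp: has_integral_integrable)
  then have "(\<lambda>x. \<bar>x\<bar> * ?f (?g x)) absolutely_integrable_on {0<..} \<and>
       integral {0<..} (\<lambda>x. \<bar>x\<bar> * ?f (?g x)) = Gamma s"
    by (subst has_absolute_integral_change_of_variables_1'[where g = ?g])
       (auto intro!: derivative_eq_intros inj_onI simp: im integral_unique[OF g] power2_eq_iff)
  then have hi: "((\<lambda>x. \<bar>x\<bar> * ?f (?g x)) has_integral Gamma s) {0<..}"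
    using set_lebesgue_integral_eq_integral(1) by (blast intro: has_integral_iff[THEN iffD2])
  let ?h = "\<lambda>x. std_normal_density x * ?g x powr p"
  \<comment> \<open>The Jacobian \<open>x\<close> equals \<open>sqrt 2 * ?g x powr (1/2)\<close>;
    this \<open>sqrt 2\<close> and the normalisation \<open>1 / sqrt (2 * pi)\<close> combine to the
    constant.\<close>
  have eq: "?h x = (\<bar>x\<bar> * ?f (?g x)) * (1 / (2 * sqrt pi))" if "x > 0" for x
  proof -
    have "x * (?g x) powr (s - 1) = sqrt 2 * (?g x) powr p"
    proof -
      have "x = sqrt 2 * ?g x powr (1/2)"
        using that by (simp add: powr_half_sqrt real_sqrt_divide)
      then have "x * (?g x) powr (s - 1) = sqrt 2 * (?g x powr (1/2) * ?g x powr (s - 1))" by simp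
      also have "?g x powr (1/2) * ?g x powr (s - 1) = ?g x powr p"
        by (simp add: powr_add[symmetric] s_def)
      finally show ?thesis .
    qed
    then have "(\<bar>x\<bar> * ?f (?g x)) = sqrt 2 * (?g x) powr p / exp (?g x)" using that by simp
    then show ?thesis unfolding std_normal_density_def
      by (simp add: real_sqrt_mult exp_minus field_simps)
  qed
  have "((\<lambda>x. (\<bar>x\<bar> * ?f (?g x)) * (1 / (2 * sqrt pi))) has_integral Gamma s * (1 / (2 * sqrt pi))) {0<..}"
    by (rule has_integral_mult_left[OF hi])
  then have "(?h has_integral Gamma s * (1 / (2 * sqrt pi))) {0<..}"
    by (rule has_integral_eq[rotated]) (use eq in auto)
  then have "(\<integral>\<^sup>+x. ennreal (indicator {0<..} x * ?h x) \<partial>lborel) = ennreal (Gamma s * (1 / (2 * sqrt pi)))"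
    by (intro nn_integral_has_integral_lebesgue) (auto intro!: mult_nonneg_nonneg)
  then have "has_bochner_integral lborel (\<lambda>x. indicator {0<..} x * ?h x) (Gamma s * (1 / (2 * sqrt pi)))"
    using s by (intro has_bochner_integral_nn_integral) (auto intro!: mult_nonneg_nonneg Gamma_real_nonneg)
  \<comment> \<open>Both sides vanish at 0, since \<open>0 powr p = 0\<close>.\<close>
  also have "(\<lambda>x. indicator {0<..} x * ?h x) = (\<lambda>x. indicator {0..} x *\<^sub>R ?h x)"
    using p by (auto simp: fun_eq_iff indicator_def)
  finally have "has_bochner_integral lborel ?h (2 *\<^sub>R (Gamma s * (1 / (2 * sqrt pi))))"
    by (rule has_bochner_integral_even_function) (simp add: std_normal_density_def)
  then have "has_bochner_integral lborel ?h (Gamma s / sqrt pi)" by (simp add: field_simps)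
  then have *: "integrable lborel ?h" "integral\<^sup>L lborel ?h = Gamma s / sqrt pi"
    by (auto simp: has_bochner_integral_iff)
  show "integrable std_normal_distribution (\<lambda>x. (x\<^sup>2 / 2) powr p)"
    using *(1) by (subst integrable_density) auto
  show "(\<integral>x. (x\<^sup>2 / 2) powr p \<partial>std_normal_distribution) = Gamma (p + 1/2) / sqrt pi"
    using *(2) by (subst integral_density) (auto simp: s_def)
qed

section \<open>Weighted sums of Gaussian tails\<close>

definition gauss_tail :: "real \<Rightarrow> real" where
  "gauss_tail x = measure std_normal_distribution {z. x \<le> \<bar>z\<bar>}"

lemma gauss_tail_nonneg: "0 \<le> gauss_tail x" and gauss_tail_le_1: "gauss_tail x \<le> 1"
  by (auto simp: gauss_tail_def gauss.prob_le_1)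

lemma gauss_tail_eq_integral: "gauss_tail x = (\<integral>z. of_bool (x \<le> \<bar>z\<bar>) \<partial>std_normal_distribution)"
proof -
  have "gauss_tail x = (\<integral>z. indicator {z. x \<le> \<bar>z\<bar>} z \<partial>std_normal_distribution)"
    by (simp add: gauss_tail_def)
  also have "\<dots> = (\<integral>z. of_bool (x \<le> \<bar>z\<bar>) \<partial>std_normal_distribution)"
    by (intro Bochner_Integration.integral_cong) (auto simp: indicator_def)
  finally show ?thesis .
qed

text \<open>Markov's inequality for the moment of order \<open>q\<close>. Polynomial decay of
  arbitrary order is enough; later \<open>q = b + 2\<close> is taken to match
  \<open>weight_tail\<close>.\<close>

lemma gauss_tail_bound:
  assumes q: "q > 0" and v: "v > 0"
  shows "gauss_tail (sqrt (2 * v)) \<le> (Gamma (q + 1/2) / sqrt pi) * v powr (-q)"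
proof -
  have eq: "{z. sqrt (2 * v) \<le> \<bar>z\<bar>} = {z \<in> space std_normal_distribution. (z\<^sup>2 / 2) powr q \<ge> v powr q}"
  proof -
    have "sqrt (2 * v) \<le> \<bar>z\<bar> \<longleftrightarrow> v powr q \<le> (z\<^sup>2 / 2) powr q" for z
    proof -
      have "sqrt (2 * v) \<le> \<bar>z\<bar> \<longleftrightarrow> sqrt (2 * v) \<le> sqrt (z\<^sup>2)" by simp
      also have "\<dots> \<longleftrightarrow> v \<le> z\<^sup>2 / 2" by (subst real_sqrt_le_iff) auto
      also have "\<dots> \<longleftrightarrow> v powr q \<le> (z\<^sup>2 / 2) powr q"
        using q v powr_less_mono2[of q "z\<^sup>2/2" v] powr_mono2[of q v "z\<^sup>2/2"] by (auto simp: not_le[symmetric])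
      finally show ?thesis .
    qed
    then show ?thesis by auto
  qed
  have "gauss_tail (sqrt (2 * v)) \<le> (\<integral>x. (x\<^sup>2 / 2) powr q \<partial>std_normal_distribution) / v powr q"
    unfolding gauss_tail_def eq using v
    by (intro integral_Markov_inequality_measure[where A = "{}"] gauss_abs_moment q) auto
  also have "\<dots> = (Gamma (q + 1/2) / sqrt pi) * v powr (-q)"
    by (simp add: gauss_abs_moment(2)[OF q] powr_minus field_simps)
  finally show ?thesis .
qed

lemma measurable_cum_weight [measurable]: "cum_weight b \<in> borel_measurable borel"
  by (intro borel_measurable_mono monoI cum_weight_mono)

lemma sqrt_le_abs_iff:
  assumes "\<epsilon> > 0"
  shows "\<epsilon> * sqrt (2 * v) \<le> \<bar>z\<bar> \<longleftrightarrow> v \<le> z\<^sup>2 / 2 / \<epsilon>\<^sup>2"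
proof -
  have "\<epsilon> * sqrt (2 * v) \<le> \<bar>z\<bar> \<longleftrightarrow> sqrt (\<epsilon>\<^sup>2 * (2 * v)) \<le> sqrt (z\<^sup>2)"
    using assms by (simp add: real_sqrt_mult)
  also have "\<dots> \<longleftrightarrow> v \<le> z\<^sup>2 / 2 / \<epsilon>\<^sup>2"
    using assms by (subst real_sqrt_le_iff) (auto simp: field_simps)
  finally show ?thesis .
qed

lemma gauss_tail_bound':
  assumes q: "q > 0" and e: "\<epsilon> > 0" and v: "v > 0"
  shows "gauss_tail (\<epsilon> * sqrt (2 * v)) \<le> (Gamma (q + 1/2) / sqrt pi) * (\<epsilon>\<^sup>2 * v) powr (-q)"
proof -
  have "\<epsilon> * sqrt (2 * v) = sqrt (2 * (\<epsilon>\<^sup>2 * v))" using e by (simp add: real_sqrt_mult)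
  then show ?thesis using gauss_tail_bound[OF q, of "\<epsilon>\<^sup>2 * v"] e v by simp
qed

text \<open>Each tail is the expectation of an indicator. For fixed \<open>z\<close> the indicators
  select the finitely many \<open>m\<close> with
  \<open>loglog m \<le> z\<^sup>2 / 2 / \<epsilon>\<^sup>2\<close>, so interchanging sum and
  integral leaves the accumulated weight under the integral.\<close>

lemma gauss_tail_sum:
  assumes b: "b > -1" and e: "\<epsilon> > 0"
  shows "summable (\<lambda>m. weight b m * gauss_tail (\<epsilon> * sqrt (2 * loglog m)))"
    and "(\<Sum>m. weight b m * gauss_tail (\<epsilon> * sqrt (2 * loglog m))) =
      (\<integral>z. cum_weight b (z\<^sup>2 / 2 / \<epsilon>\<^sup>2) \<partial>std_normal_distribution)"
proof -
  let ?K = "Gamma (b + 2 + 1/2) / sqrt pi * \<epsilon>\<^sup>2 powr -(b+2)"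
  show sm: "summable (\<lambda>m. weight b m * gauss_tail (\<epsilon> * sqrt (2 * loglog m)))"
  proof (rule summable_comparison_test'[OF summable_mult[OF weight_tail(1)[of b], of ?K], of 0])
    fix m
    have "gauss_tail (\<epsilon> * sqrt (2 * loglog m)) \<le> (Gamma (b + 2 + 1/2) / sqrt pi) * (\<epsilon>\<^sup>2 * loglog m) powr (-(b+2))"
      using b by (intro gauss_tail_bound'[OF _ e]) auto
    also have "\<dots> = ?K * loglog m powr -(b+2)" using e by (subst powr_mult) (auto simp: mult.assoc)
    finally have "weight b m * gauss_tail (\<epsilon> * sqrt (2 * loglog m)) \<le> weight b m * (?K * loglog m powr -(b+2))"
      by (rule mult_left_mono) simp
    then show "norm (weight b m * gauss_tail (\<epsilon> * sqrt (2 * loglog m))) \<le> ?K * (weight b m * loglog m powr -(b+2))"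
      using gauss_tail_nonneg by (simp add: abs_mult mult_ac)
  qed
  let ?F = "\<lambda>m z. weight b m * of_bool (\<epsilon> * sqrt (2 * loglog m) \<le> \<bar>z\<bar>)"
  have fin: "finite {m. ?F m z \<noteq> 0}" for z
    by (rule finite_subset[OF _ finite_loglog_le[of "z\<^sup>2 / 2 / \<epsilon>\<^sup>2"]]) (auto simp: sqrt_le_abs_iff[OF e])
  have int: "(\<integral>z. ?F m z \<partial>std_normal_distribution) = weight b m * gauss_tail (\<epsilon> * sqrt (2 * loglog m))" for m
    by (simp add: gauss_tail_eq_integral)
  have "(\<Sum>m. \<integral>z. ?F m z \<partial>std_normal_distribution) = (\<integral>z. (\<Sum>m. ?F m z) \<partial>std_normal_distribution)"
  proof (rule integral_suminf[symmetric])
    show "integrable std_normal_distribution (?F m)" for m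
      by (rule gauss.integrable_const_bound[of _ "weight b m"]) auto
    show "AE z in std_normal_distribution. summable (\<lambda>m. norm (?F m z))"
      using fin by (intro AE_I2 summable_finite[of "{m. ?F m _ \<noteq> 0}"]) auto
    have "(\<integral>z. norm (?F m z) \<partial>std_normal_distribution) = (\<integral>z. ?F m z \<partial>std_normal_distribution)" for m
      by (intro Bochner_Integration.integral_cong) auto
    then show "summable (\<lambda>m. \<integral>z. norm (?F m z) \<partial>std_normal_distribution)"
      using sm by (simp only: int)
  qed
  also have "(\<lambda>z. \<Sum>m. ?F m z) = (\<lambda>z. cum_weight b (z\<^sup>2 / 2 / \<epsilon>\<^sup>2))"
  proof
    fix z
    have "(\<Sum>m. ?F m z) = (\<Sum>m | loglog m \<le> z\<^sup>2 / 2 / \<epsilon>\<^sup>2. ?F m z)"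
      by (rule suminf_finite) (auto simp: sqrt_le_abs_iff[OF e])
    also have "\<dots> = cum_weight b (z\<^sup>2 / 2 / \<epsilon>\<^sup>2)"
      unfolding cum_weight_def by (rule sum.cong) (auto simp: sqrt_le_abs_iff[OF e])
    finally show "(\<Sum>m. ?F m z) = cum_weight b (z\<^sup>2 / 2 / \<epsilon>\<^sup>2)" .
  qed
  finally show "(\<Sum>m. weight b m * gauss_tail (\<epsilon> * sqrt (2 * loglog m))) =
      (\<integral>z. cum_weight b (z\<^sup>2 / 2 / \<epsilon>\<^sup>2) \<partial>std_normal_distribution)"
    by (simp only: int)
qed

lemma gauss_tail_sum_limit:
  assumes b: "b > -1"
  shows "((\<lambda>\<epsilon>. \<epsilon> powr (2 * (b + 1)) * (\<Sum>m. weight b m * gauss_tail (\<epsilon> * sqrt (2 * loglog m))))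
     \<longlongrightarrow> Gamma (b + 3/2) / ((b + 1) * sqrt pi)) (at_right 0)"
proof -
  define p where "p = b + 1"
  have p: "p > 0" using b by (simp add: p_def)
  obtain C where C: "C > 0" "\<And>u. cum_weight b u \<le> C * u powr p"
    using cum_weight_bound[OF b] unfolding p_def by blast
  \<comment> \<open>Here \<open>t\<close> stands for \<open>1 / \<epsilon>\<close>, which turns the
    one-sided limit at 0 into a limit at infinity.\<close>
  let ?s = "\<lambda>t z. (t powr (-2 * p)) * cum_weight b (z\<^sup>2 / 2 * t\<^sup>2)"
  have pw: "(t\<^sup>2) powr p = t powr (2 * p)" if "t > 0" for t :: real
    using that powr_powr[of t 2 p] by simp
  have "((\<lambda>t. integral\<^sup>L std_normal_distribution (?s t)) \<longlongrightarrow>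
      (\<integral>z. (z\<^sup>2 / 2) powr p / p \<partial>std_normal_distribution)) at_top"
  proof (rule integral_dominated_convergence_at_top[where w = "\<lambda>z. C * (z\<^sup>2 / 2) powr p"])
    show "integrable std_normal_distribution (\<lambda>z. C * (z\<^sup>2 / 2) powr p)"
      by (intro integrable_mult_right gauss_abs_moment p)
    show "AE z in std_normal_distribution. ((\<lambda>t. ?s t z) \<longlongrightarrow> (z\<^sup>2 / 2) powr p / p) at_top"
    proof (rule AE_I2)
      fix z :: real
      show "((\<lambda>t. ?s t z) \<longlongrightarrow> (z\<^sup>2 / 2) powr p / p) at_top"
      proof (cases "z = 0")
        case True then show ?thesis using p by (simp add: cum_weight_eq_0)
      next
        case False
        then have z: "z\<^sup>2 / 2 > 0" by simp
        have "filterlim (\<lambda>t::real. z\<^sup>2 / 2 * t\<^sup>2) at_top at_top" using z by real_asymp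
        from filterlim_compose[OF cum_weight_asymp[OF b] this]
        have "((\<lambda>t. (z\<^sup>2 / 2) powr p * (cum_weight b (z\<^sup>2 / 2 * t\<^sup>2) / (z\<^sup>2 / 2 * t\<^sup>2) powr p))
          \<longlongrightarrow> (z\<^sup>2 / 2) powr p * (1 / p)) at_top" unfolding p_def by (rule tendsto_mult[OF tendsto_const])
        then have "((\<lambda>t. (z\<^sup>2 / 2) powr p * (cum_weight b (z\<^sup>2 / 2 * t\<^sup>2) / (z\<^sup>2 / 2 * t\<^sup>2) powr p))
          \<longlongrightarrow> (z\<^sup>2 / 2) powr p / p) at_top" by simp
        then show ?thesis
        proof (rule Lim_transform_eventually)
          show "\<forall>\<^sub>F t in at_top. (z\<^sup>2 / 2) powr p * (cum_weight b (z\<^sup>2 / 2 * t\<^sup>2) / (z\<^sup>2 / 2 * t\<^sup>2) powr p) = ?s t z"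
            using eventually_gt_at_top[of 0]
          proof eventually_elim
            case (elim t)
            have "(z\<^sup>2 / 2 * t\<^sup>2) powr p = (z\<^sup>2 / 2) powr p * t powr (2 * p)"
              using z elim by (subst powr_mult) (auto simp: pw)
            moreover have "t powr (-2 * p) = 1 / t powr (2 * p)" by (simp add: powr_minus_divide)
            ultimately show ?case using z elim by simp
          qed
        qed
      qed
    qed
    show "\<forall>\<^sub>F t in at_top. AE z in std_normal_distribution. norm (?s t z) \<le> C * (z\<^sup>2 / 2) powr p"
      using eventually_gt_at_top[of 0]
    proof eventually_elim
      case (elim t)
      have "?s t z \<le> C * (z\<^sup>2 / 2) powr p" for z
      proof -
        have "?s t z \<le> t powr (-2 * p) * (C * (z\<^sup>2 / 2 * t\<^sup>2) powr p)"
          by (intro mult_left_mono C) auto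
        also have "(z\<^sup>2 / 2 * t\<^sup>2) powr p = (z\<^sup>2 / 2) powr p * t powr (2 * p)"
          using elim by (subst powr_mult) (auto simp: pw)
        also have "t powr (-2 * p) * (C * ((z\<^sup>2 / 2) powr p * t powr (2 * p))) = C * (z\<^sup>2 / 2) powr p * (t powr (-2*p) * t powr (2 * p))"
          by simp
        also have "t powr (-2*p) * t powr (2 * p) = 1" using elim by (simp add: powr_add[symmetric])
        finally show ?thesis by simp
      qed
      then show ?case by (simp add: abs_mult cum_weight_nonneg)
    qed
  qed auto
  also have "(\<integral>z. (z\<^sup>2 / 2) powr p / p \<partial>std_normal_distribution) = Gamma (b + 3/2) / ((b + 1) * sqrt pi)"
    using gauss_abs_moment(2)[OF p] by (simp add: p_def add_ac)
  finally show ?thesis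
    unfolding filterlim_at_right_to_top
  proof (rule Lim_transform_eventually)
    show "\<forall>\<^sub>F t in at_top. integral\<^sup>L std_normal_distribution (?s t) =
      inverse t powr (2 * (b + 1)) * (\<Sum>m. weight b m * gauss_tail (inverse t * sqrt (2 * loglog m)))"
      using eventually_gt_at_top[of 0]
    proof eventually_elim
      case (elim t)
      have "inverse t powr (2 * p) = t powr (-2 * p)" using elim by (simp add: powr_minus inverse_powr)
      moreover have "z\<^sup>2 / 2 / (inverse t)\<^sup>2 = z\<^sup>2 / 2 * t\<^sup>2" for z :: real
        by (metis power_inverse inverse_inverse_eq divide_inverse)
      moreover have "(\<Sum>m. weight b m * gauss_tail (inverse t * sqrt (2 * loglog m))) =
          (\<integral>z. cum_weight b (z\<^sup>2 / 2 / (inverse t)\<^sup>2) \<partial>std_normal_distribution)"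
        using elim by (intro gauss_tail_sum(2)[OF b]) simp
      ultimately show ?case by (simp only: p_def integral_mult_right_zero)
    qed
  qed
qed

section \<open>The alternating tail series of the maximum\<close>

text \<open>Equals \<open>sgn (cos (\<pi> w / 2))\<close> except at the odd integers, where the values are chosen such that
  the layer decomposition below holds everywhere.\<close>

definition square_wave :: "real \<Rightarrow> real" where
  "square_wave w = (- 1) ^ nat \<lfloor>(\<bar>w\<bar> + 1) / 2\<rfloor>"

lemma measurable_square_wave [measurable]: "square_wave \<in> borel_measurable borel"
  unfolding square_wave_def by measurable

lemma abs_square_wave [simp]: "\<bar>square_wave w\<bar> = 1"
  by (simp add: square_wave_def power_abs)

text \<open>The number \<open>nat \<lfloor>(\<bar>w\<bar> + 1) / 2\<rfloor>\<close> counts the odd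
  positive integers up to \<open>\<bar>w\<bar>\<close>. Exactly these layers are active and they
  come first, so the alternating sum runs through 1, 0, 1, 0 and then stays constant.\<close>

lemma sum_square_wave_layers:
  "(\<Sum>k<m. (- 1) ^ k * of_bool (real (2 * k + 1) \<le> \<bar>w\<bar>)) = (of_bool (odd (min m (nat \<lfloor>(\<bar>w\<bar> + 1) / 2\<rfloor>))) :: real)"
proof (induction m)
  case (Suc m)
  let ?q = "nat \<lfloor>(\<bar>w\<bar> + 1) / 2\<rfloor>"
  have "real (2 * m + 1) \<le> \<bar>w\<bar> \<longleftrightarrow> real_of_int (int m + 1) \<le> (\<bar>w\<bar> + 1) / 2" by (auto simp: field_simps)
  also have "\<dots> \<longleftrightarrow> int m + 1 \<le> \<lfloor>(\<bar>w\<bar> + 1) / 2\<rfloor>" by (subst le_floor_iff) simp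
  also have "\<dots> \<longleftrightarrow> m < ?q" by linarith
  finally have *: "real (2 * m + 1) \<le> \<bar>w\<bar> \<longleftrightarrow> m < ?q" .
  show ?case
  proof (cases "m < ?q")
    case True
    then have "min m ?q = m" "min (Suc m) ?q = Suc m" by auto
    then show ?thesis unfolding sum.lessThan_Suc Suc.IH * using True by simp
  next
    case False
    then have "min m ?q = ?q" "min (Suc m) ?q = ?q" by auto
    then show ?thesis unfolding sum.lessThan_Suc Suc.IH * using False by simp
  qed
qed simp

lemma one_minus_square_wave: "1 - square_wave w = 2 * of_bool (odd (nat \<lfloor>(\<bar>w\<bar> + 1) / 2\<rfloor>))"
  by (auto simp: square_wave_def)

text \<open>Stopping early changes the value only if the cut precedes the last active layer; then an
  even cut gives 0 and an odd cut gives 1, the extreme values of the parity indicator.\<close>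

lemma square_wave_lower: "2 * (\<Sum>k<2 * J. (- 1) ^ k * of_bool (real (2 * k + 1) \<le> \<bar>w\<bar>)) \<le> 1 - square_wave w"
  and square_wave_upper: "1 - square_wave w \<le> 2 * (\<Sum>k<2 * J + 1. (- 1) ^ k * of_bool (real (2 * k + 1) \<le> \<bar>w\<bar>))"
  unfolding sum_square_wave_layers one_minus_square_wave by (auto simp: min_def)

text \<open>Write \<open>\<bar>w\<bar>\<close> as \<open>2 * q + r\<close> with \<open>r\<close> in
  [-1, 1). The shift by \<open>q * pi\<close> contributes the sign \<open>(-1) ^ q\<close>, and the
  remaining cosine is positive unless \<open>r = -1\<close>, which is a zero.\<close>

lemma square_wave_eq_sgn_cos:
  assumes "cos (pi * w / 2) \<noteq> 0"
  shows "square_wave w = sgn (cos (pi * w / 2))"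
proof -
  define q where "q = nat \<lfloor>(\<bar>w\<bar> + 1) / 2\<rfloor>"
  define r where "r = \<bar>w\<bar> - 2 * real q"
  have q: "real q \<le> (\<bar>w\<bar> + 1) / 2" "(\<bar>w\<bar> + 1) / 2 < real q + 1"
  proof -
    have "real q = of_int \<lfloor>(\<bar>w\<bar> + 1) / 2\<rfloor>" by (simp add: q_def of_nat_nat)
    then show "real q \<le> (\<bar>w\<bar> + 1) / 2" "(\<bar>w\<bar> + 1) / 2 < real q + 1" by linarith+
  qed
  then have r: "-1 \<le> r" "r < 1" by (auto simp: r_def field_simps)
  have "cos (pi * w / 2) = cos (pi * \<bar>w\<bar> / 2)"
    by (cases "w \<ge> 0") auto
  also have "pi * \<bar>w\<bar> / 2 = real q * pi + pi * r / 2" by (simp add: r_def field_simps)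
  also have "cos \<dots> = (-1) ^ q * cos (pi * r / 2)" by (simp add: cos_add)
  finally have c: "cos (pi * w / 2) = (-1) ^ q * cos (pi * r / 2)" .
  have "r \<noteq> -1" using assms c by auto
  then have "-1 < r" using r by linarith
  then have "pi * (-1) < pi * r" "pi * r < pi * 1" using r by (intro mult_strict_left_mono; simp)+
  then have "cos (pi * r / 2) > 0" by (intro cos_gt_zero_pi) auto
  moreover have "sgn ((-1) ^ q :: real) = (-1) ^ q" by (cases "even q") auto
  ultimately show ?thesis by (simp add: c sgn_mult square_wave_def q_def[symmetric])
qed

text \<open>This is P(sup |W(t)| \<ge> x over 0 \<le> t \<le> 1) for a Brownian motion W. The
  integral of the square wave is the heat solution on (-x, x) with zero boundary values and initial
  value 1, read at time 1 and position 0 after odd reflection in the endpoints.\<close>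

definition max_tail :: "real \<Rightarrow> real" where
  "max_tail x = (\<integral>z. 1 - square_wave (z / x) \<partial>std_normal_distribution)"

lemma integrable_square_wave [simp]: "integrable std_normal_distribution (\<lambda>z. square_wave (z / x))"
  by (rule gauss.integrable_const_bound[of _ 1]) auto

lemma integral_square_wave_layers:
  assumes x: "x > 0"
  shows "(\<integral>z. (\<Sum>k<m. (- 1) ^ k * of_bool (real (2 * k + 1) \<le> \<bar>z / x\<bar>)) \<partial>std_normal_distribution) =
    (\<Sum>k<m. (- 1) ^ k * gauss_tail (real (2 * k + 1) * x))"
    and "integrable std_normal_distribution (\<lambda>z. \<Sum>k<m. (- 1) ^ k * of_bool (real (2 * k + 1) \<le> \<bar>z / x\<bar>) :: real)"
proof -
  have *: "of_bool (real (2 * k + 1) \<le> \<bar>z / x\<bar>) = (of_bool (real (2 * k + 1) * x \<le> \<bar>z\<bar>) :: real)" for k z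
    using x by (simp add: abs_divide field_simps)
  have i: "integrable std_normal_distribution (\<lambda>z. of_bool (c \<le> \<bar>z\<bar>) :: real)" for c
    by (rule gauss.integrable_const_bound[of _ 1]) auto
  show "integrable std_normal_distribution (\<lambda>z. \<Sum>k<m. (- 1) ^ k * of_bool (real (2 * k + 1) \<le> \<bar>z / x\<bar>) :: real)"
    unfolding * by (intro Bochner_Integration.integrable_sum integrable_mult_right i)
  show "(\<integral>z. (\<Sum>k<m. (- 1) ^ k * of_bool (real (2 * k + 1) \<le> \<bar>z / x\<bar>)) \<partial>std_normal_distribution) =
    (\<Sum>k<m. (- 1) ^ k * gauss_tail (real (2 * k + 1) * x))"
    unfolding * gauss_tail_eq_integral
    by (subst Bochner_Integration.integral_sum) (auto intro!: integrable_mult_right i)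
qed

text \<open>The pointwise enclosures are integrated layer by layer. The case \<open>J = 0\<close>
  already gives nonnegativity and the bound by twice the Gaussian tail.\<close>

lemma max_tail_lower: "x > 0 \<Longrightarrow> 2 * (\<Sum>k<2 * J. (- 1) ^ k * gauss_tail (real (2 * k + 1) * x)) \<le> max_tail x"
  and max_tail_upper: "x > 0 \<Longrightarrow> max_tail x \<le> 2 * (\<Sum>k<2 * J + 1. (- 1) ^ k * gauss_tail (real (2 * k + 1) * x))"
proof -
  assume x: "x > 0"
  show "2 * (\<Sum>k<2 * J. (- 1) ^ k * gauss_tail (real (2 * k + 1) * x)) \<le> max_tail x"
    unfolding max_tail_def integral_square_wave_layers(1)[OF x, symmetric] integral_mult_right_zero[symmetric]
    by (intro integral_mono Bochner_Integration.integrable_diff integrable_mult_right integral_square_wave_layers(2)[OF x] square_wave_lower) auto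
  show "max_tail x \<le> 2 * (\<Sum>k<2 * J + 1. (- 1) ^ k * gauss_tail (real (2 * k + 1) * x))"
    unfolding max_tail_def integral_square_wave_layers(1)[OF x, symmetric] integral_mult_right_zero[symmetric]
    by (intro integral_mono Bochner_Integration.integrable_diff integrable_mult_right integral_square_wave_layers(2)[OF x] square_wave_upper) auto
qed

lemma max_tail_nonneg: "x > 0 \<Longrightarrow> 0 \<le> max_tail x"
  using max_tail_lower[of x 0] by simp

lemma max_tail_le_gauss_tail: "x > 0 \<Longrightarrow> max_tail x \<le> 2 * gauss_tail x"
  using max_tail_upper[of x 0] by simp

lemma eps_sqrt_loglog_pos: "\<epsilon> > 0 \<Longrightarrow> \<epsilon> * sqrt (2 * loglog m) > 0"
  by simp

text \<open>Layer \<open>k\<close> at parameter \<epsilon> is the Gaussian sum at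
  \<open>(2 * k + 1) * \<epsilon>\<close>, so its limit carries the factor
  \<open>(2 * k + 1) powr -p\<close> with \<open>p = 2 * (b + 1)\<close>. Enclosing by finitely many
  layers avoids exchanging the limit with the infinite series, which matters because for b \<le>
  -1/2 that series does not converge absolutely.\<close>

lemma max_tail_sum_limit:
  assumes b: "b > -1"
  shows "((\<lambda>\<epsilon>. \<epsilon> powr (2 * (b + 1)) * (\<Sum>m. weight b m * max_tail (\<epsilon> * sqrt (2 * loglog m))))
     \<longlongrightarrow> 2 / ((b + 1) * sqrt pi) * Gamma (b + 3/2) *
           (\<Sum>k. (-1) ^ k / (real (2 * k + 1)) powr (2 * b + 2))) (at_right 0)"
proof (rule tendstoI)
  fix e :: real assume e: "e > 0"
  define p where "p = 2 * (b + 1)"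
  have p: "p > 0" using b by (simp add: p_def)
  define q where "q = Gamma (b + 3/2) / ((b + 1) * sqrt pi)"
  define H where "H \<epsilon> = \<epsilon> powr p * (\<Sum>m. weight b m * gauss_tail (\<epsilon> * sqrt (2 * loglog m)))" for \<epsilon>
  define F where "F \<epsilon> = \<epsilon> powr p * (\<Sum>m. weight b m * max_tail (\<epsilon> * sqrt (2 * loglog m)))" for \<epsilon>
  define a where "a k = 1 / real (2 * k + 1) powr p" for k
  have H: "(H \<longlongrightarrow> q) (at_right 0)"
    using gauss_tail_sum_limit[OF b] by (simp add: H_def[abs_def] p_def q_def)
  have a0: "a \<longlonglongrightarrow> 0"
  proof -
    have "((\<lambda>x::real. 1 / (2 * x + 1) powr p) \<longlongrightarrow> 0) at_top" using p by real_asymp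
    from filterlim_compose[OF this filterlim_real_sequentially] show ?thesis by (simp add: a_def[abs_def] add_ac)
  qed
  have apos: "0 \<le> a k" for k by (simp add: a_def)
  have adec: "a (Suc k) \<le> a k" for k
    unfolding a_def using p by (intro divide_left_mono powr_mono2) (auto intro!: mult_pos_pos)
  define L where "L = (\<Sum>k. (-1) ^ k * a k)"
  define S where "S m = (\<Sum>k<m. (-1) ^ k * a k)" for m
  have lim: "2 / ((b + 1) * sqrt pi) * Gamma (b + 3/2) * (\<Sum>k. (-1) ^ k / (real (2 * k + 1)) powr (2 * b + 2)) = 2 * q * L"
    by (simp add: q_def L_def a_def p_def)
  have S1: "(\<lambda>n. 2 * q * S (2 * n)) \<longlonglongrightarrow> 2 * q * L"
    using summable_Leibniz'(3)[OF a0 apos adec] unfolding S_def L_def by (intro tendsto_mult tendsto_const)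
  have S2: "(\<lambda>n. 2 * q * S (2 * n + 1)) \<longlonglongrightarrow> 2 * q * L"
    using summable_Leibniz'(5)[OF a0 apos adec] unfolding S_def L_def by (intro tendsto_mult tendsto_const)
  \<comment> \<open>One cut-off serves both sides: the even and the odd Leibniz partial sums tend to
    the same limit.\<close>
  obtain J where J: "2 * q * S (2 * J) > 2 * q * L - e" "2 * q * S (2 * J + 1) < 2 * q * L + e"
  proof -
    have "\<forall>\<^sub>F n in sequentially. 2 * q * S (2 * n) > 2 * q * L - e \<and> 2 * q * S (2 * n + 1) < 2 * q * L + e"
      using e by (intro eventually_conj order_tendstoD(1)[OF S1] order_tendstoD(2)[OF S2]) auto
    then show ?thesis using that by (auto simp: eventually_sequentially)
  qed
  \<comment> \<open>The factor \<open>a k\<close> restores the common prefactor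
    \<open>\<epsilon> powr p\<close>, since \<open>H\<close> at the dilated argument contains the
    power of \<open>(2 * k + 1) * \<epsilon>\<close>.\<close>
  define B where "B m \<epsilon> = 2 * (\<Sum>k<m. (-1) ^ k * (a k * H (real (2 * k + 1) * \<epsilon>)))" for m \<epsilon>
  have Blim: "(B m \<longlongrightarrow> 2 * q * S m) (at_right 0)" for m
  proof -
    have "((\<lambda>\<epsilon>. H (real (2 * k + 1) * \<epsilon>)) \<longlongrightarrow> q) (at_right 0)" for k
    proof (rule filterlim_compose[OF H])
      have "real (2 * k + 1) > 0" by simp
      then show "filterlim (\<lambda>\<epsilon>. real (2 * k + 1) * \<epsilon>) (at_right 0) (at_right 0)"
        by real_asymp
    qed
    then have "(B m \<longlongrightarrow> 2 * (\<Sum>k<m. (-1) ^ k * (a k * q))) (at_right 0)"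
      unfolding B_def by (intro tendsto_intros)
    also have "2 * (\<Sum>k<m. (-1) ^ k * (a k * q)) = 2 * q * S m"
      by (simp add: S_def sum_distrib_left mult_ac)
    finally show ?thesis .
  qed
  have Beq: "B m \<epsilon> = \<epsilon> powr p * (\<Sum>j. weight b j * (2 * (\<Sum>k<m. (-1) ^ k * gauss_tail (real (2 * k + 1) * (\<epsilon> * sqrt (2 * loglog j))))))"
    and Bsm: "summable (\<lambda>j. weight b j * (2 * (\<Sum>k<m. (-1) ^ k * gauss_tail (real (2 * k + 1) * (\<epsilon> * sqrt (2 * loglog j))))))"
    if e: "\<epsilon> > 0" for m \<epsilon>
  proof -
    have sm: "summable (\<lambda>j. weight b j * gauss_tail (real (2 * k + 1) * \<epsilon> * sqrt (2 * loglog j)))" for k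
      using e by (intro gauss_tail_sum(1)[OF b]) (auto intro!: mult_pos_pos)
    have eq: "weight b j * (2 * (\<Sum>k<m. (-1) ^ k * gauss_tail (real (2 * k + 1) * (\<epsilon> * sqrt (2 * loglog j))))) =
        (\<Sum>k<m. 2 * (-1) ^ k * (weight b j * gauss_tail (real (2 * k + 1) * \<epsilon> * sqrt (2 * loglog j))))" for j
      by (simp add: sum_distrib_left mult_ac)
    show "summable (\<lambda>j. weight b j * (2 * (\<Sum>k<m. (-1) ^ k * gauss_tail (real (2 * k + 1) * (\<epsilon> * sqrt (2 * loglog j))))))"
      unfolding eq by (intro summable_sum summable_mult sm)
    have "a k * H (real (2 * k + 1) * \<epsilon>) = \<epsilon> powr p * (\<Sum>j. weight b j * gauss_tail (real (2 * k + 1) * \<epsilon> * sqrt (2 * loglog j)))" for k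
    proof -
      have "a k * H (real (2 * k + 1) * \<epsilon>) = (a k * (real (2 * k + 1) * \<epsilon>) powr p) *
          (\<Sum>j. weight b j * gauss_tail (real (2 * k + 1) * \<epsilon> * sqrt (2 * loglog j)))"
        unfolding H_def by (rule mult.assoc[symmetric])
      also have "a k * (real (2 * k + 1) * \<epsilon>) powr p = \<epsilon> powr p"
        unfolding a_def by (subst powr_mult) auto
      finally show ?thesis .
    qed
    then have "B m \<epsilon> = (\<Sum>k<m. 2 * (-1) ^ k * (\<epsilon> powr p * (\<Sum>j. weight b j * gauss_tail (real (2 * k + 1) * \<epsilon> * sqrt (2 * loglog j)))))"
      unfolding B_def by (simp add: sum_distrib_left mult_ac)
    also have "\<dots> = \<epsilon> powr p * (\<Sum>k<m. \<Sum>j. 2 * (-1) ^ k * (weight b j * gauss_tail (real (2 * k + 1) * \<epsilon> * sqrt (2 * loglog j))))"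
      by (subst suminf_mult[OF sm]) (simp add: sum_distrib_left mult_ac)
    also have "(\<Sum>k<m. \<Sum>j. 2 * (-1) ^ k * (weight b j * gauss_tail (real (2 * k + 1) * \<epsilon> * sqrt (2 * loglog j)))) =
       (\<Sum>j. \<Sum>k<m. 2 * (-1) ^ k * (weight b j * gauss_tail (real (2 * k + 1) * \<epsilon> * sqrt (2 * loglog j))))"
      by (rule suminf_sum[symmetric]) (rule summable_mult[OF sm])
    finally show "B m \<epsilon> = \<epsilon> powr p * (\<Sum>j. weight b j * (2 * (\<Sum>k<m. (-1) ^ k * gauss_tail (real (2 * k + 1) * (\<epsilon> * sqrt (2 * loglog j))))))"
      unfolding eq .
  qed
  have Gsm: "summable (\<lambda>j. weight b j * max_tail (\<epsilon> * sqrt (2 * loglog j)))" if e: "\<epsilon> > 0" for \<epsilon>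
  proof (rule summable_comparison_test'[OF summable_mult[OF gauss_tail_sum(1)[OF b e], of 2], of 0])
    fix j
    have "weight b j * max_tail (\<epsilon> * sqrt (2 * loglog j)) \<le> weight b j * (2 * gauss_tail (\<epsilon> * sqrt (2 * loglog j)))"
      using e by (intro mult_left_mono max_tail_le_gauss_tail eps_sqrt_loglog_pos) auto
    then show "norm (weight b j * max_tail (\<epsilon> * sqrt (2 * loglog j))) \<le> 2 * (weight b j * gauss_tail (\<epsilon> * sqrt (2 * loglog j)))"
      using max_tail_nonneg[OF eps_sqrt_loglog_pos[OF e, of j]] by (simp add: abs_mult mult_ac)
  qed
  have lo: "B (2 * J) \<epsilon> \<le> F \<epsilon>" if e: "\<epsilon> > 0" for \<epsilon>
    unfolding Beq[OF e] F_def
    by (intro mult_left_mono suminf_le Bsm[OF e] Gsm[OF e] max_tail_lower eps_sqrt_loglog_pos e) auto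
  have up: "F \<epsilon> \<le> B (2 * J + 1) \<epsilon>" if e: "\<epsilon> > 0" for \<epsilon>
    unfolding Beq[OF e] F_def
    by (intro mult_left_mono suminf_le Bsm[OF e] Gsm[OF e] max_tail_upper eps_sqrt_loglog_pos e) auto
  have "\<forall>\<^sub>F \<epsilon> in at_right 0. 2 * q * L - e < B (2 * J) \<epsilon>"
    by (rule order_tendstoD(1)[OF Blim J(1)])
  moreover have "\<forall>\<^sub>F \<epsilon> in at_right 0. B (2 * J + 1) \<epsilon> < 2 * q * L + e"
    by (rule order_tendstoD(2)[OF Blim J(2)])
  ultimately have "\<forall>\<^sub>F \<epsilon> in at_right 0. dist (F \<epsilon>) (2 * q * L) < e"
    using eventually_at_right_less[of 0]
  proof eventually_elim
    case (elim \<epsilon>)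
    then show ?case using lo[of \<epsilon>] up[of \<epsilon>] by (auto simp: dist_real_def abs_less_iff)
  qed
  then show "\<forall>\<^sub>F \<epsilon> in at_right 0. dist (\<epsilon> powr (2 * (b + 1)) * (\<Sum>m. weight b m * max_tail (\<epsilon> * sqrt (2 * loglog m))))
     (2 / ((b + 1) * sqrt pi) * Gamma (b + 3/2) *
           (\<Sum>k. (-1) ^ k / (real (2 * k + 1)) powr (2 * b + 2))) < e"
    unfolding lim F_def p_def .
qed

section \<open>Replacing probabilities by their limit profile\<close>

lemma suminf_cum_weight: "(\<lambda>m. if loglog m \<le> u then weight b m else 0) sums cum_weight b u"
proof -
  have "(\<lambda>m. if loglog m \<le> u then weight b m else 0) sums (\<Sum>m | loglog m \<le> u. if loglog m \<le> u then weight b m else 0)"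
    by (rule sums_finite) auto
  then show ?thesis by (simp add: cum_weight_def)
qed

text \<open>The indices are split by the size of \<open>\<epsilon>\<^sup>2 * loglog m\<close>: up to
  \<theta> the difference is at most 2 and the weight is small, between \<theta> and
  \<open>T\<close> the local uniformity \<open>close\<close> applies, and beyond \<open>T\<close>
  both tails are small. The summable sequence \<open>r\<close> accommodates errors that do not
  shrink with \<epsilon>; the prefactor removes them.\<close>

lemma precise_rate_comparison:
  fixes P :: "nat \<Rightarrow> real \<Rightarrow> real" and G :: "real \<Rightarrow> real"
  assumes b: "b > -1"
    and P0: "\<And>m \<epsilon>. 0 \<le> P m \<epsilon>" and P1: "\<And>m \<epsilon>. P m \<epsilon> \<le> 1"
    and G0: "\<And>x. x > 0 \<Longrightarrow> 0 \<le> G x" and G2: "\<And>x. x > 0 \<Longrightarrow> G x \<le> 2"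
    and close: "\<And>\<alpha> \<beta> \<eta>. 0 < \<alpha> \<Longrightarrow> \<alpha> < \<beta> \<Longrightarrow> 0 < \<eta> \<Longrightarrow> \<exists>N. \<forall>m\<ge>N. \<forall>\<epsilon>>0.
       \<alpha> \<le> \<epsilon> * sqrt (2 * loglog m) \<longrightarrow> \<epsilon> * sqrt (2 * loglog m) \<le> \<beta> \<longrightarrow> \<bar>P m \<epsilon> - G (\<epsilon> * sqrt (2 * loglog m))\<bar> \<le> \<eta>"
    and r: "summable (\<lambda>m. weight b m * r m)" "\<And>m. 0 \<le> r m"
    and e0: "\<epsilon>0 > 0" and C: "C \<ge> 0" "C' \<ge> 0"
    and tailP: "\<And>m \<epsilon>. 0 < \<epsilon> \<Longrightarrow> \<epsilon> < \<epsilon>0 \<Longrightarrow> T0 \<le> \<epsilon>\<^sup>2 * loglog m \<Longrightarrow> P m \<epsilon> \<le> C * (\<epsilon>\<^sup>2 * loglog m) powr -(b + 2) + r m"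
    and tailG: "\<And>m \<epsilon>. 0 < \<epsilon> \<Longrightarrow> G (\<epsilon> * sqrt (2 * loglog m)) \<le> C' * (\<epsilon>\<^sup>2 * loglog m) powr -(b + 2)"
    and lim: "((\<lambda>\<epsilon>. \<epsilon> powr (2 * (b + 1)) * (\<Sum>m. weight b m * G (\<epsilon> * sqrt (2 * loglog m)))) \<longlongrightarrow> q) (at_right 0)"
  shows "\<forall>\<^sub>F \<epsilon> in at_right 0. summable (\<lambda>m. weight b m * P m \<epsilon>)"
    and "((\<lambda>\<epsilon>. \<epsilon> powr (2 * (b + 1)) * (\<Sum>m. weight b m * P m \<epsilon>)) \<longlongrightarrow> q) (at_right 0)"
proof -
  define p where "p = b + 1"
  have p: "p > 0" using b by (simp add: p_def)
  define d where "d m \<epsilon> = \<bar>P m \<epsilon> - G (\<epsilon> * sqrt (2 * loglog m))\<bar>" for m \<epsilon>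
  obtain W where W: "W > 0" "\<And>u. cum_weight b u \<le> W * u powr p"
    using cum_weight_bound[OF b] unfolding p_def by blast
  define R where "R = (\<Sum>m. weight b m * r m)"
  have pw: "(\<epsilon>\<^sup>2) powr x = \<epsilon> powr (2 * x)" if "\<epsilon> > 0" for \<epsilon> x :: real
    using that powr_powr[of \<epsilon> 2 x] by simp
  have Gsm: "summable (\<lambda>m. weight b m * G (\<epsilon> * sqrt (2 * loglog m)))" if e: "\<epsilon> > 0" for \<epsilon>
  proof (rule summable_comparison_test'[OF summable_mult[OF weight_tail(1)[of b], of "C' * (\<epsilon>\<^sup>2) powr -(b+2)"], of 0])
    fix m
    have "weight b m * G (\<epsilon> * sqrt (2 * loglog m)) \<le> weight b m * (C' * (\<epsilon>\<^sup>2 * loglog m) powr -(b + 2))"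
      by (intro mult_left_mono tailG e) auto
    also have "(\<epsilon>\<^sup>2 * loglog m) powr -(b + 2) = (\<epsilon>\<^sup>2) powr -(b+2) * loglog m powr -(b+2)"
      by (simp add: powr_mult)
    finally show "norm (weight b m * G (\<epsilon> * sqrt (2 * loglog m))) \<le> C' * (\<epsilon>\<^sup>2) powr -(b+2) * (weight b m * loglog m powr -(b + 2))"
      using G0[OF eps_sqrt_loglog_pos[OF e, of m]] by (simp add: abs_mult mult_ac)
  qed
  have main: "\<forall>\<^sub>F \<epsilon> in at_right 0. summable (\<lambda>m. weight b m * d m \<epsilon>) \<and> \<epsilon> powr (2 * p) * (\<Sum>m. weight b m * d m \<epsilon>) \<le> e"
    if e: "e > 0" for e
  proof -
    \<comment> \<open>The parameters \<theta>, \<open>T\<close> and \<eta> are chosen so that each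
      region contributes at most \<open>e / 4\<close>; the last quarter is for
      \<open>R\<close>.\<close>
    define \<theta> where "\<theta> = (e / (8 * W)) powr (1 / p)"
    have th: "\<theta> > 0" "2 * (W * \<theta> powr p) = e / 4"
      using e W p by (auto simp: \<theta>_def powr_powr field_simps)
    \<comment> \<open>The three entries secure the validity of the tail bound,
      \<open>T > \<theta>\<close>, and \<open>(C + C') * (2 / T) \<le> e / 4\<close>.\<close>
    define T where "T = max (max T0 (\<theta> + 1)) (8 * (C + C') / e)"
    have T: "T \<ge> T0" "T > \<theta>" "T > 0" using th by (auto simp: T_def)
    have T4: "(C + C') * (2 / T) \<le> e / 4"
    proof -
      have "T \<ge> 8 * (C + C') / e" by (simp add: T_def)
      then show ?thesis using e T by (simp add: field_simps)
    qed
    define \<eta> where "\<eta> = e / (4 * (W * T powr p))"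
    have eta: "\<eta> > 0" "\<eta> * (W * T powr p) = e / 4" using e W T by (auto simp: \<eta>_def)
    obtain N where N: "\<And>m \<epsilon>. m \<ge> N \<Longrightarrow> \<epsilon> > 0 \<Longrightarrow> sqrt (2 * \<theta>) \<le> \<epsilon> * sqrt (2 * loglog m) \<Longrightarrow> \<epsilon> * sqrt (2 * loglog m) \<le> sqrt (2 * T)
        \<Longrightarrow> d m \<epsilon> \<le> \<eta>"
      using close[of "sqrt (2 * \<theta>)" "sqrt (2 * T)" \<eta>] th T eta by (auto simp: d_def)
    have inv: "filterlim (\<lambda>\<epsilon>::real. c / \<epsilon>\<^sup>2) at_top (at_right 0)" if "c > 0" for c
      using that by real_asymp
    have "\<forall>\<^sub>F \<epsilon> in at_right 0. \<epsilon> powr (2 * p) * R < e / 4"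
    proof -
      have "((\<lambda>\<epsilon>. \<epsilon> powr (2 * p) * R) \<longlongrightarrow> 0) (at_right 0)" using p by real_asymp
      then show ?thesis by (rule order_tendstoD(2)) (use e in auto)
    qed
    \<comment> \<open>For such \<epsilon> every index of the middle region lies beyond
      \<open>N\<close>, so uniform closeness is available there.\<close>
    moreover have "\<forall>\<^sub>F \<epsilon> in at_right 0. loglog N < \<theta> / \<epsilon>\<^sup>2"
      using inv[OF th(1)] unfolding filterlim_at_top_dense by blast
    moreover have "\<forall>\<^sub>F \<epsilon> in at_right 0. (\<Sum>m. (if loglog m > T / \<epsilon>\<^sup>2 then weight b m * loglog m powr (-(b + 2)) else 0)) \<le> 2 / (T / \<epsilon>\<^sup>2)"
      by (rule eventually_compose_filterlim[OF weight_tail(2) inv[OF T(3)]])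
    moreover have "\<forall>\<^sub>F \<epsilon> in at_right 0. \<epsilon> < \<epsilon>0" using e0 by (auto simp: eventually_at_right_field)
    ultimately show ?thesis using eventually_at_right_less[of 0]
    proof eventually_elim
      case (elim \<epsilon>)
      then have ep: "\<epsilon> > 0" by simp
      then have e2: "\<epsilon>\<^sup>2 > 0" by simp
      \<comment> \<open>\<open>A\<close>, \<open>B\<close> and \<open>Z\<close> are nonnegative
        majorants for the low, middle and high regions; \<open>B\<close> is kept on the low region
        too, where it does no harm.\<close>
      define A where "A m = 2 * (if loglog m \<le> \<theta> / \<epsilon>\<^sup>2 then weight b m else 0)" for m
      define B where "B m = \<eta> * (if loglog m \<le> T / \<epsilon>\<^sup>2 then weight b m else 0)" for m
      define Z where "Z m = ((C + C') * (\<epsilon>\<^sup>2) powr -(b+2)) * (if loglog m > T / \<epsilon>\<^sup>2 then weight b m * loglog m powr -(b+2) else 0) + weight b m * r m" for m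
      have cs: "\<epsilon> * sqrt (2 * loglog m) = sqrt (2 * (\<epsilon>\<^sup>2 * loglog m))" for m
        using ep by (simp add: real_sqrt_mult)
      have le: "weight b m * d m \<epsilon> \<le> A m + B m + Z m" for m
      proof -
        have Zn: "0 \<le> Z m" "0 \<le> A m" "0 \<le> B m"
          using C r(2)[of m] eta by (auto simp: Z_def A_def B_def intro!: add_nonneg_nonneg mult_nonneg_nonneg)
        consider "loglog m \<le> \<theta> / \<epsilon>\<^sup>2" | "\<theta> / \<epsilon>\<^sup>2 < loglog m" "loglog m \<le> T / \<epsilon>\<^sup>2" | "T / \<epsilon>\<^sup>2 < loglog m" by linarith
        then show ?thesis
        proof cases
          case 1
          have "d m \<epsilon> \<le> 2"
            using P0[of m \<epsilon>] P1[of m \<epsilon>] G0[OF eps_sqrt_loglog_pos[OF ep, of m]] G2[OF eps_sqrt_loglog_pos[OF ep, of m]]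
            by (auto simp: d_def abs_le_iff)
          then have "weight b m * d m \<epsilon> \<le> weight b m * 2" by (rule mult_left_mono) simp
          then show ?thesis using 1 Zn by (simp add: A_def)
        next
          case 2
          then have "loglog N < loglog m" using elim by linarith
          then have "m \<ge> N" using loglog_mono[of m N] by (meson linear not_le)
          moreover have "\<theta> \<le> \<epsilon>\<^sup>2 * loglog m" "\<epsilon>\<^sup>2 * loglog m \<le> T" using 2 e2 by (auto simp: field_simps)
          ultimately have "d m \<epsilon> \<le> \<eta>" by (intro N ep) (auto simp: cs)
          then have "weight b m * d m \<epsilon> \<le> weight b m * \<eta>" by (rule mult_left_mono) simp
          then show ?thesis using 2 Zn by (simp add: B_def mult_ac)
        next
          case 3
          then have t: "T \<le> \<epsilon>\<^sup>2 * loglog m" using e2 by (auto simp: field_simps)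
          have "d m \<epsilon> \<le> P m \<epsilon> + G (\<epsilon> * sqrt (2 * loglog m))"
            using P0[of m \<epsilon>] G0[OF eps_sqrt_loglog_pos[OF ep, of m]] by (auto simp: d_def abs_le_iff)
          also have "\<dots> \<le> (C + C') * (\<epsilon>\<^sup>2 * loglog m) powr -(b + 2) + r m"
            using tailP[OF ep, of m] tailG[OF ep, of m] T t elim by (simp add: distrib_right)
          also have "(\<epsilon>\<^sup>2 * loglog m) powr -(b + 2) = (\<epsilon>\<^sup>2) powr -(b+2) * loglog m powr -(b+2)"
            by (simp add: powr_mult)
          finally have "weight b m * d m \<epsilon> \<le> weight b m * ((C + C') * ((\<epsilon>\<^sup>2) powr -(b+2) * loglog m powr -(b+2)) + r m)"
            by (rule mult_left_mono) simp
          also have "\<dots> = Z m" using 3 by (simp add: Z_def distrib_left mult_ac)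
          finally show ?thesis using Zn by simp
        qed
      qed
      have sA: "A sums (2 * cum_weight b (\<theta> / \<epsilon>\<^sup>2))" unfolding A_def by (intro sums_mult suminf_cum_weight)
      have sB: "B sums (\<eta> * cum_weight b (T / \<epsilon>\<^sup>2))" unfolding B_def by (intro sums_mult suminf_cum_weight)
      let ?tl = "\<lambda>m. if loglog m > T / \<epsilon>\<^sup>2 then weight b m * loglog m powr -(b+2) else 0"
      have st: "summable ?tl" by (rule summable_comparison_test'[OF weight_tail(1)[of b], of 0]) auto
      have sZ: "Z sums (((C + C') * (\<epsilon>\<^sup>2) powr -(b+2)) * suminf ?tl + R)"
        unfolding Z_def R_def by (intro sums_add sums_mult summable_sums st r(1))
      note sABZ = sums_add[OF sums_add[OF sA sB] sZ]
      have sd: "summable (\<lambda>m. weight b m * d m \<epsilon>)"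
        by (rule summable_comparison_test'[OF sums_summable[OF sABZ], of 0]) (use le in \<open>auto simp: d_def abs_mult\<close>)
      have "(\<Sum>m. weight b m * d m \<epsilon>) \<le> 2 * cum_weight b (\<theta> / \<epsilon>\<^sup>2) + \<eta> * cum_weight b (T / \<epsilon>\<^sup>2) + (((C + C') * (\<epsilon>\<^sup>2) powr -(b+2)) * suminf ?tl + R)"
        by (rule sums_le[OF _ summable_sums[OF sd] sABZ]) (rule le)
      also have "\<dots> \<le> 2 * (W * (\<theta> / \<epsilon>\<^sup>2) powr p) + \<eta> * (W * (T / \<epsilon>\<^sup>2) powr p) + (((C + C') * (\<epsilon>\<^sup>2) powr -(b+2)) * (2 / (T / \<epsilon>\<^sup>2)) + R)"
        using elim C eta by (intro add_mono mult_left_mono W) (auto intro!: mult_nonneg_nonneg)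
      finally have "\<epsilon> powr (2 * p) * (\<Sum>m. weight b m * d m \<epsilon>) \<le>
         \<epsilon> powr (2 * p) * (2 * (W * (\<theta> / \<epsilon>\<^sup>2) powr p) + \<eta> * (W * (T / \<epsilon>\<^sup>2) powr p) + (((C + C') * (\<epsilon>\<^sup>2) powr -(b+2)) * (2 / (T / \<epsilon>\<^sup>2)) + R))"
        by (rule mult_left_mono) simp
      also have "\<dots> = 2 * (W * \<theta> powr p) + \<eta> * (W * T powr p) + (C + C') * (2 / T) + \<epsilon> powr (2 * p) * R"
      proof -
        have 1: "\<epsilon> powr (2 * p) * (x / \<epsilon>\<^sup>2) powr p = x powr p" if "x > 0" for x
          using that ep by (simp add: powr_divide pw)
        \<comment> \<open>The exponents \<open>2 * p\<close>, \<open>-2 * (b + 2)\<close> and 2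
          cancel; the last one comes from the tail estimate at level
          \<open>T / \<epsilon>\<^sup>2\<close>.\<close>
        have 2: "\<epsilon> powr (2 * p) * ((\<epsilon>\<^sup>2) powr -(b+2) * \<epsilon>\<^sup>2) = 1"
        proof -
          have "\<epsilon>\<^sup>2 = \<epsilon> powr 2" using ep by simp
          then have "\<epsilon> powr (2 * p) * ((\<epsilon>\<^sup>2) powr -(b+2) * \<epsilon>\<^sup>2) = \<epsilon> powr (2 * p + 2 * (-(b+2)) + 2)"
            using ep by (simp only: pw powr_add powr_powr mult.assoc)
          also have "2 * p + 2 * (-(b+2)) + 2 = 0" by (simp add: p_def)
          finally show ?thesis using ep by simp
        qed
        have "\<epsilon> powr (2 * p) * (2 * (W * (\<theta> / \<epsilon>\<^sup>2) powr p) + \<eta> * (W * (T / \<epsilon>\<^sup>2) powr p) + (((C + C') * (\<epsilon>\<^sup>2) powr -(b+2)) * (2 / (T / \<epsilon>\<^sup>2)) + R))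
          = 2 * (W * (\<epsilon> powr (2 * p) * (\<theta> / \<epsilon>\<^sup>2) powr p)) + \<eta> * (W * (\<epsilon> powr (2 * p) * (T / \<epsilon>\<^sup>2) powr p)) +
            (C + C') * (2 / T) * (\<epsilon> powr (2 * p) * ((\<epsilon>\<^sup>2) powr -(b+2) * \<epsilon>\<^sup>2)) + \<epsilon> powr (2 * p) * R"
          by (simp add: algebra_simps add_divide_distrib)
        then show ?thesis using 1[OF th(1)] 1[OF T(3)] 2 by simp
      qed
      also have "\<dots> \<le> e" using th eta T4 elim by linarith
      finally show ?case using sd by blast
    qed
  qed
  have eq: "summable (\<lambda>m. weight b m * P m \<epsilon>) \<and> \<bar>(\<Sum>m. weight b m * P m \<epsilon>) - (\<Sum>m. weight b m * G (\<epsilon> * sqrt (2 * loglog m)))\<bar> \<le> (\<Sum>m. weight b m * d m \<epsilon>)"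
    if e: "\<epsilon> > 0" and s: "summable (\<lambda>m. weight b m * d m \<epsilon>)" for \<epsilon>
  proof -
    let ?D = "\<lambda>m. weight b m * (P m \<epsilon> - G (\<epsilon> * sqrt (2 * loglog m)))"
    have n: "norm (?D m) = weight b m * d m \<epsilon>" for m by (simp add: abs_mult d_def)
    have sn: "summable (\<lambda>m. norm (?D m))" using s by (simp only: n)
    have sD: "summable ?D" by (rule summable_norm_cancel[OF sn])
    have "summable (\<lambda>m. ?D m + weight b m * G (\<epsilon> * sqrt (2 * loglog m)))" by (rule summable_add[OF sD Gsm[OF e]])
    then have sP: "summable (\<lambda>m. weight b m * P m \<epsilon>)" by (simp add: algebra_simps)
    have "(\<Sum>m. weight b m * P m \<epsilon>) - (\<Sum>m. weight b m * G (\<epsilon> * sqrt (2 * loglog m))) = suminf ?D"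
      by (subst suminf_diff[OF sP Gsm[OF e]]) (simp add: algebra_simps)
    moreover have "norm (suminf ?D) \<le> (\<Sum>m. weight b m * d m \<epsilon>)"
      using summable_norm[OF sn] by (simp only: n)
    ultimately show ?thesis using sP by simp
  qed
  show "\<forall>\<^sub>F \<epsilon> in at_right 0. summable (\<lambda>m. weight b m * P m \<epsilon>)"
    using main[of 1, simplified] eventually_at_right_less[of 0] by eventually_elim (use eq in auto)
  show "((\<lambda>\<epsilon>. \<epsilon> powr (2 * (b + 1)) * (\<Sum>m. weight b m * P m \<epsilon>)) \<longlongrightarrow> q) (at_right 0)"
  proof (rule Lim_transform[OF lim], rule tendstoI)
    fix e :: real assume "e > 0"
    then have "e / 2 > 0" by simp
    from main[OF this] eventually_at_right_less[of 0]
    show "\<forall>\<^sub>F \<epsilon> in at_right 0. dist (\<epsilon> powr (2 * (b + 1)) * (\<Sum>m. weight b m * P m \<epsilon>) -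
       \<epsilon> powr (2 * (b + 1)) * (\<Sum>m. weight b m * G (\<epsilon> * sqrt (2 * loglog m)))) 0 < e"
    proof eventually_elim
      case (elim \<epsilon>)
      have "\<bar>\<epsilon> powr (2 * p) * (\<Sum>m. weight b m * P m \<epsilon>) - \<epsilon> powr (2 * p) * (\<Sum>m. weight b m * G (\<epsilon> * sqrt (2 * loglog m)))\<bar>
        = \<epsilon> powr (2 * p) * \<bar>(\<Sum>m. weight b m * P m \<epsilon>) - (\<Sum>m. weight b m * G (\<epsilon> * sqrt (2 * loglog m)))\<bar>"
        by (simp add: right_diff_distrib[symmetric] abs_mult)
      also have "\<dots> \<le> \<epsilon> powr (2 * p) * (\<Sum>m. weight b m * d m \<epsilon>)"
        using eq[of \<epsilon>] elim by (intro mult_left_mono) auto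
      also have "\<dots> \<le> e / 2" using elim by simp
      finally show ?case using \<open>e > 0\<close> by (simp add: p_def dist_real_def)
    qed
  qed
qed

section \<open>Random walks with unit variance\<close>

locale iid_unit_variance = prob_space M for M :: "'a measure" +
  fixes X :: "nat \<Rightarrow> 'a \<Rightarrow> real"
  assumes rv [measurable]: "\<And>i. X i \<in> borel_measurable M"
    and indep: "indep_vars (\<lambda>_. borel) X UNIV"
    and ident: "\<And>i. distr M borel (X i) = distr M borel (X 0)"
    and int_X0: "integrable M (X 0)" and mean_X0: "expectation (X 0) = 0"
    and int_X0_sq: "integrable M (\<lambda>\<omega>. (X 0 \<omega>)\<^sup>2)" and var_X0: "expectation (\<lambda>\<omega>. (X 0 \<omega>)\<^sup>2) = 1"
begin

abbreviation \<mu> where "\<mu> \<equiv> distr M borel (X 0)"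

sublocale \<mu>: real_distribution \<mu>
  by (rule real_distribution_distr) simp

lemma measurable_psum [measurable]: "psum X n \<in> borel_measurable M"
  unfolding psum_def[abs_def] by measurable

lemma psum_Suc: "psum X (Suc n) \<omega> = psum X n \<omega> + X n \<omega>"
  by (simp add: psum_def)

text \<open>Independence makes the joint law of the past \<open>T\<close> and the new step a
  product. The first form integrates out the new step given the past, as the killed walk requires;
  the second averages over the past for a fixed new step, which yields a recursion in the starting
  point.\<close>

lemma fubini_step:
  fixes H :: "(nat \<Rightarrow> real) \<times> real \<Rightarrow> real"
  assumes H [measurable]: "H \<in> borel_measurable (PiM {..<k} (\<lambda>_. borel) \<Otimes>\<^sub>M borel)"
    and B: "\<And>p. \<bar>H p\<bar> \<le> B"
  defines "T \<equiv> \<lambda>\<omega>. restrict (\<lambda>i. X i \<omega>) {..<k}"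
  shows "(\<integral>\<omega>. H (T \<omega>, X k \<omega>) \<partial>M) = (\<integral>\<omega>. (\<integral>\<xi>. H (T \<omega>, \<xi>) \<partial>\<mu>) \<partial>M)"
    and "(\<integral>\<omega>. H (T \<omega>, X k \<omega>) \<partial>M) = (\<integral>\<xi>. (\<integral>\<omega>. H (T \<omega>, \<xi>) \<partial>M) \<partial>\<mu>)"
proof -
  let ?P = "PiM {..<k} (\<lambda>_. borel :: real measure)" and ?Q = "PiM {k} (\<lambda>_. borel :: real measure)"
  \<comment> \<open>The single variable is packaged as a block indexed by \<open>{k}\<close>, so
    that independence of disjoint blocks applies.\<close>
  define R where "R \<omega> = restrict (\<lambda>i. X i \<omega>) {k}" for \<omega>
  have ind: "indep_var ?P T ?Q R"
    unfolding T_def R_def[abs_def] by (rule indep_var_restrict[OF indep]) auto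
  then have T [measurable]: "T \<in> measurable M ?P" and R [measurable]: "R \<in> measurable M ?Q"
    by (blast dest: indep_var_rv1 indep_var_rv2)+
  have Rk: "R \<omega> k = X k \<omega>" for \<omega> by (simp add: R_def)
  have [measurable]: "(\<lambda>f. f k) \<in> borel_measurable ?Q" by (rule measurable_component_singleton) simp
  let ?N = "distr M ?P T" and ?L = "distr M ?Q R"
  interpret N: prob_space ?N by (rule prob_space_distr) simp
  interpret L: prob_space ?L by (rule prob_space_distr) simp
  interpret NL: pair_prob_space ?N ?L ..
  have eq: "?N \<Otimes>\<^sub>M ?L = distr M (?P \<Otimes>\<^sub>M ?Q) (\<lambda>x. (T x, R x))"
    using ind by (simp add: indep_var_distribution_eq)
  define H' where "H' p = H (fst p, snd p k)" for p :: "(nat \<Rightarrow> real) \<times> (nat \<Rightarrow> real)"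
  have [measurable]: "H' \<in> borel_measurable (?P \<Otimes>\<^sub>M ?Q)"
    unfolding H'_def by measurable
  have setsN: "sets (?N \<Otimes>\<^sub>M ?L) = sets (?P \<Otimes>\<^sub>M ?Q)"
    by (intro sets_pair_measure_cong) auto
  have Hm: "H' \<in> borel_measurable (?N \<Otimes>\<^sub>M ?L)"
    using measurable_cong_sets[OF setsN refl] by measurable
  have int: "integrable (?N \<Otimes>\<^sub>M ?L) H'"
    by (rule NL.P.integrable_const_bound[of _ B]) (use B Hm in \<open>auto simp: H'_def\<close>)
  have inner: "(\<integral>f. g (f k) \<partial>?L) = (\<integral>\<xi>. g \<xi> \<partial>\<mu>)" if [measurable]: "g \<in> borel_measurable borel" for g :: "real \<Rightarrow> real"
  proof -
    have "(\<integral>f. g (f k) \<partial>?L) = (\<integral>\<omega>. g (X k \<omega>) \<partial>M)" by (subst integral_distr) (auto simp: Rk)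
    also have "\<dots> = (\<integral>\<xi>. g \<xi> \<partial>distr M borel (X k))" by (subst integral_distr) auto
    finally show ?thesis unfolding ident[of k] .
  qed
  have "(\<integral>\<omega>. H (T \<omega>, X k \<omega>) \<partial>M) = (\<integral>p. H' p \<partial>(?N \<Otimes>\<^sub>M ?L))"
    unfolding eq by (subst integral_distr) (auto simp: H'_def Rk)
  also have fst: "\<dots> = (\<integral>t. (\<integral>f. H' (t, f) \<partial>?L) \<partial>?N)"
    by (rule NL.integral_fst'[symmetric, OF int])
  also have "\<dots> = (\<integral>t. (\<integral>\<xi>. H (t, \<xi>) \<partial>\<mu>) \<partial>?N)"
    unfolding H'_def fst_conv snd_conv
    by (intro Bochner_Integration.integral_cong refl inner) (simp add: space_PiM)
  also have "\<dots> = (\<integral>\<omega>. (\<integral>\<xi>. H (T \<omega>, \<xi>) \<partial>\<mu>) \<partial>M)"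
    by (subst integral_distr) auto
  finally show "(\<integral>\<omega>. H (T \<omega>, X k \<omega>) \<partial>M) = (\<integral>\<omega>. (\<integral>\<xi>. H (T \<omega>, \<xi>) \<partial>\<mu>) \<partial>M)" .
  have "(\<integral>\<omega>. H (T \<omega>, X k \<omega>) \<partial>M) = (\<integral>p. H' p \<partial>(?N \<Otimes>\<^sub>M ?L))"
    unfolding eq by (subst integral_distr) (auto simp: H'_def Rk)
  also note fst
  also have "(\<integral>t. (\<integral>f. H' (t, f) \<partial>?L) \<partial>?N) = (\<integral>f. (\<integral>t. H' (t, f) \<partial>?N) \<partial>?L)"
    by (rule NL.Fubini_integral[symmetric]) (use int in \<open>simp add: split_def\<close>)
  also have "\<dots> = (\<integral>f. (\<integral>\<omega>. H (T \<omega>, f k) \<partial>M) \<partial>?L)"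
    unfolding H'_def fst_conv snd_conv
    by (intro Bochner_Integration.integral_cong refl integral_distr) auto
  also have "\<dots> = (\<integral>\<xi>. (\<integral>\<omega>. H (T \<omega>, \<xi>) \<partial>M) \<partial>\<mu>)"
    by (rule inner) measurable
  finally show "(\<integral>\<omega>. H (T \<omega>, X k \<omega>) \<partial>M) = (\<integral>\<xi>. (\<integral>\<omega>. H (T \<omega>, \<xi>) \<partial>M) \<partial>\<mu>)" .
qed

lemma psum_restrict: "j \<le> k \<Longrightarrow> (\<Sum>i<j. restrict (\<lambda>i. X i \<omega>) {..<k} i) = psum X j \<omega>"
  unfolding psum_def by (rule sum.cong) auto

lemma measurable_partial_sum_PiM:
  "j \<le> k \<Longrightarrow> (\<lambda>p. \<Sum>i<j. fst p i) \<in> borel_measurable (PiM {..<k} (\<lambda>_. borel :: real measure) \<Otimes>\<^sub>M N)"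
  for j k :: nat and N :: "real measure"
proof -
  assume j: "j \<le> k"
  have "(\<lambda>p. fst p i) \<in> borel_measurable (PiM {..<k} (\<lambda>_. borel :: real measure) \<Otimes>\<^sub>M N)" if "i \<in> {..<j}" for i
    by (rule measurable_compose[OF measurable_fst], rule measurable_component_singleton) (use that j in auto)
  from borel_measurable_sum[of "{..<j}" "\<lambda>i p. fst p i", OF this] show ?thesis by simp
qed

end

section \<open>The killed walk and exit probabilities\<close>

text \<open>The expectation of \<open>f\<close> at time \<open>n\<close> of the random walk with step law \<open>\<mu>\<close> started in \<open>y\<close> and killed
  on leaving \<open>(-c, c)\<close>.\<close>

primrec stay :: "real measure \<Rightarrow> real \<Rightarrow> (real \<Rightarrow> real) \<Rightarrow> nat \<Rightarrow> real \<Rightarrow> real" where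
  "stay \<mu> c f 0 y = of_bool (\<bar>y\<bar> < c) * f y"
| "stay \<mu> c f (Suc n) y = of_bool (\<bar>y\<bar> < c) * (\<integral>\<xi>. stay \<mu> c f n (y + \<xi>) \<partial>\<mu>)"

lemma stay_outside: "c \<le> \<bar>y\<bar> \<Longrightarrow> stay \<mu> c f n y = 0"
  by (cases n) auto

lemma (in real_distribution) measurable_stay:
  assumes [measurable]: "f \<in> borel_measurable borel"
  shows "stay M c f n \<in> borel_measurable borel"
proof (induction n)
  case 0 then show ?case by simp
next
  case (Suc n)
  note Suc [measurable]
  have [measurable]: "(\<lambda>(y, \<xi>). stay M c f n (y + \<xi>)) \<in> borel_measurable (borel \<Otimes>\<^sub>M M)"
    by measurable
  show ?case by simp
qed

lemma (in real_distribution) stay_abs_le: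
  assumes [measurable]: "f \<in> borel_measurable borel" and f: "\<And>y. \<bar>f y\<bar> \<le> 1"
  shows "\<bar>stay M c f n y\<bar> \<le> 1"
    and "integrable M (\<lambda>\<xi>. stay M c f n (y + \<xi>))"
proof -
  note measurable_stay[OF assms(1), measurable]
  have i: "integrable M (\<lambda>\<xi>. stay M c f n (y + \<xi>))" if "\<And>y. \<bar>stay M c f n y\<bar> \<le> 1" for y n
    by (rule integrable_const_bound[of _ 1]) (use that in auto)
  have b: "\<bar>stay M c f n y\<bar> \<le> 1" for n y
  proof (induction n arbitrary: y)
    case 0 then show ?case using f by (simp add: abs_mult)
  next
    case (Suc n)
    have "\<bar>\<integral>\<xi>. stay M c f n (y + \<xi>) \<partial>M\<bar> \<le> (\<integral>\<xi>. \<bar>stay M c f n (y + \<xi>)\<bar> \<partial>M)"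
      by (rule integral_abs_bound)
    also have "\<dots> \<le> (\<integral>\<xi>. 1 \<partial>M)"
      by (intro integral_mono integrable_abs i Suc) auto
    finally show ?case using prob_space by (simp add: abs_mult)
  qed
  then show "\<bar>stay M c f n y\<bar> \<le> 1" .
  show "integrable M (\<lambda>\<xi>. stay M c f n (y + \<xi>))" by (rule i[OF b])
qed

context iid_unit_variance
begin

lemma measurable_stay_one [measurable]: "stay \<mu> c (\<lambda>_. 1) n \<in> borel_measurable borel"
  by (rule \<mu>.measurable_stay) simp

text \<open>The left side interpolates between the recursion (\<open>k = 0\<close>) and the survival
  probability (\<open>k = n\<close>). Revealing one more step and averaging over it leaves the value
  unchanged, so the induction runs over the number of revealed steps.\<close>

lemma stay_eq_prob_aux:
  assumes c: "c > 0" and "k \<le> n"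
  shows "(\<integral>\<omega>. of_bool (\<forall>j\<le>k. \<bar>psum X j \<omega>\<bar> < c) * stay \<mu> c (\<lambda>_. 1) (n - k) (psum X k \<omega>) \<partial>M) = stay \<mu> c (\<lambda>_. 1) n 0"
  using \<open>k \<le> n\<close>
proof (induction k)
  case 0
  have "psum X 0 \<omega> = 0" for \<omega> by (simp add: psum_def)
  then show ?case using c by (simp add: prob_space)
next
  case (Suc k)
  define m where "m = n - Suc k"
  have nk: "n - k = Suc m" using Suc by (simp add: m_def)
  let ?T = "\<lambda>\<omega>. restrict (\<lambda>i. X i \<omega>) {..<k}"
  let ?E = "\<lambda>t::nat \<Rightarrow> real. \<forall>j\<le>k. \<bar>\<Sum>i<j. t i\<bar> < c"
  define H where "H = (\<lambda>p::(nat \<Rightarrow> real) \<times> real. of_bool (?E (fst p)) * stay \<mu> c (\<lambda>_. 1) m ((\<Sum>i<k. fst p i) + snd p))"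
  have [measurable]: "j \<le> k \<Longrightarrow> (\<lambda>p. \<Sum>i<j. fst p i) \<in> borel_measurable (PiM {..<k} (\<lambda>_. borel :: real measure) \<Otimes>\<^sub>M (borel :: real measure))" for j
    by (rule measurable_partial_sum_PiM)
  have "Measurable.pred (PiM {..<k} (\<lambda>_. borel :: real measure) \<Otimes>\<^sub>M (borel :: real measure)) (\<lambda>p. \<forall>j\<in>{..k}. \<bar>\<Sum>i<j. fst p i\<bar> < c)"
    by (intro pred_intros_finite) auto
  then have [measurable]: "Measurable.pred (PiM {..<k} (\<lambda>_. borel :: real measure) \<Otimes>\<^sub>M (borel :: real measure)) (\<lambda>p. ?E (fst p))"
    by (simp add: Ball_def)
  have Hm: "H \<in> borel_measurable (PiM {..<k} (\<lambda>_. borel) \<Otimes>\<^sub>M borel)"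
    unfolding H_def by measurable
  have HB: "\<bar>H p\<bar> \<le> 1" for p
    using \<mu>.stay_abs_le(1)[of "\<lambda>_. 1" c m] by (simp add: H_def abs_mult)
  have ET: "?E (?T \<omega>) \<longleftrightarrow> (\<forall>j\<le>k. \<bar>psum X j \<omega>\<bar> < c)" for \<omega>
    by (intro all_cong imp_cong refl) (simp only: psum_restrict)
  have "(\<integral>\<omega>. H (?T \<omega>, X k \<omega>) \<partial>M) = (\<integral>\<omega>. (\<integral>\<xi>. H (?T \<omega>, \<xi>) \<partial>\<mu>) \<partial>M)"
    by (rule fubini_step(1)[OF Hm HB])
  moreover have "(\<integral>\<xi>. H (?T \<omega>, \<xi>) \<partial>\<mu>) = of_bool (\<forall>j\<le>k. \<bar>psum X j \<omega>\<bar> < c) * stay \<mu> c (\<lambda>_. 1) (n - k) (psum X k \<omega>)" for \<omega>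
    unfolding H_def fst_conv snd_conv ET psum_restrict[OF order_refl] nk by auto
  \<comment> \<open>\<open>H\<close> tests only the times up to \<open>k\<close>. The constraint at
    time \<open>Suc k\<close> comes for free, because \<open>stay\<close> vanishes outside the
    interval.\<close>
  moreover have "H (?T \<omega>, X k \<omega>) = of_bool (\<forall>j\<le>Suc k. \<bar>psum X j \<omega>\<bar> < c) * stay \<mu> c (\<lambda>_. 1) (n - Suc k) (psum X (Suc k) \<omega>)" for \<omega>
    unfolding H_def fst_conv snd_conv ET psum_restrict[OF order_refl] psum_Suc[symmetric] m_def
    using stay_outside[of c "psum X (Suc k) \<omega>"] by (auto simp: le_Suc_eq not_less)
  ultimately show ?case using Suc by simp
qed

lemma maxpsum_less_iff: "1 \<le> n \<Longrightarrow> maxpsum X n \<omega> < c \<longleftrightarrow> (\<forall>j\<in>{1..n}. \<bar>psum X j \<omega>\<bar> < c)"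
  unfolding maxpsum_def by (subst Max_less_iff) auto

lemma measurable_maxpsum [measurable]: "1 \<le> n \<Longrightarrow> maxpsum X n \<in> borel_measurable M"
  unfolding maxpsum_def[abs_def] by (intro borel_measurable_Max) auto

lemma prob_maxpsum_less:
  assumes c: "c > 0" and n: "n \<ge> 1"
  shows "prob {\<omega> \<in> space M. maxpsum X n \<omega> < c} = stay \<mu> c (\<lambda>_. 1) n 0"
proof -
  \<comment> \<open>The maximum starts at time 1 while the recursion also tests time 0; there the
    sum is 0 and \<open>c > 0\<close> decides.\<close>
  have iff: "maxpsum X n \<omega> < c \<longleftrightarrow> (\<forall>j\<le>n. \<bar>psum X j \<omega>\<bar> < c)" for \<omega>
  proof -
    have "(\<forall>j\<le>n. \<bar>psum X j \<omega>\<bar> < c) \<longleftrightarrow> (\<forall>j\<in>{1..n}. \<bar>psum X j \<omega>\<bar> < c)"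
    proof safe
      fix j assume *: "\<forall>j\<in>{1..n}. \<bar>psum X j \<omega>\<bar> < c" "j \<le> n"
      then show "\<bar>psum X j \<omega>\<bar> < c" using c by (cases j) (auto simp: psum_def simp del: sum.lessThan_Suc)
    qed auto
    then show ?thesis using n by (simp add: maxpsum_less_iff)
  qed
  have "prob {\<omega> \<in> space M. maxpsum X n \<omega> < c} = (\<integral>\<omega>. indicator {\<omega> \<in> space M. maxpsum X n \<omega> < c} \<omega> \<partial>M)"
    using n by (simp add: measure_restrict_space Int_absorb1 subset_eq)
  also have "\<dots> = (\<integral>\<omega>. of_bool (\<forall>j\<le>n. \<bar>psum X j \<omega>\<bar> < c) * stay \<mu> c (\<lambda>_. 1) (n - n) (psum X n \<omega>) \<partial>M)"
    by (intro Bochner_Integration.integral_cong) (auto simp: indicator_def iff)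
  also have "\<dots> = stay \<mu> c (\<lambda>_. 1) n 0" by (rule stay_eq_prob_aux[OF c order_refl])
  finally show ?thesis .
qed

text \<open>The newest step is absorbed into the starting point \<open>y\<close>. This is the shape
  of the recursion for \<open>stay\<close>, so exit probabilities and one-time tails can be compared
  by a single induction.\<close>

lemma prob_shifted_psum_Suc:
  "prob {\<omega> \<in> space M. s \<le> \<bar>y + psum X (Suc n) \<omega>\<bar>} = (\<integral>\<xi>. prob {\<omega> \<in> space M. s \<le> \<bar>y + \<xi> + psum X n \<omega>\<bar>} \<partial>\<mu>)"
proof -
  let ?T = "\<lambda>\<omega>. restrict (\<lambda>i. X i \<omega>) {..<n}"
  define H where "H = (\<lambda>p::(nat \<Rightarrow> real) \<times> real. of_bool (s \<le> \<bar>y + ((\<Sum>i<n. fst p i) + snd p)\<bar>) :: real)"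
  have [measurable]: "(\<lambda>p. \<Sum>i<n. fst p i) \<in> borel_measurable (PiM {..<n} (\<lambda>_. borel :: real measure) \<Otimes>\<^sub>M (borel :: real measure))"
    by (rule measurable_partial_sum_PiM) simp
  have Hm: "H \<in> borel_measurable (PiM {..<n} (\<lambda>_. borel) \<Otimes>\<^sub>M borel)"
    unfolding H_def by measurable
  have HB: "\<bar>H p\<bar> \<le> 1" for p by (simp add: H_def)
  have p: "prob {\<omega> \<in> space M. P \<omega>} = (\<integral>\<omega>. of_bool (P \<omega>) \<partial>M)" if [measurable]: "Measurable.pred M P" for P
  proof -
    have "prob {\<omega> \<in> space M. P \<omega>} = (\<integral>\<omega>. indicator {\<omega> \<in> space M. P \<omega>} \<omega> \<partial>M)"
      by (simp add: Int_absorb1 subset_eq)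
    also have "\<dots> = (\<integral>\<omega>. of_bool (P \<omega>) \<partial>M)"
      by (intro Bochner_Integration.integral_cong) (auto simp: indicator_def)
    finally show ?thesis .
  qed
  have "(\<integral>\<omega>. H (?T \<omega>, X n \<omega>) \<partial>M) = (\<integral>\<xi>. (\<integral>\<omega>. H (?T \<omega>, \<xi>) \<partial>M) \<partial>\<mu>)"
    by (rule fubini_step(2)[OF Hm HB])
  then show ?thesis
    unfolding H_def fst_conv snd_conv psum_restrict[OF order_refl] psum_Suc[symmetric]
    by (simp add: p add_ac)
qed

lemma X_moments:
  "integrable M (X i)" "expectation (X i) = 0" "integrable M (\<lambda>\<omega>. (X i \<omega>)\<^sup>2)" "expectation (\<lambda>\<omega>. (X i \<omega>)\<^sup>2) = 1"
proof -
  have a: "integrable M (\<lambda>\<omega>. g (X i \<omega>)) \<longleftrightarrow> integrable M (\<lambda>\<omega>. g (X 0 \<omega>))"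
    "expectation (\<lambda>\<omega>. g (X i \<omega>)) = expectation (\<lambda>\<omega>. g (X 0 \<omega>))"
    if [measurable]: "g \<in> borel_measurable borel" for g :: "real \<Rightarrow> real"
    using integrable_distr_eq[of "X i" M borel g] integrable_distr_eq[of "X 0" M borel g]
      integral_distr[of "X i" M borel g] integral_distr[of "X 0" M borel g] ident[of i] by auto
  show "integrable M (X i)" "expectation (X i) = 0" using a[of "\<lambda>x. x"] int_X0 mean_X0 by auto
  show "integrable M (\<lambda>\<omega>. (X i \<omega>)\<^sup>2)" "expectation (\<lambda>\<omega>. (X i \<omega>)\<^sup>2) = 1"
    using a[of "\<lambda>x. x\<^sup>2"] int_X0_sq var_X0 by auto
qed

lemma prob_abs_psum_le:
  assumes s: "s > 0"
  shows "prob {\<omega> \<in> space M. s \<le> \<bar>psum X n \<omega>\<bar>} \<le> real n / s\<^sup>2"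
proof -
  have "integrable M (\<lambda>\<omega>. (psum X n \<omega>)\<^sup>2) \<and> expectation (\<lambda>\<omega>. (psum X n \<omega>)\<^sup>2) = real n"
  proof (induction n)
    case 0 then show ?case by (simp add: psum_def)
  next
    case (Suc n)
    have "indep_var borel (X n) borel (\<lambda>\<omega>. \<Sum>i\<in>{..<n}. X i \<omega>)"
      by (rule indep_vars_sum) (auto intro: indep_vars_subset[OF indep])
    then have ind: "indep_var borel (X n) borel (psum X n)" by (simp add: psum_def[abs_def])
    have i: "integrable M (psum X n)" unfolding psum_def[abs_def] by (simp add: X_moments)
    have "integrable M (\<lambda>\<omega>. X n \<omega> * psum X n \<omega>)" "expectation (\<lambda>\<omega>. X n \<omega> * psum X n \<omega>) = 0"
      using indep_var_integrable[OF ind X_moments(1) i] indep_var_lebesgue_integral[OF ind X_moments(1) i]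
      by (simp_all add: X_moments)
    moreover have "(psum X (Suc n) \<omega>)\<^sup>2 = (psum X n \<omega>)\<^sup>2 + (X n \<omega>)\<^sup>2 + 2 * (X n \<omega> * psum X n \<omega>)" for \<omega>
      by (simp add: psum_Suc power2_sum)
    ultimately show ?case using Suc X_moments by simp
  qed
  then have "prob {\<omega> \<in> space M. (psum X n \<omega>)\<^sup>2 \<ge> s\<^sup>2} \<le> real n / s\<^sup>2"
    using integral_Markov_inequality_measure[of M "\<lambda>\<omega>. (psum X n \<omega>)\<^sup>2" "{}" "s\<^sup>2"] s by auto
  also have "{\<omega> \<in> space M. (psum X n \<omega>)\<^sup>2 \<ge> s\<^sup>2} = {\<omega> \<in> space M. s \<le> \<bar>psum X n \<omega>\<bar>}"
    using s by (auto simp: abs_le_square_iff[symmetric])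
  finally show ?thesis .
qed

text \<open>Ottaviani's inequality: outside \<open>(-c, c)\<close> the right-hand side is at least 1 by Chebyshev, and inside
  both sides satisfy the same recursion.\<close>

lemma exit_prob_le:
  assumes c: "c > 0" and n: "2 * real n \<le> (c / 2)\<^sup>2"
  shows "1 - stay \<mu> c (\<lambda>_. 1) n y \<le> 2 * prob {\<omega> \<in> space M. c / 2 \<le> \<bar>y + psum X n \<omega>\<bar>}"
  using n
proof (induction n arbitrary: y)
  case 0
  show ?case
  proof (cases "\<bar>y\<bar> < c")
    case False
    then have "{\<omega> \<in> space M. c / 2 \<le> \<bar>y + psum X 0 \<omega>\<bar>} = space M" using c by (auto simp: psum_def)
    then show ?thesis using False by (simp add: prob_space)
  qed simp
next
  case (Suc n)
  show ?case
  proof (cases "\<bar>y\<bar> < c")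
    case True
    have i: "integrable \<mu> (\<lambda>\<xi>. stay \<mu> c (\<lambda>_. 1) n (y + \<xi>))" by (rule \<mu>.stay_abs_le) auto
    have [measurable]: "(\<lambda>\<xi>. prob {\<omega> \<in> space M. c / 2 \<le> \<bar>y + \<xi> + psum X n \<omega>\<bar>}) \<in> borel_measurable borel"
      by measurable
    have i2: "integrable \<mu> (\<lambda>\<xi>. prob {\<omega> \<in> space M. c / 2 \<le> \<bar>y + \<xi> + psum X n \<omega>\<bar>})"
      by (rule \<mu>.integrable_const_bound[of _ 1]) auto
    have "1 - stay \<mu> c (\<lambda>_. 1) (Suc n) y = (\<integral>\<xi>. 1 - stay \<mu> c (\<lambda>_. 1) n (y + \<xi>) \<partial>\<mu>)"
      using True i \<mu>.prob_space by simp
    also have "\<dots> \<le> (\<integral>\<xi>. 2 * prob {\<omega> \<in> space M. c / 2 \<le> \<bar>y + \<xi> + psum X n \<omega>\<bar>} \<partial>\<mu>)"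
      using Suc by (intro integral_mono Bochner_Integration.integrable_diff integrable_mult_right i i2) auto
    also have "\<dots> = 2 * prob {\<omega> \<in> space M. c / 2 \<le> \<bar>y + psum X (Suc n) \<omega>\<bar>}"
      by (simp only: integral_mult_right_zero prob_shifted_psum_Suc)
    finally show ?thesis .
  next
    case False
    let ?A = "{\<omega> \<in> space M. c / 2 \<le> \<bar>y + psum X (Suc n) \<omega>\<bar>}"
    let ?B = "{\<omega> \<in> space M. c / 2 \<le> \<bar>psum X (Suc n) \<omega>\<bar>}"
    have "prob ?B \<le> real (Suc n) / (c / 2)\<^sup>2" by (rule prob_abs_psum_le) (use c in auto)
    also have "\<dots> \<le> 1 / 2" using Suc.prems c by (subst pos_divide_le_eq) (auto simp: zero_less_power)
    finally have B: "prob ?B \<le> 1 / 2" .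
    have "c / 2 \<le> \<bar>y + u\<bar> \<or> c / 2 \<le> \<bar>u\<bar>" for u using False by linarith
    then have "prob (space M) \<le> prob (?A \<union> ?B)"
      by (intro finite_measure_mono) auto
    also have "\<dots> \<le> prob ?A + prob ?B" by (rule measure_Un_le) auto
    finally show ?thesis using False B by (simp add: prob_space)
  qed
qed

lemma prob_maxpsum_ge_le:
  assumes c: "c > 0" and n: "n \<ge> 1" "2 * real n \<le> (c / 2)\<^sup>2"
  shows "prob {\<omega> \<in> space M. c \<le> maxpsum X n \<omega>} \<le> 2 * prob {\<omega> \<in> space M. c / 2 \<le> \<bar>psum X n \<omega>\<bar>}"
proof -
  have "{\<omega> \<in> space M. c \<le> maxpsum X n \<omega>} = space M - {\<omega> \<in> space M. maxpsum X n \<omega> < c}" by auto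
  then have "prob {\<omega> \<in> space M. c \<le> maxpsum X n \<omega>} = 1 - stay \<mu> c (\<lambda>_. 1) n 0"
    using n c by (simp add: prob_compl prob_maxpsum_less)
  also have "\<dots> \<le> 2 * prob {\<omega> \<in> space M. c / 2 \<le> \<bar>psum X n \<omega>\<bar>}"
    using exit_prob_le[OF c n(2), of 0] by simp
  finally show ?thesis .
qed

lemma prob_X_eq:
  "prob {\<omega> \<in> space M. u < (X i \<omega>)\<^sup>2} = prob {\<omega> \<in> space M. u < (X 0 \<omega>)\<^sup>2}"
proof -
  have "prob {\<omega> \<in> space M. u < (X j \<omega>)\<^sup>2} = measure (distr M borel (X j)) {x. u < x\<^sup>2}" for j
    by (subst measure_distr) (auto intro!: arg_cong[where f = prob])
  then show ?thesis using ident[of i] by metis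
qed

end

section \<open>Exponential tails after truncation\<close>

lemma exp_le_quadratic:
  fixes u :: real assumes "\<bar>u\<bar> \<le> 1" shows "exp u \<le> 1 + u + u\<^sup>2"
proof (cases "u \<ge> 0")
  case True then show ?thesis using exp_bound[of u] assms by simp
next
  case False
  define v where "v = - u"
  have v: "0 < v" "v \<le> 1" using False assms by (auto simp: v_def)
  \<comment> \<open>For negative arguments the identity (1 + v)(1 - v + v^2) = 1 + v^3 reduces the
    claim to \<open>exp v \<ge> 1 + v\<close>.\<close>
  have "exp v * (1 - v + v\<^sup>2) \<ge> (1 + v) * (1 - v + v\<^sup>2)"
    using v exp_ge_add_one_self[of v] by (intro mult_right_mono) auto
  also have "(1 + v) * (1 - v + v\<^sup>2) = 1 + v ^ 3" by (simp add: algebra_simps power2_eq_square power3_eq_cube)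
  finally have "1 \<le> exp v * (1 - v + v\<^sup>2)" using zero_less_power[OF v(1), of 3] by linarith
  then have "exp (- v) \<le> 1 - v + v\<^sup>2" by (simp add: exp_minus divide_simps mult.commute)
  then show ?thesis by (simp add: v_def)
qed

context iid_unit_variance
begin

text \<open>No centering of the truncated variables is needed: their means are at most \<open>1 / sqrt n\<close> in absolute value.\<close>

lemma exp_moment_truncated:
  assumes n: "n \<ge> 1" and s: "\<bar>s\<bar> = (1::real)"
  defines "Y \<equiv> \<lambda>i \<omega>. s * (if (X i \<omega>)\<^sup>2 \<le> real n then X i \<omega> else 0) / sqrt (real n)"
  shows "integrable M (\<lambda>\<omega>. exp (\<Sum>i<n. Y i \<omega>))" "expectation (\<lambda>\<omega>. exp (\<Sum>i<n. Y i \<omega>)) \<le> exp 2"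
proof -
  have n0: "real n > 0" using n by simp
  have [measurable]: "Y i \<in> borel_measurable M" for i unfolding Y_def by measurable
  have Yb: "\<bar>Y i \<omega>\<bar> \<le> 1" for i \<omega>
  proof -
    have "\<bar>X i \<omega>\<bar> \<le> sqrt (real n)" if "(X i \<omega>)\<^sup>2 \<le> real n" using that real_le_rsqrt abs_le_square_iff
      by (metis real_sqrt_abs real_sqrt_le_iff)
    then show ?thesis using s n0 by (auto simp: Y_def abs_mult divide_le_eq)
  qed
  have iE: "integrable M (\<lambda>\<omega>. exp (Y i \<omega>))" for i
    by (rule integrable_const_bound[of _ "exp 1"]) (use Yb in \<open>auto simp: abs_le_iff\<close>)
  have iY: "integrable M (Y i)" for i
    by (rule integrable_const_bound[of _ 1]) (use Yb in auto)
  have iY2: "integrable M (\<lambda>\<omega>. (Y i \<omega>)\<^sup>2)" for i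
    by (rule integrable_const_bound[of _ 1]) (use Yb in \<open>auto simp: abs_square_le_1\<close>)
  have EY: "expectation (\<lambda>\<omega>. exp (Y i \<omega>)) \<le> exp (2 / real n)" for i
  proof -
    have "expectation (\<lambda>\<omega>. exp (Y i \<omega>)) \<le> expectation (\<lambda>\<omega>. 1 + Y i \<omega> + (Y i \<omega>)\<^sup>2)"
      by (intro integral_mono iE) (use iY iY2 exp_le_quadratic Yb in auto)
    also have "\<dots> = 1 + expectation (Y i) + expectation (\<lambda>\<omega>. (Y i \<omega>)\<^sup>2)"
      using iY iY2 by (simp add: prob_space)
    also have "expectation (\<lambda>\<omega>. (Y i \<omega>)\<^sup>2) \<le> expectation (\<lambda>\<omega>. (X i \<omega>)\<^sup>2 / real n)"
    proof (intro integral_mono iY2)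
      show "integrable M (\<lambda>\<omega>. (X i \<omega>)\<^sup>2 / real n)" using X_moments by simp
      have "s\<^sup>2 = 1" using s by (metis one_power2 power2_abs)
      then show "(Y i \<omega>)\<^sup>2 \<le> (X i \<omega>)\<^sup>2 / real n" for \<omega>
        using n0 by (auto simp: Y_def power_divide power_mult_distrib)
    qed
    also have "\<dots> = 1 / real n" using X_moments by simp
    also have "expectation (Y i) \<le> 1 / real n"
    proof -
      \<comment> \<open>Since \<open>X i\<close> has mean 0, subtracting it changes nothing, and the
        difference lives only where the truncation acts. There
        \<open>a = \<bar>X i \<omega>\<bar> / sqrt (real n)\<close> is at least 1, so
        \<open>a\<close> is bounded by its square.\<close>
      have "expectation (Y i) = expectation (\<lambda>\<omega>. Y i \<omega> - s / sqrt (real n) * X i \<omega>)"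
        using iY X_moments by simp
      also have "\<dots> \<le> expectation (\<lambda>\<omega>. (X i \<omega>)\<^sup>2 / real n)"
      proof (rule integral_mono)
        show "integrable M (\<lambda>\<omega>. (X i \<omega>)\<^sup>2 / real n)" "integrable M (\<lambda>\<omega>. Y i \<omega> - s / sqrt (real n) * X i \<omega>)"
          using X_moments iY by auto
        fix \<omega>
        show "Y i \<omega> - s / sqrt (real n) * X i \<omega> \<le> (X i \<omega>)\<^sup>2 / real n"
        proof (cases "(X i \<omega>)\<^sup>2 \<le> real n")
          case True then show ?thesis using n0 by (simp add: Y_def)
        next
          case False
          define a where "a = \<bar>X i \<omega>\<bar> / sqrt (real n)"
          have a2: "a\<^sup>2 = (X i \<omega>)\<^sup>2 / real n" using n0 by (simp add: a_def power_divide)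
          have "a \<ge> 1"
          proof (rule ccontr)
            assume "\<not> a \<ge> 1"
            moreover have "a \<ge> 0" by (simp add: a_def)
            ultimately have "a\<^sup>2 \<le> 1" by (simp add: abs_square_le_1)
            then show False using False n0 a2 by (simp add: divide_le_eq)
          qed
          have "- (s * X i \<omega>) \<le> \<bar>s * X i \<omega>\<bar>" by (rule abs_ge_minus_self)
          also have "\<dots> = \<bar>X i \<omega>\<bar>" using s by (simp add: abs_mult)
          finally have "- (s * X i \<omega>) / sqrt (real n) \<le> \<bar>X i \<omega>\<bar> / sqrt (real n)"
            by (rule divide_right_mono) simp
          then have "Y i \<omega> - s / sqrt (real n) * X i \<omega> \<le> a"
            using False by (simp add: Y_def a_def)
          also have "a \<le> a\<^sup>2" using \<open>a \<ge> 1\<close> by (simp add: power2_eq_square)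
          finally show ?thesis by (simp add: a2)
        qed
      qed
      also have "\<dots> = 1 / real n" using X_moments by simp
      finally show ?thesis .
    qed
    also have "1 + 1 / real n + 1 / real n = 1 + 2 / real n" by (simp add: field_simps)
    also have "\<dots> \<le> exp (2 / real n)" by (rule exp_ge_add_one_self)
    finally show ?thesis by simp
  qed
  have ind: "indep_vars (\<lambda>_. borel) (\<lambda>i \<omega>. exp (Y i \<omega>)) {..<n}"
    unfolding Y_def by (rule indep_vars_compose2[OF indep_vars_subset[OF indep]]) auto
  have eq: "exp (\<Sum>i<n. Y i \<omega>) = (\<Prod>i<n. exp (Y i \<omega>))" for \<omega> by (simp add: exp_sum)
  show "integrable M (\<lambda>\<omega>. exp (\<Sum>i<n. Y i \<omega>))"
    unfolding eq by (rule indep_vars_integrable[OF _ ind]) (auto simp: iE)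
  have "expectation (\<lambda>\<omega>. exp (\<Sum>i<n. Y i \<omega>)) = (\<Prod>i<n. expectation (\<lambda>\<omega>. exp (Y i \<omega>)))"
    unfolding eq by (rule indep_vars_lebesgue_integral[OF _ ind]) (auto simp: iE)
  also have "\<dots> \<le> (\<Prod>i<n. exp (2 / real n))"
    by (intro prod_mono conjI EY) (auto intro!: integral_nonneg_AE)
  also have "\<dots> = exp 2" using n0 by (simp add: exp_of_nat_mult[symmetric])
  finally show "expectation (\<lambda>\<omega>. exp (\<Sum>i<n. Y i \<omega>)) \<le> exp 2" .
qed

text \<open>Unless some summand exceeds sqrt n in absolute value, the sum agrees with its
  truncation. The jumps are handled by a union bound, the truncated sum by Markov's inequality for
  its exponential, once for each sign.\<close>

lemma prob_abs_psum_ge_le: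
  assumes n: "n \<ge> 1"
  shows "prob {\<omega> \<in> space M. y * sqrt (real n) \<le> \<bar>psum X n \<omega>\<bar>} \<le>
    real n * prob {\<omega> \<in> space M. real n < (X 0 \<omega>)\<^sup>2} + 2 * exp 2 * exp (- y)"
proof -
  have n0: "sqrt (real n) > 0" using n by simp
  define Y where "Y s i \<omega> = s * (if (X i \<omega>)\<^sup>2 \<le> real n then X i \<omega> else 0) / sqrt (real n)" for s :: real and i \<omega>
  have [measurable]: "Y s i \<in> borel_measurable M" for s i unfolding Y_def by measurable
  let ?U = "\<Union>i<n. {\<omega> \<in> space M. real n < (X i \<omega>)\<^sup>2}"
  let ?E = "\<lambda>s. {\<omega> \<in> space M. exp y \<le> exp (\<Sum>i<n. Y s i \<omega>)}"
  have E: "prob (?E s) \<le> exp 2 * exp (- y)" if "\<bar>s\<bar> = 1" for s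
  proof -
    have "prob (?E s) \<le> expectation (\<lambda>\<omega>. exp (\<Sum>i<n. Y s i \<omega>)) / exp y"
      by (rule integral_Markov_inequality_measure[where A = "{}"])
         (use exp_moment_truncated(1)[OF n that] in \<open>auto simp: Y_def\<close>)
    also have "\<dots> \<le> exp 2 / exp y"
      using exp_moment_truncated(2)[OF n that] by (intro divide_right_mono) (auto simp: Y_def)
    finally show ?thesis by (simp add: exp_minus field_simps)
  qed
  have "prob {\<omega> \<in> space M. y * sqrt (real n) \<le> \<bar>psum X n \<omega>\<bar>} \<le> prob (?U \<union> (?E 1 \<union> ?E (-1)))"
  proof (rule finite_measure_mono)
    show "{\<omega> \<in> space M. y * sqrt (real n) \<le> \<bar>psum X n \<omega>\<bar>} \<subseteq> ?U \<union> (?E 1 \<union> ?E (-1))"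
    proof
      fix \<omega> assume "\<omega> \<in> {\<omega> \<in> space M. y * sqrt (real n) \<le> \<bar>psum X n \<omega>\<bar>}"
      then have w: "\<omega> \<in> space M" "y * sqrt (real n) \<le> \<bar>psum X n \<omega>\<bar>" by auto
      show "\<omega> \<in> ?U \<union> (?E 1 \<union> ?E (-1))"
      proof (rule ccontr)
        assume "\<not> ?thesis"
        then have U: "\<omega> \<notin> ?U" and E: "\<not> exp y \<le> exp (\<Sum>i<n. Y 1 i \<omega>)" "\<not> exp y \<le> exp (\<Sum>i<n. Y (- 1) i \<omega>)"
          using w by auto
        from U have eq: "(\<Sum>i<n. Y s i \<omega>) = s * psum X n \<omega> / sqrt (real n)" for s
          using w by (auto simp: Y_def psum_def sum_distrib_left sum_divide_distrib not_less intro!: sum.cong)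
        have *: "s * psum X n \<omega> < y * sqrt (real n)" if "\<not> exp y \<le> exp (\<Sum>i<n. Y s i \<omega>)" for s
          using that unfolding eq by (simp add: not_le pos_divide_less_eq[OF n0])
        show False using w *[OF E(1)] *[OF E(2)] by (auto simp: abs_if split: if_splits)
      qed
    qed
  qed auto
  also have "\<dots> \<le> prob ?U + prob (?E 1 \<union> ?E (-1))" by (rule measure_Un_le) auto
  also have "prob (?E 1 \<union> ?E (-1)) \<le> prob (?E 1) + prob (?E (-1))" by (rule measure_Un_le) auto
  also have "prob ?U \<le> (\<Sum>i<n. prob {\<omega> \<in> space M. real n < (X i \<omega>)\<^sup>2})"
    by (rule measure_UNION_le) auto
  also have "\<dots> = real n * prob {\<omega> \<in> space M. real n < (X 0 \<omega>)\<^sup>2}" by (subst sum.cong[OF refl prob_X_eq]) simp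
  finally show ?thesis using E[of 1] E[of "-1"] by simp
qed

text \<open>The factor \<open>Suc m\<close> is cancelled by the weight, leaving a bounded multiple
  of P(X^2 > n). Those probabilities sum to at most E X^2.\<close>

lemma summable_large_jumps: "summable (\<lambda>m. weight b m * (real (Suc m) * prob {\<omega> \<in> space M. real (Suc m) < (X 0 \<omega>)\<^sup>2}))"
proof -
  let ?p = "\<lambda>m. prob {\<omega> \<in> space M. real (Suc m) < (X 0 \<omega>)\<^sup>2}"
  have "((\<lambda>x::real. ln (ln x) powr b / ln x) \<longlongrightarrow> 0) at_top" by real_asymp
  from filterlim_compose[OF this filterlim_Suc_real]
  have "(\<lambda>m. weight b m * real (Suc m)) \<longlonglongrightarrow> 0"
  proof (rule Lim_transform_eventually)
    show "\<forall>\<^sub>F m in sequentially. ln (ln (real (Suc m))) powr b / ln (real (Suc m)) = weight b m * real (Suc m)"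
      using eventually_compose_filterlim[OF eventually_Lg filterlim_Suc_real]
      by eventually_elim (simp add: weight_def loglog_def)
  qed
  then have "Bseq (\<lambda>m. weight b m * real (Suc m))" by (intro convergent_imp_Bseq convergentI)
  then obtain K where K: "K > 0" "\<And>m. norm (weight b m * real (Suc m)) \<le> K" unfolding Bseq_def by blast
  have "summable ?p"
  proof (rule summableI_nonneg_bounded)
    fix N
    \<comment> \<open>At most \<open>x\<close> positive integers lie below \<open>x\<close>; taking
      expectations at \<open>x = (X 0 \<omega>)\<^sup>2\<close> bounds all partial sums at
      once.\<close>
    have pw: "(\<Sum>m<N. of_bool (real (Suc m) < x)) \<le> x" if "x \<ge> 0" for x :: real
    proof -
      have "(\<Sum>m<N. of_bool (real (Suc m) < x)) = real (card {m\<in>{..<N}. real (Suc m) < x})"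
        by (simp add: sum.If_cases of_bool_def Int_def)
      also have "card {m\<in>{..<N}. real (Suc m) < x} \<le> card {..<nat \<lfloor>x\<rfloor>}"
        by (rule card_mono) (auto simp: Suc_le_eq[symmetric] intro!: le_nat_floor)
      also have "real (card {..<nat \<lfloor>x\<rfloor>}) \<le> x" using that by simp
      finally show ?thesis by simp
    qed
    have "?p m = expectation (\<lambda>\<omega>. of_bool (real (Suc m) < (X 0 \<omega>)\<^sup>2))" for m
    proof -
      have "?p m = expectation (indicator {\<omega> \<in> space M. real (Suc m) < (X 0 \<omega>)\<^sup>2})" by (simp add: Int_absorb1 subset_eq)
      also have "\<dots> = expectation (\<lambda>\<omega>. of_bool (real (Suc m) < (X 0 \<omega>)\<^sup>2))"
        by (intro Bochner_Integration.integral_cong) (auto simp: indicator_def)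
      finally show ?thesis .
    qed
    moreover have i: "integrable M (\<lambda>\<omega>. of_bool (real (Suc m) < (X 0 \<omega>)\<^sup>2) :: real)" for m
      by (rule integrable_const_bound[of _ 1]) auto
    ultimately have "(\<Sum>m<N. ?p m) = (\<Sum>m<N. expectation (\<lambda>\<omega>. of_bool (real (Suc m) < (X 0 \<omega>)\<^sup>2)))"
      by (simp only:)
    also have "\<dots> = expectation (\<lambda>\<omega>. \<Sum>m<N. of_bool (real (Suc m) < (X 0 \<omega>)\<^sup>2))"
      by (rule Bochner_Integration.integral_sum[symmetric]) (rule i)
    also have "\<dots> \<le> expectation (\<lambda>\<omega>. (X 0 \<omega>)\<^sup>2)"
      by (intro integral_mono Bochner_Integration.integrable_sum i pw int_X0_sq) auto
    finally show "(\<Sum>m<N. ?p m) \<le> 1" by (simp add: var_X0)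
  qed simp
  then show ?thesis
  proof (rule summable_comparison_test'[OF summable_mult, of _ 0 _ K])
    fix m
    have "weight b m * real (Suc m) * ?p m \<le> K * ?p m" using K(2)[of m] by (intro mult_right_mono) auto
    then show "norm (weight b m * (real (Suc m) * ?p m)) \<le> K * ?p m" by (simp add: abs_mult mult.assoc)
  qed
qed

end

section \<open>The limit law of the maximum\<close>

text \<open>A discrete maximum principle. The function \<open>v\<close> may fall short by \<kappa>
  at time 0, by \<rho> in a layer of width \<open>d\<close> outside the interval, and by
  \<open>e\<close> in each step. The layer catches every exit by a jump of size at most
  \<open>d\<close>; a longer jump costs at most \<open>1 + B\<close> and has probability at most
  \<open>e'\<close>.\<close>

lemma (in real_distribution) stay_compare:
  fixes v :: "nat \<Rightarrow> real \<Rightarrow> real"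
  assumes f [measurable]: "f \<in> borel_measurable borel" and f1: "\<And>y. \<bar>f y\<bar> \<le> 1"
    and v [measurable]: "\<And>k. v k \<in> borel_measurable borel" and vB: "\<And>k y. \<bar>v k y\<bar> \<le> B"
    and init: "\<And>y. \<bar>y\<bar> < c \<Longrightarrow> f y \<le> v 0 y + \<kappa>"
    and bdry: "\<And>k y. c \<le> \<bar>y\<bar> \<Longrightarrow> \<bar>y\<bar> \<le> c + d \<Longrightarrow> - \<rho> \<le> v k y"
    and step: "\<And>k y. (\<integral>\<xi>. v k (y + \<xi>) \<partial>M) \<le> v (Suc k) y + e"
    and jump: "prob {\<xi>. d < \<bar>\<xi>\<bar>} \<le> e'"
    and nn: "0 \<le> \<kappa>" "0 \<le> \<rho>" "0 \<le> e" "0 \<le> d"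
    and y: "\<bar>y\<bar> \<le> c + d"
  shows "stay M c f n y \<le> v n y + \<kappa> + \<rho> + real n * (e + (1 + B) * e')"
  using y
proof (induction n arbitrary: y)
  case 0
  show ?case
  proof (cases "\<bar>y\<bar> < c")
    case True then show ?thesis using init[of y] nn by simp
  next
    case False then show ?thesis using bdry[of y 0] 0 nn by simp
  qed
next
  case (Suc n)
  have B0: "0 \<le> B" using vB[of 0 0] by linarith
  have e0: "0 \<le> e'" using jump measure_nonneg order_trans by blast
  define K where "K = \<kappa> + \<rho> + real n * (e + (1 + B) * e')"
  have K0: "0 \<le> K" using nn B0 e0 by (simp add: K_def)
  have KS: "\<kappa> + \<rho> + real (Suc n) * (e + (1 + B) * e') = K + e + (1 + B) * e'"
    by (simp add: K_def algebra_simps)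
  have Be: "0 \<le> (1 + B) * e'" using B0 e0 by simp
  show ?case
  proof (cases "\<bar>y\<bar> < c")
    case False
    then have "stay M c f (Suc n) y = 0" by simp
    moreover have "0 \<le> v (Suc n) y + \<rho>" using bdry[of y "Suc n"] Suc.prems False by simp
    moreover have "0 \<le> real (Suc n) * (e + (1 + B) * e')" using nn Be by (intro mult_nonneg_nonneg[OF of_nat_0_le_iff] add_nonneg_nonneg)
    ultimately show ?thesis using nn by linarith
  next
    case True
    have iv: "integrable M (\<lambda>\<xi>. v n (y + \<xi>))"
      by (rule integrable_const_bound[of _ B]) (use vB in auto)
    have ij: "integrable M (\<lambda>\<xi>. (1 + B) * of_bool (d < \<bar>\<xi>\<bar>))"
      by (intro integrable_mult_right integrable_const_bound[of _ 1]) auto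
    have ej: "(\<integral>\<xi>. of_bool (d < \<bar>\<xi>\<bar>) \<partial>M) = prob {\<xi>. d < \<bar>\<xi>\<bar>}"
    proof -
      have "(\<integral>\<xi>. of_bool (d < \<bar>\<xi>\<bar>) \<partial>M) = (\<integral>\<xi>. indicator {\<xi>. d < \<bar>\<xi>\<bar>} \<xi> \<partial>M)"
        by (intro Bochner_Integration.integral_cong) (auto simp: indicator_def)
      also have "\<dots> = prob {\<xi>. d < \<bar>\<xi>\<bar>}" by simp
      finally show ?thesis .
    qed
    have "stay M c f (Suc n) y = (\<integral>\<xi>. stay M c f n (y + \<xi>) \<partial>M)" using True by simp
    also have "\<dots> \<le> (\<integral>\<xi>. v n (y + \<xi>) + K + (1 + B) * of_bool (d < \<bar>\<xi>\<bar>) \<partial>M)"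
    proof (rule integral_mono)
      show "integrable M (\<lambda>\<xi>. stay M c f n (y + \<xi>))" by (rule stay_abs_le(2)[OF f f1])
      show "integrable M (\<lambda>\<xi>. v n (y + \<xi>) + K + (1 + B) * of_bool (d < \<bar>\<xi>\<bar>))"
        by (intro Bochner_Integration.integrable_add iv ij) simp
      fix \<xi>
      show "stay M c f n (y + \<xi>) \<le> v n (y + \<xi>) + K + (1 + B) * of_bool (d < \<bar>\<xi>\<bar>)"
      proof (cases "d < \<bar>\<xi>\<bar>")
        case True
        have "stay M c f n (y + \<xi>) \<le> 1" using stay_abs_le(1)[OF f f1, of c n "y + \<xi>"] by linarith
        then show ?thesis using True vB[of n "y + \<xi>"] K0 by simp
      next
        case False
        then have "\<bar>y + \<xi>\<bar> \<le> c + d" using True by linarith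
        from Suc.IH[OF this] show ?thesis using False by (simp add: K_def)
      qed
    qed
    also have "\<dots> = (\<integral>\<xi>. v n (y + \<xi>) \<partial>M) + K + (1 + B) * prob {\<xi>. d < \<bar>\<xi>\<bar>}"
      using iv ij prob_space by (simp add: ej)
    also have "\<dots> \<le> (v (Suc n) y + e) + K + (1 + B) * e'"
      using step[of n y] jump B0 by (intro add_mono mult_left_mono) auto
    finally show ?thesis using KS by linarith
  qed
qed

text \<open>Turns the one-sided comparison into a lower bound as well.\<close>

lemma stay_uminus: "stay M c (\<lambda>y. - f y) n y = - stay M c f n y"
  by (induction n arbitrary: y) auto

text \<open>Killing on the wider interval with the narrower indicator as terminal value gives room
  near the endpoints: a continuous function that vanishes at \<open>c'\<close> can dominate this
  indicator, but not the constant 1.\<close>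

lemma (in real_distribution) stay_mono_width:
  assumes "c \<le> c'"
  shows "stay M c (\<lambda>_. 1) n y \<le> stay M c' (\<lambda>y. of_bool (\<bar>y\<bar> < c)) n y"
proof (induction n arbitrary: y)
  case 0 then show ?case using assms by auto
next
  case (Suc n)
  have nn: "0 \<le> stay M c' (\<lambda>y. of_bool (\<bar>y\<bar> < c)) n y" for n y
    by (induction n arbitrary: y) (auto intro!: integral_nonneg_AE)
  have "(\<integral>\<xi>. stay M c (\<lambda>_. 1) n (y + \<xi>) \<partial>M) \<le> (\<integral>\<xi>. stay M c' (\<lambda>y. of_bool (\<bar>y\<bar> < c)) n (y + \<xi>) \<partial>M)"
    by (intro integral_mono stay_abs_le(2) Suc) auto
  then show ?case using assms nn[of "Suc n" y] by (auto simp: not_less)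
qed

text \<open>With \<open>\<theta> = \<pi> y / (2R)\<close>, odd frequencies vanish at \<open>y = \<plusminus>R\<close> and keep doing so under the heat flow.\<close>

inductive_set oddtrig :: "(real \<Rightarrow> real) set" where
  base: "(\<lambda>\<theta>. cos (real (2 * j + 1) * \<theta>)) \<in> oddtrig"
| add: "f \<in> oddtrig \<Longrightarrow> g \<in> oddtrig \<Longrightarrow> (\<lambda>\<theta>. f \<theta> + g \<theta>) \<in> oddtrig"
| scale: "f \<in> oddtrig \<Longrightarrow> (\<lambda>\<theta>. c * f \<theta>) \<in> oddtrig"

text \<open>Multiplication by the squared cosine shifts a frequency by 0, 2 or -2 and so preserves
  parity. Frequency 1 shifted down becomes -1, which is frequency 1 again because the cosine is
  even.\<close>

lemma oddtrig_cos_sq: "f \<in> oddtrig \<Longrightarrow> (\<lambda>\<theta>. (cos \<theta>)\<^sup>2 * f \<theta>) \<in> oddtrig"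
proof (induction rule: oddtrig.induct)
  case (base j)
  have prod: "(cos \<theta>)\<^sup>2 * cos (N * \<theta>) = 1/2 * cos (N * \<theta>) + (1/4 * cos ((N + 2) * \<theta>) + 1/4 * cos ((N - 2) * \<theta>))" for N \<theta> :: real
  proof -
    have "cos ((N + 2) * \<theta>) + cos ((N - 2) * \<theta>) = 2 * cos (N * \<theta>) * cos (2 * \<theta>)"
      by (simp add: distrib_right left_diff_distrib cos_add cos_diff)
    then have "cos ((N + 2) * \<theta>) + cos ((N - 2) * \<theta>) = 2 * cos (N * \<theta>) * (2 * (cos \<theta>)\<^sup>2 - 1)"
      by (simp only: cos_double_cos)
    then show ?thesis by (simp add: algebra_simps)
  qed
  have 1: "(\<lambda>\<theta>. cos ((real (2 * j + 1) + 2) * \<theta>)) \<in> oddtrig"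
    using oddtrig.base[of "Suc j"] by (simp add: algebra_simps)
  have 2: "(\<lambda>\<theta>. cos ((real (2 * j + 1) - 2) * \<theta>)) \<in> oddtrig"
  proof (cases j)
    case 0 then show ?thesis using oddtrig.base[of 0] by simp
  next
    case (Suc i) then show ?thesis using oddtrig.base[of i] by (simp add: algebra_simps)
  qed
  show ?case unfolding prod by (intro oddtrig.add oddtrig.scale oddtrig.base 1 2)
next
  case (add f g) then show ?case using oddtrig.add by (simp add: distrib_left)
next
  case (scale f c) then show ?case using oddtrig.scale[of _ c] by (simp add: mult.left_commute)
qed

lemma oddtrig_cos_power: "(\<lambda>\<theta>. cos \<theta> ^ (2 * i + 1)) \<in> oddtrig"
proof (induction i)
  case 0 then show ?case using oddtrig.base[of 0] by simp
next
  case (Suc i)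
  from oddtrig_cos_sq[OF this] show ?case by (simp add: power2_eq_square mult.assoc)
qed

lemma oddtrig_sum: "finite I \<Longrightarrow> (\<And>i. i \<in> I \<Longrightarrow> f i \<in> oddtrig) \<Longrightarrow> (\<lambda>\<theta>. \<Sum>i\<in>I. f i \<theta>) \<in> oddtrig"
proof (induction I rule: finite_induct)
  case empty
  show ?case using oddtrig.scale[OF oddtrig.base[of 0], of 0] by simp
qed (use oddtrig.add in auto)

text \<open>The clamp is an odd function of the cosine, so the odd part of a Weierstrass polynomial
  approximates it equally well, and odd powers of the cosine have only odd frequencies.\<close>

lemma oddtrig_approx_clamp:
  assumes k: "\<kappa> > 0"
  obtains f where "f \<in> oddtrig" "\<And>\<theta>. \<bar>f \<theta> - max (-1) (min 1 (s * cos \<theta>))\<bar> \<le> \<kappa>"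
proof -
  let ?c = "\<lambda>x::real. max (-1) (min 1 (s * x))"
  have "continuous_on {-1..1} ?c" by (intro continuous_intros)
  then obtain g where g: "real_polynomial_function g" "\<And>x. x \<in> {-1..1} \<Longrightarrow> \<bar>?c x - g x\<bar> < \<kappa>"
    using Stone_Weierstrass_real_polynomial_function[of "{-1..1::real}" ?c \<kappa>] k by auto
  obtain a n where a: "g = (\<lambda>x. \<Sum>i\<le>n. a i * x ^ i)"
    using real_polynomial_function_imp_sum[OF g(1)] by blast
  define h where "h x = (g x - g (- x)) / 2" for x
  have hh: "h x = (\<Sum>i\<in>{i. i \<le> n \<and> odd i}. a i * x ^ i)" for x
  proof -
    have "h x = (\<Sum>i\<le>n. (a i * x ^ i - a i * (- x) ^ i) / 2)"
      by (simp add: h_def a sum_subtractf[symmetric] sum_divide_distrib[symmetric])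
    also have "\<dots> = (\<Sum>i\<in>{..n}. if odd i then a i * x ^ i else 0)"
      by (intro sum.cong) auto
    also have "\<dots> = (\<Sum>i\<in>{i. i \<le> n \<and> odd i}. a i * x ^ i)"
      by (simp add: sum.If_cases) (intro sum.cong, auto)
    finally show ?thesis .
  qed
  have "(\<lambda>\<theta>. h (cos \<theta>)) \<in> oddtrig"
    unfolding hh
  proof (rule oddtrig_sum)
    fix i assume "i \<in> {i. i \<le> n \<and> odd i}"
    then obtain j where "i = 2 * j + 1" by (auto elim: oddE)
    then show "(\<lambda>\<theta>. a i * cos \<theta> ^ i) \<in> oddtrig" using oddtrig.scale[OF oddtrig_cos_power] by simp
  qed auto
  moreover have "\<bar>h (cos \<theta>) - ?c (cos \<theta>)\<bar> \<le> \<kappa>" for \<theta>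
  proof -
    have 1: "cos \<theta> \<in> {-1..1}" "- cos \<theta> \<in> {-1..1}" by auto
    have "?c (- cos \<theta>) = - ?c (cos \<theta>)" by (auto simp: max_def min_def)
    moreover have "\<bar>(p - q) / 2 - u\<bar> \<le> \<kappa>" if "\<bar>u - p\<bar> < \<kappa>" "\<bar>w - q\<bar> < \<kappa>" "w = - u" for p q u w :: real
      using that by (simp add: abs_le_iff abs_less_iff field_simps)
    ultimately show ?thesis using g(2)[OF 1(1)] g(2)[OF 1(2)] unfolding h_def by blast
  qed
  ultimately show ?thesis using that by blast
qed

section \<open>Heat flow against the rescaled walk\<close>

locale standardized_distribution = real_distribution +
  assumes int_id: "integrable M (\<lambda>x. x)" and mean_id: "expectation (\<lambda>x. x) = 0"
    and int_sq: "integrable M (\<lambda>x. x\<^sup>2)" and second_moment: "expectation (\<lambda>x. x\<^sup>2) = 1"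
begin

text \<open>An error of smaller order than \<open>1 / n\<close> per step is needed, because
  \<open>n\<close> steps accumulate. The Taylor remainder
  \<open>min (6 * x\<^sup>2) (\<bar>t\<bar> * \<bar>x\<bar> ^ 3)\<close> has a majorant independent
  of \<open>t\<close> and vanishes pointwise, so dominated convergence needs only a second
  moment.\<close>

lemma char_rescaled:
  "(\<lambda>n. real n * cmod (char M (l / sqrt (real n)) - exp (- l\<^sup>2 / (2 * real n)))) \<longlonglongrightarrow> 0"
proof -
  let ?t = "\<lambda>n. l / sqrt (real n)"
  define E where "E n = (\<integral>x. min (6 * x\<^sup>2) (\<bar>?t n\<bar> * \<bar>x\<bar> ^ 3) \<partial>M)" for n
  have lim: "(\<lambda>n. min (6 * x\<^sup>2) (\<bar>?t n\<bar> * \<bar>x\<bar> ^ 3)) \<longlonglongrightarrow> 0" for x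
  proof -
    have "(\<lambda>n. \<bar>?t n\<bar> * \<bar>x\<bar> ^ 3) \<longlonglongrightarrow> 0"
    proof -
      have "?t \<longlonglongrightarrow> 0" by real_asymp
      then have "(\<lambda>n. \<bar>?t n\<bar> * \<bar>x\<bar> ^ 3) \<longlonglongrightarrow> \<bar>0\<bar> * \<bar>x\<bar> ^ 3" by (intro tendsto_intros)
      then show ?thesis by simp
    qed
    then have "(\<lambda>n. min (6 * x\<^sup>2) (\<bar>?t n\<bar> * \<bar>x\<bar> ^ 3)) \<longlonglongrightarrow> min (6 * x\<^sup>2) 0" by (intro tendsto_intros)
    moreover have "min (6 * x\<^sup>2) 0 = 0" by simp
    ultimately show ?thesis by (simp only:)
  qed
  have "E \<longlonglongrightarrow> (\<integral>x. 0 \<partial>M)"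
    unfolding E_def
    by (rule integral_dominated_convergence[where w = "\<lambda>x. 6 * x\<^sup>2"]) (use lim int_sq in auto)
  then have E0: "E \<longlonglongrightarrow> 0" by simp
  have var: "variance (\<lambda>x. x) = 1" using mean_id second_moment by simp
  let ?u = "\<lambda>n. l\<^sup>2 / 6 * E n + real n * \<bar>1 - l\<^sup>2 / (2 * real n) - exp (- l\<^sup>2 / (2 * real n))\<bar>"
  have b: "real n * cmod (char M (?t n) - exp (- l\<^sup>2 / (2 * real n))) \<le> ?u n" if n: "n \<ge> 1" for n
  proof -
    have t2: "(?t n)\<^sup>2 = l\<^sup>2 / real n" using n by (simp add: power_divide)
    have "cmod (char M (?t n) - (1 - (?t n)\<^sup>2 * 1 / 2)) \<le> (?t n)\<^sup>2 / 6 * E n"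
      unfolding E_def by (rule char_approx3[OF int_id mean_id int_sq var])
    then have 1: "cmod (char M (?t n) - of_real (1 - l\<^sup>2 / (2 * real n))) \<le> l\<^sup>2 / real n / 6 * E n"
      unfolding t2 by (simp add: mult.commute)
    have "cmod (char M (?t n) - of_real (exp (- l\<^sup>2 / (2 * real n)))) \<le>
      cmod (char M (?t n) - of_real (1 - l\<^sup>2 / (2 * real n))) + cmod (of_real (1 - l\<^sup>2 / (2 * real n)) - of_real (exp (- l\<^sup>2 / (2 * real n))))"
      by (rule norm_diff_triangle_le[OF order_refl order_refl])
    also have "cmod (of_real (1 - l\<^sup>2 / (2 * real n)) - of_real (exp (- l\<^sup>2 / (2 * real n)))) = \<bar>1 - l\<^sup>2 / (2 * real n) - exp (- l\<^sup>2 / (2 * real n))\<bar>"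
      by (simp only: of_real_diff[symmetric] norm_of_real)
    finally have "real n * cmod (char M (?t n) - of_real (exp (- l\<^sup>2 / (2 * real n)))) \<le>
       real n * (l\<^sup>2 / real n / 6 * E n + \<bar>1 - l\<^sup>2 / (2 * real n) - exp (- l\<^sup>2 / (2 * real n))\<bar>)"
      using 1 by (intro mult_left_mono) auto
    also have "\<dots> = ?u n" using n by (simp add: distrib_left)
    finally show ?thesis by simp
  qed
  have "(\<lambda>n::nat. real n * \<bar>1 - l\<^sup>2 / (2 * real n) - exp (- l\<^sup>2 / (2 * real n))\<bar>) \<longlonglongrightarrow> 0"
  proof -
    have "(\<lambda>n::nat. real n * (1 - l\<^sup>2 / (2 * real n) - exp (- l\<^sup>2 / (2 * real n)))) \<longlonglongrightarrow> 0"
      by real_asymp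
    from tendsto_rabs[OF this] show ?thesis by (simp add: abs_mult)
  qed
  then have "?u \<longlonglongrightarrow> l\<^sup>2 / 6 * 0 + 0" by (intro tendsto_add tendsto_mult tendsto_const E0)
  then have u: "?u \<longlonglongrightarrow> 0" by simp
  show ?thesis
  proof (rule Lim_null_comparison[OF _ u])
    show "\<forall>\<^sub>F n in sequentially. norm (real n * cmod (char M (?t n) - exp (- l\<^sup>2 / (2 * real n)))) \<le> ?u n"
      using eventually_ge_at_top[of 1] by eventually_elim (use b in auto)
  qed
qed

text \<open>On the event, \<open>n\<close> is at most \<open>x\<^sup>2 / d\<^sup>2\<close>, so the
  quantity is bounded by a truncated second moment, which tends to 0.\<close>

lemma large_jump_rescaled:
  assumes d: "d > 0"
  shows "(\<lambda>n. real n * prob {\<xi>. d * sqrt (real n) < \<bar>\<xi>\<bar>}) \<longlonglongrightarrow> 0"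
proof -
  let ?g = "\<lambda>n x. x\<^sup>2 / d\<^sup>2 * of_bool (d * sqrt (real n) < \<bar>x\<bar>)"
  have i: "integrable M (\<lambda>x. x\<^sup>2 / d\<^sup>2)" using int_sq by simp
  have "(\<lambda>n. \<integral>x. ?g n x \<partial>M) \<longlonglongrightarrow> (\<integral>x. 0 \<partial>M)"
  proof (rule integral_dominated_convergence[OF _ _ i])
    show "AE x in M. (\<lambda>n. ?g n x) \<longlonglongrightarrow> 0"
    proof (rule AE_I2)
      fix x
      have "filterlim (\<lambda>n::nat. d * sqrt (real n)) at_top sequentially" using d by real_asymp
      then have "\<forall>\<^sub>F n::nat in sequentially. d * sqrt (real n) \<ge> \<bar>x\<bar>" by (simp add: filterlim_at_top)
      then have "\<forall>\<^sub>F n in sequentially. 0 = ?g n x" by eventually_elim auto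
      then show "(\<lambda>n. ?g n x) \<longlonglongrightarrow> 0" by (rule Lim_transform_eventually[OF tendsto_const])
    qed
  qed auto
  then have lim: "(\<lambda>n. \<integral>x. ?g n x \<partial>M) \<longlonglongrightarrow> 0" by simp
  have "real n * prob {\<xi>. d * sqrt (real n) < \<bar>\<xi>\<bar>} \<le> (\<integral>x. ?g n x \<partial>M)" for n
  proof -
    have "real n * prob {\<xi>. d * sqrt (real n) < \<bar>\<xi>\<bar>} = (\<integral>x. real n * indicator {\<xi>. d * sqrt (real n) < \<bar>\<xi>\<bar>} x \<partial>M)"
      by simp
    also have "\<dots> \<le> (\<integral>x. ?g n x \<partial>M)"
    proof (rule integral_mono)
      show "integrable M (\<lambda>x. real n * indicator {\<xi>. d * sqrt (real n) < \<bar>\<xi>\<bar>} x)"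
        by (intro integrable_mult_right integrable_const_bound[of _ 1]) auto
      show "integrable M (?g n)"
        by (rule Bochner_Integration.integrable_bound[OF i]) auto
      fix x
      show "real n * indicator {\<xi>. d * sqrt (real n) < \<bar>\<xi>\<bar>} x \<le> ?g n x"
      proof (cases "d * sqrt (real n) < \<bar>x\<bar>")
        case True
        then have "(d * sqrt (real n))\<^sup>2 \<le> x\<^sup>2" using d by (simp flip: abs_le_square_iff add: abs_mult)
        then show ?thesis using True d by (simp add: power_mult_distrib field_simps)
      qed simp
    qed
    finally show ?thesis .
  qed
  then show ?thesis by (intro tendsto_sandwich[OF _ _ tendsto_const lim]) auto
qed

text \<open>\<open>V\<close> is the heat flow started in \<open>f\<close>, and \<open>e n\<close> bounds the error made when one step of length \<open>1 / n\<close> of the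
  heat flow is replaced by a step of the walk rescaled by \<open>sqrt n\<close>.\<close>

definition heat_extension :: "real \<Rightarrow> (real \<Rightarrow> real) \<Rightarrow> (real \<Rightarrow> real \<Rightarrow> real) \<Rightarrow> real \<Rightarrow> real \<Rightarrow> (nat \<Rightarrow> real) \<Rightarrow> bool" where
  "heat_extension R f V B L e \<longleftrightarrow>
    (\<forall>y. V 0 y = f (pi * y / (2 * R))) \<and> (\<forall>t. V t \<in> borel_measurable borel) \<and> (\<forall>t\<ge>0. \<forall>y. \<bar>V t y\<bar> \<le> B) \<and>
    (\<forall>t\<ge>0. \<forall>y y'. \<bar>V t y - V t y'\<bar> \<le> L * \<bar>y - y'\<bar>) \<and> (\<forall>t\<ge>0. V t R = 0 \<and> V t (- R) = 0) \<and>
    V 1 0 = (\<integral>z. f (pi * z / (2 * R)) \<partial>std_normal_distribution) \<and>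
    (\<lambda>n. real n * e n) \<longlonglongrightarrow> 0 \<and>
    (\<forall>n\<ge>1. \<forall>k y. \<bar>(\<integral>\<xi>. V (real k / real n) (y + \<xi> / sqrt (real n)) \<partial>M) - V (real (Suc k) / real n) y\<bar> \<le> e n)"

lemma heat_extension_base:
  assumes R: "R > 0"
  shows "\<exists>V B L e. heat_extension R (\<lambda>\<theta>. cos (real (2 * j + 1) * \<theta>)) V B L e"
proof -
  define l where "l = real (2 * j + 1) * pi / (2 * R)"
  \<comment> \<open>The separated solution of the heat equation; \<open>l * R\<close> is an odd
    multiple of \<open>pi / 2\<close>, hence the zeros at both endpoints. In complex form a step of
    the walk or of the heat flow multiplies the wave by a scalar, and \<open>e n\<close> is the
    distance between the two multipliers.\<close>
  define V where "V t y = cos (l * y) * exp (- l\<^sup>2 * t / 2)" for t y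
  define e where "e n = cmod (char M (l / sqrt (real n)) - exp (- l\<^sup>2 / (2 * real n)))" for n :: nat
  have ex: "exp (- l\<^sup>2 * t / 2) \<le> 1" if "t \<ge> 0" for t using that by simp
  have "heat_extension R (\<lambda>\<theta>. cos (real (2 * j + 1) * \<theta>)) V 1 \<bar>l\<bar> e"
    unfolding heat_extension_def
  proof (intro conjI allI impI)
    show "V 0 y = cos (real (2 * j + 1) * (pi * y / (2 * R)))" for y
      by (simp add: V_def l_def field_simps)
    show "V t \<in> borel_measurable borel" for t unfolding V_def by measurable
    show "\<bar>V t y\<bar> \<le> 1" if "t \<ge> 0" for t y
      using ex[OF that] mult_mono[OF abs_cos_le_one[of "l * y"] ex[OF that]] by (simp add: V_def abs_mult)
    show "\<bar>V t y - V t y'\<bar> \<le> \<bar>l\<bar> * \<bar>y - y'\<bar>" if "t \<ge> 0" for t y y'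
    proof -
      have "\<bar>cos (l * y) - cos (l * y')\<bar> \<le> \<bar>l * y - l * y'\<bar>"
      proof -
        have "cos (l * y) - cos (l * y') = 2 * sin ((l * y + l * y') / 2) * sin ((l * y' - l * y) / 2)"
          by (rule cos_diff_cos)
        then have "\<bar>cos (l * y) - cos (l * y')\<bar> = 2 * (\<bar>sin ((l * y + l * y') / 2)\<bar> * \<bar>sin ((l * y' - l * y) / 2)\<bar>)"
          by (simp add: abs_mult)
        also have "\<dots> \<le> 2 * (1 * \<bar>(l * y' - l * y) / 2\<bar>)"
          by (intro mult_left_mono mult_mono abs_sin_le_one abs_sin_x_le_abs_x) auto
        finally show ?thesis by simp
      qed
      also have "\<bar>l * y - l * y'\<bar> = \<bar>l\<bar> * \<bar>y - y'\<bar>" by (simp add: abs_mult[symmetric] right_diff_distrib)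
      finally have "\<bar>cos (l * y) - cos (l * y')\<bar> * exp (- l\<^sup>2 * t / 2) \<le> (\<bar>l\<bar> * \<bar>y - y'\<bar>) * 1"
        using ex[OF that] by (intro mult_mono) auto
      then show ?thesis by (simp add: V_def left_diff_distrib[symmetric] abs_mult)
    qed
    have "cos (l * R) = 0"
    proof -
      have "l * R = of_int (2 * int j + 1) * (pi / 2)" using R by (simp add: l_def)
      then show ?thesis unfolding cos_zero_iff_int by (intro exI[of _ "2 * int j + 1"]) auto
    qed
    then show "V t R = 0" "V t (- R) = 0" for t by (simp_all add: V_def)
    have cg: "(\<integral>z. cos (l * z) \<partial>std_normal_distribution) = exp (- l\<^sup>2 / 2)"
    proof -
      have "(\<integral>z. cos (l * z) \<partial>std_normal_distribution) = Re (\<integral>z. iexp (l * z) \<partial>std_normal_distribution)"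
        by (subst integral_Re[symmetric]) (auto intro!: gauss.integrable_iexp simp: Re_exp)
      also have "\<dots> = exp (- l\<^sup>2 / 2)"
        using char_std_normal_distribution by (simp add: char_def fun_eq_iff)
      finally show ?thesis .
    qed
    show "V 1 0 = (\<integral>z. cos (real (2 * j + 1) * (pi * z / (2 * R))) \<partial>std_normal_distribution)"
    proof -
      have "cos (real (2 * j + 1) * (pi * z / (2 * R))) = cos (l * z)" for z by (simp add: l_def mult.assoc)
      then show ?thesis by (simp only: cg) (simp add: V_def)
    qed
    show "(\<lambda>n. real n * e n) \<longlonglongrightarrow> 0" unfolding e_def by (rule char_rescaled)
    show "\<bar>(\<integral>\<xi>. V (real k / real n) (y + \<xi> / sqrt (real n)) \<partial>M) - V (real (Suc k) / real n) y\<bar> \<le> e n" if n: "n \<ge> 1" for n k y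
    proof -
      let ?t = "l / sqrt (real n)" and ?E = "exp (- l\<^sup>2 * (real k / real n) / 2)"
      have i: "integrable M (\<lambda>\<xi>. iexp (l * y) * iexp (?t * \<xi>))"
        by (intro integrable_mult_right integrable_iexp) auto
      have "(\<integral>\<xi>. cos (l * (y + \<xi> / sqrt (real n))) \<partial>M) = (\<integral>\<xi>. Re (iexp (l * y) * iexp (?t * \<xi>)) \<partial>M)"
      proof (intro Bochner_Integration.integral_cong refl)
        fix \<xi>
        have "iexp (l * y) * iexp (?t * \<xi>) = iexp (l * (y + \<xi> / sqrt (real n)))"
          by (simp add: exp_add[symmetric] algebra_simps)
        then show "cos (l * (y + \<xi> / sqrt (real n))) = Re (iexp (l * y) * iexp (?t * \<xi>))" by (simp only: Re_exp) simp
      qed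
      also have "\<dots> = Re (\<integral>\<xi>. iexp (l * y) * iexp (?t * \<xi>) \<partial>M)" by (rule integral_Re[OF i])
      also have "\<dots> = Re (iexp (l * y) * char M ?t)" by (simp add: char_def)
      finally have I: "(\<integral>\<xi>. cos (l * (y + \<xi> / sqrt (real n))) \<partial>M) = Re (iexp (l * y) * char M ?t)" .
      have V1: "V (real (Suc k) / real n) y = ?E * Re (iexp (l * y) * of_real (exp (- l\<^sup>2 / (2 * real n))))"
      proof -
        have "exp (- l\<^sup>2 * (real (Suc k) / real n) / 2) = ?E * exp (- l\<^sup>2 / (2 * real n))"
          using n by (simp add: exp_add[symmetric] field_simps)
        then show ?thesis by (simp add: V_def Re_exp)
      qed
      have IV: "(\<integral>\<xi>. V (real k / real n) (y + \<xi> / sqrt (real n)) \<partial>M) = ?E * Re (iexp (l * y) * char M ?t)"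
        unfolding V_def integral_mult_left_zero I by (rule mult.commute)
      have "(\<integral>\<xi>. V (real k / real n) (y + \<xi> / sqrt (real n)) \<partial>M) - V (real (Suc k) / real n) y =
         ?E * (Re (iexp (l * y) * char M ?t) - Re (iexp (l * y) * of_real (exp (- l\<^sup>2 / (2 * real n)))))"
        unfolding V1 IV by (rule right_diff_distrib[symmetric])
      also have "Re (iexp (l * y) * char M ?t) - Re (iexp (l * y) * of_real (exp (- l\<^sup>2 / (2 * real n)))) =
         Re (iexp (l * y) * (char M ?t - of_real (exp (- l\<^sup>2 / (2 * real n)))))"
        by (simp only: right_diff_distrib minus_complex.sel)
      finally have "\<bar>(\<integral>\<xi>. V (real k / real n) (y + \<xi> / sqrt (real n)) \<partial>M) - V (real (Suc k) / real n) y\<bar> =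
         ?E * \<bar>Re (iexp (l * y) * (char M ?t - of_real (exp (- l\<^sup>2 / (2 * real n)))))\<bar>" by (simp add: abs_mult)
      also have "\<dots> \<le> 1 * cmod (iexp (l * y) * (char M ?t - of_real (exp (- l\<^sup>2 / (2 * real n)))))"
        by (intro mult_mono abs_Re_le_cmod ex) auto
      also have "\<dots> = e n" by (simp add: norm_mult e_def)
      finally show ?thesis .
    qed
  qed
  then show ?thesis by blast
qed

lemma heat_extension_scale:
  assumes "heat_extension R f V B L e"
  shows "heat_extension R (\<lambda>\<theta>. c * f \<theta>) (\<lambda>t y. c * V t y) (\<bar>c\<bar> * B) (\<bar>c\<bar> * L) (\<lambda>n. \<bar>c\<bar> * e n)"
  unfolding heat_extension_def
proof (intro conjI allI impI)
  note * = assms[unfolded heat_extension_def]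
  have [measurable]: "V t \<in> borel_measurable borel" for t using * by blast
  show "c * V 0 y = c * f (pi * y / (2 * R))" for y using * by simp
  show "(\<lambda>y. c * V t y) \<in> borel_measurable borel" for t by measurable
  show "\<bar>c * V t y\<bar> \<le> \<bar>c\<bar> * B" if "t \<ge> 0" for t y using * that by (simp add: abs_mult mult_left_mono)
  show "\<bar>c * V t y - c * V t y'\<bar> \<le> \<bar>c\<bar> * L * \<bar>y - y'\<bar>" if "t \<ge> 0" for t y y'
  proof -
    have "\<bar>c\<bar> * \<bar>V t y - V t y'\<bar> \<le> \<bar>c\<bar> * (L * \<bar>y - y'\<bar>)" using * that by (intro mult_left_mono) auto
    then show ?thesis by (simp add: right_diff_distrib[symmetric] abs_mult)
  qed
  show "c * V t R = 0" "c * V t (- R) = 0" if "t \<ge> 0" for t using * that by auto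
  show "c * V 1 0 = (\<integral>z. c * f (pi * z / (2 * R)) \<partial>std_normal_distribution)" using * by simp
  have "(\<lambda>n. \<bar>c\<bar> * (real n * e n)) \<longlonglongrightarrow> \<bar>c\<bar> * 0" using * by (intro tendsto_mult tendsto_const) auto
  then show "(\<lambda>n. real n * (\<bar>c\<bar> * e n)) \<longlonglongrightarrow> 0" by (simp add: mult.left_commute)
  show "\<bar>(\<integral>\<xi>. c * V (real k / real n) (y + \<xi> / sqrt (real n)) \<partial>M) - c * V (real (Suc k) / real n) y\<bar> \<le> \<bar>c\<bar> * e n" if "n \<ge> 1" for n k y
  proof -
    have "\<bar>c\<bar> * \<bar>(\<integral>\<xi>. V (real k / real n) (y + \<xi> / sqrt (real n)) \<partial>M) - V (real (Suc k) / real n) y\<bar> \<le> \<bar>c\<bar> * e n"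
      using * that by (intro mult_left_mono) auto
    then show ?thesis by (simp add: right_diff_distrib[symmetric] abs_mult)
  qed
qed

lemma heat_extension_add:
  assumes "heat_extension R f V B L e" "heat_extension R f' V' B' L' e'"
  shows "heat_extension R (\<lambda>\<theta>. f \<theta> + f' \<theta>) (\<lambda>t y. V t y + V' t y) (B + B') (L + L') (\<lambda>n. e n + e' n)"
  unfolding heat_extension_def
proof (intro conjI allI impI)
  note * = assms[unfolded heat_extension_def]
  have m [measurable]: "V t \<in> borel_measurable borel" "V' t \<in> borel_measurable borel" for t using * by auto
  have b: "\<bar>V t y\<bar> \<le> B" "\<bar>V' t y\<bar> \<le> B'" if "t \<ge> 0" for t y using * that by auto
  show "V 0 y + V' 0 y = f (pi * y / (2 * R)) + f' (pi * y / (2 * R))" for y using * by simp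
  show "(\<lambda>y. V t y + V' t y) \<in> borel_measurable borel" for t by measurable
  show "\<bar>V t y + V' t y\<bar> \<le> B + B'" if "t \<ge> 0" for t y using b[OF that, of y] by linarith
  show "\<bar>V t y + V' t y - (V t y' + V' t y')\<bar> \<le> (L + L') * \<bar>y - y'\<bar>" if "t \<ge> 0" for t y y'
  proof -
    have "\<bar>V t y - V t y'\<bar> \<le> L * \<bar>y - y'\<bar>" "\<bar>V' t y - V' t y'\<bar> \<le> L' * \<bar>y - y'\<bar>" using * that by auto
    then show ?thesis by (simp add: distrib_right)
  qed
  show "V t R + V' t R = 0" "V t (- R) + V' t (- R) = 0" if "t \<ge> 0" for t using * that by auto
  have i: "integrable std_normal_distribution (\<lambda>z. f (pi * z / (2 * R)))" "integrable std_normal_distribution (\<lambda>z. f' (pi * z / (2 * R)))"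
  proof -
    have "integrable std_normal_distribution (V 0)"
      by (rule gauss.integrable_const_bound[of _ B]) (use b in auto)
    moreover have "integrable std_normal_distribution (V' 0)"
      by (rule gauss.integrable_const_bound[of _ B']) (use b in auto)
    moreover have "V 0 = (\<lambda>z. f (pi * z / (2 * R)))" "V' 0 = (\<lambda>z. f' (pi * z / (2 * R)))" using * by auto
    ultimately show "integrable std_normal_distribution (\<lambda>z. f (pi * z / (2 * R)))" "integrable std_normal_distribution (\<lambda>z. f' (pi * z / (2 * R)))"
      by auto
  qed
  show "V 1 0 + V' 1 0 = (\<integral>z. f (pi * z / (2 * R)) + f' (pi * z / (2 * R)) \<partial>std_normal_distribution)"
    using * i by simp
  have "(\<lambda>n. real n * e n + real n * e' n) \<longlonglongrightarrow> 0 + 0" using * by (intro tendsto_add) auto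
  then show "(\<lambda>n. real n * (e n + e' n)) \<longlonglongrightarrow> 0" by (simp add: distrib_left)
  show "\<bar>(\<integral>\<xi>. V (real k / real n) (y + \<xi> / sqrt (real n)) + V' (real k / real n) (y + \<xi> / sqrt (real n)) \<partial>M) -
     (V (real (Suc k) / real n) y + V' (real (Suc k) / real n) y)\<bar> \<le> e n + e' n" if n: "n \<ge> 1" for n k y
  proof -
    have "integrable M (\<lambda>\<xi>. V (real k / real n) (y + \<xi> / sqrt (real n)))"
      by (rule integrable_const_bound[of _ B]) (use b in auto)
    moreover have "integrable M (\<lambda>\<xi>. V' (real k / real n) (y + \<xi> / sqrt (real n)))"
      by (rule integrable_const_bound[of _ B']) (use b in auto)
    moreover have "\<bar>(\<integral>\<xi>. V (real k / real n) (y + \<xi> / sqrt (real n)) \<partial>M) - V (real (Suc k) / real n) y\<bar> \<le> e n"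
      "\<bar>(\<integral>\<xi>. V' (real k / real n) (y + \<xi> / sqrt (real n)) \<partial>M) - V' (real (Suc k) / real n) y\<bar> \<le> e' n" using * n by auto
    ultimately show ?thesis by simp
  qed
qed

lemma oddtrig_heat_extension:
  assumes "f \<in> oddtrig" "R > 0"
  shows "\<exists>V B L e. heat_extension R f V B L e"
  using assms(1)
proof (induction rule: oddtrig.induct)
  case (base j) then show ?case using heat_extension_base[OF assms(2)] by blast
next
  case (add f g) then show ?case using heat_extension_add by blast
next
  case (scale f c) then show ?case using heat_extension_scale by blast
qed

text \<open>The heat flow at time \<open>k / n\<close>, read at \<open>y / sqrt n\<close>, serves as
  comparison function for \<open>k\<close> steps of the walk. The terminal values \<open>g n\<close>
  may vary with \<open>n\<close>, since they are a fixed profile stretched by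
  \<open>sqrt n\<close>.\<close>

lemma stay_upper_eventually:
  assumes f: "f \<in> oddtrig" and R: "R > 0" and k: "\<kappa> \<ge> 0" and \<delta>: "\<delta> > 0"
    and g [measurable]: "\<And>n. g n \<in> borel_measurable borel" and g1: "\<And>n y. \<bar>g n y\<bar> \<le> 1"
    and init: "\<And>n y. n \<ge> 1 \<Longrightarrow> \<bar>y\<bar> < R \<Longrightarrow> g n (y * sqrt (real n)) \<le> f (pi * y / (2 * R)) + \<kappa>"
  shows "\<forall>\<^sub>F n in sequentially. stay M (R * sqrt (real n)) (g n) n 0 \<le>
     (\<integral>z. f (pi * z / (2 * R)) \<partial>std_normal_distribution) + \<kappa> + \<delta>"
proof -
  obtain V B L e where H: "heat_extension R f V B L e"
    using oddtrig_heat_extension[OF f R] by blast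
  note * = H[unfolded heat_extension_def]
  have V0: "V 0 y = f (pi * y / (2 * R))" for y using * by blast
  have Vm [measurable]: "V t \<in> borel_measurable borel" for t using * by blast
  have VB: "\<bar>V t y\<bar> \<le> B" if "t \<ge> 0" for t y using * that by blast
  have VL: "\<bar>V t y - V t y'\<bar> \<le> L * \<bar>y - y'\<bar>" if "t \<ge> 0" for t y y' using * that by blast
  have VR: "V t R = 0" "V t (- R) = 0" if "t \<ge> 0" for t using * that by blast+
  have V1: "V 1 0 = (\<integral>z. f (pi * z / (2 * R)) \<partial>std_normal_distribution)" using * by blast
  have e0: "(\<lambda>n. real n * e n) \<longlonglongrightarrow> 0" using * by blast
  have Ve: "\<bar>(\<integral>\<xi>. V (real k / real n) (y + \<xi> / sqrt (real n)) \<partial>M) - V (real (Suc k) / real n) y\<bar> \<le> e n" if "n \<ge> 1" for n k y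
    using * that by blast
  have L: "L \<ge> 0" using VL[of 0 0 1] abs_ge_zero[of "V 0 0 - V 0 1"] by simp
  \<comment> \<open>Within distance \<open>d\<close> of an endpoint the Lipschitz bound keeps the
    heat flow above \<open>- \<delta> / 2\<close>; \<open>L + 1\<close> avoids division by
    zero.\<close>
  define d where "d = \<delta> / (2 * (L + 1))"
  have d: "d > 0" "L * d \<le> \<delta> / 2" using L \<delta> by (auto simp: d_def field_simps)
  define e' where "e' n = prob {\<xi>. d * sqrt (real n) < \<bar>\<xi>\<bar>}" for n
  have "(\<lambda>n. real n * e n + (1 + B) * (real n * e' n)) \<longlonglongrightarrow> 0 + (1 + B) * 0"
    unfolding e'_def by (intro tendsto_add tendsto_mult tendsto_const e0 large_jump_rescaled d)
  then have "\<forall>\<^sub>F n in sequentially. real n * e n + (1 + B) * (real n * e' n) < \<delta> / 2"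
    by (rule order_tendstoD) (use \<delta> in auto)
  then show ?thesis using eventually_ge_at_top[of 1]
  proof eventually_elim
    case (elim n)
    then have n: "n \<ge> 1" "sqrt (real n) > 0" by auto
    define v where "v k y = V (real k / real n) (y / sqrt (real n))" for k y
    have "stay M (R * sqrt (real n)) (g n) n 0 \<le> v n 0 + \<kappa> + L * d + real n * (e n + (1 + B) * e' n)"
    proof (rule stay_compare[where d = "d * sqrt (real n)"])
      show "v k \<in> borel_measurable borel" for k unfolding v_def by measurable
      show "\<bar>v k y\<bar> \<le> B" for k y unfolding v_def by (rule VB) simp
      show "g n y \<le> v 0 y + \<kappa>" if "\<bar>y\<bar> < R * sqrt (real n)" for y
      proof -
        have "\<bar>y / sqrt (real n)\<bar> < R" using that n by (simp add: divide_less_eq)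
        from init[OF n(1) this] show ?thesis using n by (simp add: v_def V0)
      qed
      show "- (L * d) \<le> v k y" if "R * sqrt (real n) \<le> \<bar>y\<bar>" "\<bar>y\<bar> \<le> R * sqrt (real n) + d * sqrt (real n)" for k y
      proof -
        define w where "w = y / sqrt (real n)"
        have w: "R \<le> \<bar>w\<bar>" "\<bar>w\<bar> \<le> R + d"
          using that n by (auto simp: w_def pos_le_divide_eq pos_divide_le_eq distrib_right)
        have t: "real k / real n \<ge> 0" by simp
        have "\<bar>V (real k / real n) w\<bar> \<le> L * d"
        proof (cases "w \<ge> 0")
          case True
          have "\<bar>V (real k / real n) w - V (real k / real n) R\<bar> \<le> L * \<bar>w - R\<bar>" by (rule VL[OF t])
          also have "\<dots> \<le> L * d" using w True L by (intro mult_left_mono) auto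
          finally show ?thesis using VR[OF t] by simp
        next
          case False
          have "\<bar>V (real k / real n) w - V (real k / real n) (- R)\<bar> \<le> L * \<bar>w - (- R)\<bar>" by (rule VL[OF t])
          also have "\<dots> \<le> L * d" using w False L by (intro mult_left_mono) auto
          finally show ?thesis using VR[OF t] by simp
        qed
        then show ?thesis unfolding v_def w_def[symmetric] by linarith
      qed
      show "(\<integral>\<xi>. v k (y + \<xi>) \<partial>M) \<le> v (Suc k) y + e n" for k y
        using Ve[OF n(1), of k "y / sqrt (real n)"] unfolding v_def add_divide_distrib by linarith
      show "prob {\<xi>. d * sqrt (real n) < \<bar>\<xi>\<bar>} \<le> e' n" by (simp add: e'_def)
      show "0 \<le> e n" using Ve[OF n(1), of 0 0] by linarith
      show "0 \<le> L * d" using L d by simp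
    qed (use g g1 k d n R in auto)
    also have "v n 0 = (\<integral>z. f (pi * z / (2 * R)) \<partial>std_normal_distribution)" using n V1 by (simp add: v_def)
    also have "real n * (e n + (1 + B) * e' n) = real n * e n + (1 + B) * (real n * e' n)" by (simp add: algebra_simps)
    finally show ?case using elim d by linarith
  qed
qed

end

section \<open>Passage to the square wave\<close>

lemma AE_gauss_countable:
  assumes "countable A"
  shows "AE z in std_normal_distribution. z \<notin> A"
proof -
  have "AE z in lborel. z \<notin> A" by (rule AE_not_in[OF countable_imp_null_set_lborel[OF assms]])
  then show ?thesis by (subst AE_density) auto
qed

lemma AE_cos_nonzero:
  assumes x: "x > 0"
  shows "AE z in std_normal_distribution. cos (pi * (z / x) / 2) \<noteq> 0"
proof -
  have "AE z in std_normal_distribution. z \<notin> range (\<lambda>i::int. of_int i * x)"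
    by (rule AE_gauss_countable) simp
  then show ?thesis
  proof eventually_elim
    case (elim z)
    show ?case
    proof
      assume "cos (pi * (z / x) / 2) = 0"
      then obtain i :: int where "pi * (z / x) / 2 = of_int i * (pi / 2)" unfolding cos_zero_iff_int by blast
      then have "z = of_int i * x" using x by (simp add: field_simps)
      then show False using elim by blast
    qed
  qed
qed

text \<open>For almost every \<open>z\<close> the cosine at \<open>z / x\<close> is nonzero, so its
  sign does not change under small perturbations of \<open>x\<close>; dominated convergence then
  applies.\<close>

lemma isCont_integral_square_wave:
  assumes x: "x > 0"
  shows "isCont (\<lambda>x. \<integral>z. square_wave (z / x) \<partial>std_normal_distribution) x"
  unfolding continuous_at_sequentially comp_def
proof (intro allI impI)
  fix X :: "nat \<Rightarrow> real" assume X: "X \<longlonglongrightarrow> x"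
  show "(\<lambda>n. \<integral>z. square_wave (z / X n) \<partial>std_normal_distribution) \<longlonglongrightarrow> (\<integral>z. square_wave (z / x) \<partial>std_normal_distribution)"
  proof (rule integral_dominated_convergence[where w = "\<lambda>_. 1"])
    show "AE z in std_normal_distribution. (\<lambda>n. square_wave (z / X n)) \<longlonglongrightarrow> square_wave (z / x)"
      using AE_cos_nonzero[OF x]
    proof eventually_elim
      case (elim z)
      have c: "(\<lambda>n. cos (pi * (z / X n) / 2)) \<longlonglongrightarrow> cos (pi * (z / x) / 2)"
        using x by (intro tendsto_intros X) auto
      have s: "(\<lambda>n. sgn (cos (pi * (z / X n) / 2))) \<longlonglongrightarrow> sgn (cos (pi * (z / x) / 2))"
        by (rule tendsto_sgn[OF c elim])
      have "\<forall>\<^sub>F n in sequentially. cos (pi * (z / X n) / 2) \<noteq> 0"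
        using c elim by (rule tendsto_imp_eventually_ne)
      then have "\<forall>\<^sub>F n in sequentially. sgn (cos (pi * (z / X n) / 2)) = square_wave (z / X n)"
        by eventually_elim (rule square_wave_eq_sgn_cos[symmetric])
      from Lim_transform_eventually[OF s this] show ?case using square_wave_eq_sgn_cos[OF elim] by simp
    qed
  qed auto
qed

lemma max_tail_eq: "max_tail x = 1 - (\<integral>z. square_wave (z / x) \<partial>std_normal_distribution)"
  using gauss.prob_space by (simp add: max_tail_def)

lemma isCont_max_tail: "x > 0 \<Longrightarrow> isCont max_tail x"
  unfolding max_tail_eq[abs_def] by (intro continuous_intros isCont_integral_square_wave)

lemma isCont_gauss_tail:
  assumes x: "x > 0"
  shows "isCont gauss_tail x"
  unfolding continuous_at_sequentially comp_def
proof (intro allI impI)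
  fix X :: "nat \<Rightarrow> real" assume X: "X \<longlonglongrightarrow> x"
  show "(\<lambda>n. gauss_tail (X n)) \<longlonglongrightarrow> gauss_tail x"
    unfolding gauss_tail_eq_integral
  proof (rule integral_dominated_convergence[where w = "\<lambda>_. 1"])
    have "AE z in std_normal_distribution. z \<notin> {x, -x}" by (rule AE_gauss_countable) simp
    then show "AE z in std_normal_distribution. (\<lambda>n. of_bool (X n \<le> \<bar>z\<bar>) :: real) \<longlonglongrightarrow> of_bool (x \<le> \<bar>z\<bar>)"
    proof eventually_elim
      case (elim z)
      then consider "x < \<bar>z\<bar>" | "\<bar>z\<bar> < x" by force
      then have "\<forall>\<^sub>F n in sequentially. of_bool (x \<le> \<bar>z\<bar>) = (of_bool (X n \<le> \<bar>z\<bar>) :: real)"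
      proof cases
        case 1
        from order_tendstoD(2)[OF X 1] show ?thesis by eventually_elim (use 1 in auto)
      next
        case 2
        from order_tendstoD(1)[OF X 2] show ?thesis by eventually_elim (use 2 in auto)
      qed
      then show ?case by (rule Lim_transform_eventually[OF tendsto_const])
    qed
  qed auto
qed

lemma clamp_integral_limit:
  assumes R: "R > 0"
  shows "(\<lambda>m. \<integral>z. max (-1) (min 1 (real m * cos (pi * z / (2 * R)))) \<partial>std_normal_distribution)
     \<longlonglongrightarrow> (\<integral>z. square_wave (z / R) \<partial>std_normal_distribution)"
proof (rule integral_dominated_convergence[where w = "\<lambda>_. 1"])
  show "AE z in std_normal_distribution. (\<lambda>m. max (-1) (min 1 (real m * cos (pi * z / (2 * R))))) \<longlonglongrightarrow> square_wave (z / R)"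
    using AE_cos_nonzero[OF R]
  proof eventually_elim
    case (elim z)
    have eq: "pi * z / (2 * R) = pi * (z / R) / 2" by simp
    define c where "c = cos (pi * (z / R) / 2)"
    have c0: "c \<noteq> 0" using elim by (simp add: c_def)
    have "\<forall>\<^sub>F m in sequentially. sgn c = max (-1) (min 1 (real m * c))"
    proof (cases "c > 0")
      case True
      have "filterlim (\<lambda>m::nat. real m * c) at_top sequentially" using True by real_asymp
      then have "\<forall>\<^sub>F m::nat in sequentially. real m * c \<ge> 1" by (simp add: filterlim_at_top)
      then show ?thesis by eventually_elim (use True in auto)
    next
      case False
      then have "c < 0" using c0 by simp
      then have "filterlim (\<lambda>m::nat. real m * c) at_bot sequentially" by real_asymp
      then have "\<forall>\<^sub>F m::nat in sequentially. real m * c \<le> -1" by (simp add: filterlim_at_bot)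
      then show ?thesis by eventually_elim (use \<open>c < 0\<close> in auto)
    qed
    then show ?case unfolding eq square_wave_eq_sgn_cos[OF elim] c_def[symmetric]
      by (rule Lim_transform_eventually[OF tendsto_const])
  qed
qed auto

context standardized_distribution
begin

lemma oddtrig_clamp_integral:
  assumes f: "f \<in> oddtrig" and R: "R > 0"
    and ap: "\<And>\<theta>. \<bar>f \<theta> - max (-1) (min 1 (s * cos \<theta>))\<bar> \<le> \<kappa>"
  shows "\<bar>(\<integral>z. f (pi * z / (2 * R)) \<partial>std_normal_distribution) -
    (\<integral>z. max (-1) (min 1 (s * cos (pi * z / (2 * R)))) \<partial>std_normal_distribution)\<bar> \<le> \<kappa>"
proof -
  let ?c = "\<lambda>z. max (-1) (min 1 (s * cos (pi * z / (2 * R))))"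
  obtain V B L e where H: "heat_extension R f V B L e"
    using oddtrig_heat_extension[OF f R] by blast
  \<comment> \<open>Measurability and boundedness of \<open>f\<close> are read off from the initial
    slice of a heat extension.\<close>
  have V0: "V 0 = (\<lambda>z. f (pi * z / (2 * R)))" and [measurable]: "V 0 \<in> borel_measurable borel" and VB: "\<And>y. \<bar>V 0 y\<bar> \<le> B"
    using H by (auto simp: heat_extension_def)
  have i1: "integrable std_normal_distribution (\<lambda>z. f (pi * z / (2 * R)))"
    unfolding V0[symmetric] by (rule gauss.integrable_const_bound[of _ B]) (use VB in auto)
  have i2: "integrable std_normal_distribution ?c"
    by (rule gauss.integrable_const_bound[of _ 1]) auto
  have "\<bar>\<integral>z. f (pi * z / (2 * R)) - ?c z \<partial>std_normal_distribution\<bar> \<le> (\<integral>z. \<bar>f (pi * z / (2 * R)) - ?c z\<bar> \<partial>std_normal_distribution)"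
    by (rule integral_abs_bound)
  also have "\<dots> \<le> (\<integral>z. \<kappa> \<partial>std_normal_distribution)"
    by (intro integral_mono integrable_abs Bochner_Integration.integrable_diff i1 i2) (use ap in auto)
  finally show ?thesis using i1 i2 gauss.prob_space by simp
qed

text \<open>The clamp vanishes at the endpoints and cannot dominate 1 up to them, so the walk is
  killed at \<open>R > x\<close> while its terminal value is the indicator of the narrower interval.
  There the clamp equals 1 once its slope is steep enough.\<close>

lemma stay_limsup:
  assumes x: "0 < x" "x < R" and \<delta>: "\<delta> > 0"
  shows "\<forall>\<^sub>F n in sequentially. stay M (x * sqrt (real n)) (\<lambda>_. 1) n 0 \<le> (\<integral>z. square_wave (z / R) \<partial>std_normal_distribution) + \<delta>"
proof -
  have R: "R > 0" using x by simp
  define c where "c = cos (pi * x / (2 * R))"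
  have angle: "0 \<le> u \<Longrightarrow> 0 \<le> pi * u / (2 * R)" "u \<le> R \<Longrightarrow> pi * u / (2 * R) \<le> pi / 2"
      "u < R \<Longrightarrow> pi * u / (2 * R) < pi / 2" "u \<le> v \<Longrightarrow> pi * u / (2 * R) \<le> pi * v / (2 * R)" for u v
    using R mult_left_mono[of u R pi] mult_strict_left_mono[of u R pi] mult_left_mono[of u v pi]
    by (auto simp: field_simps)
  have c: "c > 0" unfolding c_def using x angle(1,3)[of x] pi_gt_zero by (intro cos_gt_zero_pi) linarith+
  have "\<forall>\<^sub>F m::nat in sequentially. 1 \<le> real m * c"
  proof -
    have "filterlim (\<lambda>m::nat. real m * c) at_top sequentially" using c by real_asymp
    then show ?thesis by (simp add: filterlim_at_top)
  qed
  moreover have "\<forall>\<^sub>F m in sequentially. (\<integral>z. max (-1) (min 1 (real m * cos (pi * z / (2 * R)))) \<partial>std_normal_distribution) <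
      (\<integral>z. square_wave (z / R) \<partial>std_normal_distribution) + \<delta> / 4"
    by (rule order_tendstoD(2)[OF clamp_integral_limit[OF R]]) (use \<delta> in auto)
  ultimately have "\<forall>\<^sub>F m::nat in sequentially. 1 \<le> real m * c \<and>
      (\<integral>z. max (-1) (min 1 (real m * cos (pi * z / (2 * R)))) \<partial>std_normal_distribution) < (\<integral>z. square_wave (z / R) \<partial>std_normal_distribution) + \<delta> / 4"
    by (rule eventually_conj)
  from eventually_happens'[OF sequentially_bot this] obtain m :: nat where m: "1 \<le> real m * c"
    "(\<integral>z. max (-1) (min 1 (real m * cos (pi * z / (2 * R)))) \<partial>std_normal_distribution) < (\<integral>z. square_wave (z / R) \<partial>std_normal_distribution) + \<delta> / 4"
    by blast
  obtain f where f: "f \<in> oddtrig" "\<And>\<theta>. \<bar>f \<theta> - max (-1) (min 1 (real m * cos \<theta>))\<bar> \<le> \<delta> / 8"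
    using oddtrig_approx_clamp[of "\<delta> / 8"] \<delta> by auto
  define g where "g n y = (of_bool (\<bar>y\<bar> < x * sqrt (real n)) :: real)" for n y
  have "\<forall>\<^sub>F n in sequentially. stay M (R * sqrt (real n)) (g n) n 0 \<le>
     (\<integral>z. f (pi * z / (2 * R)) \<partial>std_normal_distribution) + \<delta> / 8 + \<delta> / 2"
  proof (rule stay_upper_eventually[OF f(1) R])
    show "g n \<in> borel_measurable borel" for n unfolding g_def by measurable
    show "g n (y * sqrt (real n)) \<le> f (pi * y / (2 * R)) + \<delta> / 8" if n: "n \<ge> 1" and y: "\<bar>y\<bar> < R" for n y
    proof -
      have g: "g n (y * sqrt (real n)) = of_bool (\<bar>y\<bar> < x)" using n by (simp add: g_def abs_mult)
      have cy: "cos (pi * y / (2 * R)) = cos (pi * \<bar>y\<bar> / (2 * R))" by (cases "y \<ge> 0") auto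
      have c0: "0 \<le> cos (pi * \<bar>y\<bar> / (2 * R))" using y angle(1,2)[of "\<bar>y\<bar>"] pi_gt_zero by (intro cos_ge_zero) linarith+
      have "of_bool (\<bar>y\<bar> < x) \<le> max (-1) (min 1 (real m * cos (pi * y / (2 * R))))"
      proof (cases "\<bar>y\<bar> < x")
        case True
        have "c \<le> cos (pi * \<bar>y\<bar> / (2 * R))"
          unfolding c_def using x True angle(1)[of "\<bar>y\<bar>"] angle(2)[of x] angle(4)[of "\<bar>y\<bar>" x] pi_gt_zero
          by (intro cos_monotone_0_pi_le) linarith+
        then have "real m * c \<le> real m * cos (pi * \<bar>y\<bar> / (2 * R))" by (rule mult_left_mono) simp
        then show ?thesis using m(1) True cy by simp
      next
        case False
        have "0 \<le> real m * cos (pi * \<bar>y\<bar> / (2 * R))" using c0 by simp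
        then show ?thesis using False cy by (simp add: le_max_iff_disj)
      qed
      then show ?thesis using f(2)[of "pi * y / (2 * R)"] g by linarith
    qed
  qed (use \<delta> in \<open>auto simp: g_def\<close>)
  then show ?thesis
  proof eventually_elim
    case (elim n)
    have "stay M (x * sqrt (real n)) (\<lambda>_. 1) n 0 \<le> stay M (R * sqrt (real n)) (g n) n 0"
      unfolding g_def[abs_def] using x by (intro stay_mono_width mult_right_mono) auto
    moreover have "(\<integral>z. f (pi * z / (2 * R)) \<partial>std_normal_distribution) \<le> (\<integral>z. square_wave (z / R) \<partial>std_normal_distribution) + \<delta> / 4 + \<delta> / 8"
      using oddtrig_clamp_integral[OF f(1) R f(2)] m(2) by linarith
    ultimately show ?case using elim by linarith
  qed
qed

lemma stay_liminf:
  assumes x: "0 < x" and \<delta>: "\<delta> > 0"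
  shows "\<forall>\<^sub>F n in sequentially. (\<integral>z. square_wave (z / x) \<partial>std_normal_distribution) - \<delta> \<le> stay M (x * sqrt (real n)) (\<lambda>_. 1) n 0"
proof -
  have "\<forall>\<^sub>F m in sequentially. (\<integral>z. max (-1) (min 1 (real m * cos (pi * z / (2 * x)))) \<partial>std_normal_distribution) >
      (\<integral>z. square_wave (z / x) \<partial>std_normal_distribution) - \<delta> / 4"
    by (rule order_tendstoD(1)[OF clamp_integral_limit[OF x]]) (use \<delta> in auto)
  then obtain m :: nat where m:
    "(\<integral>z. max (-1) (min 1 (real m * cos (pi * z / (2 * x)))) \<partial>std_normal_distribution) > (\<integral>z. square_wave (z / x) \<partial>std_normal_distribution) - \<delta> / 4"
    using eventually_happens'[OF sequentially_bot] by blast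
  obtain f where f: "f \<in> oddtrig" "\<And>\<theta>. \<bar>f \<theta> - max (-1) (min 1 (real m * cos \<theta>))\<bar> \<le> \<delta> / 8"
    using oddtrig_approx_clamp[of "\<delta> / 8"] \<delta> by auto
  have "\<forall>\<^sub>F n in sequentially. stay M (x * sqrt (real n)) (\<lambda>_. -1) n 0 \<le>
     (\<integral>z. -1 * f (pi * z / (2 * x)) \<partial>std_normal_distribution) + \<delta> / 8 + \<delta> / 2"
  proof (rule stay_upper_eventually[OF oddtrig.scale[OF f(1), of "-1"] x])
    show "-1 \<le> -1 * f (pi * y / (2 * x)) + \<delta> / 8" for y
    proof -
      have "max (-1) (min 1 (real m * cos (pi * y / (2 * x)))) \<le> 1" by simp
      then show ?thesis using f(2)[of "pi * y / (2 * x)"] by linarith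
    qed
  qed (use \<delta> in auto)
  then show ?thesis
  proof eventually_elim
    case (elim n)
    have "stay M (x * sqrt (real n)) (\<lambda>_. -1) n 0 = - stay M (x * sqrt (real n)) (\<lambda>_. 1) n 0"
      by (rule stay_uminus)
    moreover have "(\<integral>z. -1 * f (pi * z / (2 * x)) \<partial>std_normal_distribution) = - (\<integral>z. f (pi * z / (2 * x)) \<partial>std_normal_distribution)"
      by simp
    ultimately show ?case using elim oddtrig_clamp_integral[OF f(1) x f(2)] m by linarith
  qed
qed

lemma stay_limit:
  assumes x: "0 < x"
  shows "(\<lambda>n. stay M (x * sqrt (real n)) (\<lambda>_. 1) n 0) \<longlonglongrightarrow> (\<integral>z. square_wave (z / x) \<partial>std_normal_distribution)"
proof (rule tendstoI)
  fix e :: real assume e: "e > 0"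
  let ?S = "\<lambda>x. \<integral>z. square_wave (z / x) \<partial>std_normal_distribution"
  \<comment> \<open>Continuity in the half-width closes the gap left by the upper estimate.\<close>
  have "\<forall>\<^sub>F R in at_right x. ?S R < ?S x + e / 4"
  proof -
    have "(?S \<longlongrightarrow> ?S x) (at_right x)"
      using isCont_integral_square_wave[OF x] unfolding isCont_def by (rule filterlim_mono[OF _ order_refl at_le]) simp
    then show ?thesis by (rule order_tendstoD(2)) (use e in auto)
  qed
  moreover have "\<forall>\<^sub>F R in at_right x. R > x" by (simp add: eventually_at_right_less)
  ultimately have "\<forall>\<^sub>F R in at_right x. ?S R < ?S x + e / 4 \<and> x < R" by (rule eventually_conj)
  from eventually_happens'[OF trivial_limit_at_right_real this] obtain R where R: "x < R" "?S R < ?S x + e / 4"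
    by blast
  have e4: "e / 4 > 0" using e by simp
  show "\<forall>\<^sub>F n in sequentially. dist (stay M (x * sqrt (real n)) (\<lambda>_. 1) n 0) (?S x) < e"
    using stay_limsup[OF x R(1) e4] stay_liminf[OF x e4]
  proof eventually_elim
    case (elim n)
    then show ?case using R(2) e by (simp add: dist_real_def abs_less_iff)
  qed
qed

end

sublocale iid_unit_variance \<subseteq> \<mu>: standardized_distribution \<mu>
  by unfold_locales (use int_X0 mean_X0 int_X0_sq var_X0 in \<open>auto simp: integrable_distr_eq integral_distr\<close>)

context iid_unit_variance
begin

theorem erdos_kac_limit:
  assumes x: "x > 0"
  shows "(\<lambda>n. prob {\<omega> \<in> space M. x * sqrt (real n) \<le> maxpsum X n \<omega>}) \<longlonglongrightarrow> max_tail x"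
proof -
  have "(\<lambda>n. 1 - stay \<mu> (x * sqrt (real n)) (\<lambda>_. 1) n 0) \<longlonglongrightarrow> 1 - (\<integral>z. square_wave (z / x) \<partial>std_normal_distribution)"
    by (intro tendsto_intros \<mu>.stay_limit x)
  then show ?thesis
    unfolding max_tail_eq
  proof (rule Lim_transform_eventually)
    show "\<forall>\<^sub>F n in sequentially. 1 - stay \<mu> (x * sqrt (real n)) (\<lambda>_. 1) n 0 = prob {\<omega> \<in> space M. x * sqrt (real n) \<le> maxpsum X n \<omega>}"
      using eventually_ge_at_top[of 1]
    proof eventually_elim
      case (elim n)
      have "{\<omega> \<in> space M. x * sqrt (real n) \<le> maxpsum X n \<omega>} = space M - {\<omega> \<in> space M. maxpsum X n \<omega> < x * sqrt (real n)}" by auto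
      then show ?case using elim x by (simp add: prob_compl prob_maxpsum_less)
    qed
  qed
qed

text \<open>The central limit theorem on the closed set \<open>{z. x \<le> \<bar>z\<bar>}\<close>,
  whose frontier consists of at most two points and is null for the Gaussian law.\<close>

lemma clt_abs_limit:
  assumes x: "x > 0"
  shows "(\<lambda>n. prob {\<omega> \<in> space M. x * sqrt (real n) \<le> \<bar>psum X n \<omega>\<bar>}) \<longlonglongrightarrow> gauss_tail x"
proof -
  let ?\<mu> = "\<lambda>n. distr M borel (\<lambda>\<omega>. (\<Sum>i<n. X i \<omega>) / sqrt (real n * 1\<^sup>2))"
  have wc: "weak_conv_m ?\<mu> std_normal_distribution"
    by (rule central_limit_theorem_zero_mean[OF indep X_moments(2) zero_less_one X_moments(3) _ ident])
       (simp add: X_moments)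
  have fr: "frontier {z. x \<le> \<bar>z\<bar>} \<subseteq> {x, -x}"
  proof -
    have "{z. x < \<bar>z\<bar>} \<subseteq> interior {z. x \<le> \<bar>z\<bar>}"
      by (rule interior_maximal) (auto intro!: open_Collect_less continuous_intros)
    moreover have "closure {z. x \<le> \<bar>z\<bar>} = {z. x \<le> \<bar>z\<bar>}"
      by (intro closure_closed closed_Collect_le continuous_intros)
    ultimately have "frontier {z. x \<le> \<bar>z\<bar>} \<subseteq> {z. x \<le> \<bar>z\<bar>} - {z. x < \<bar>z\<bar>}" by (auto simp: frontier_def)
    then have "\<bar>z\<bar> = x" if "z \<in> frontier {z. x \<le> \<bar>z\<bar>}" for z using that by force
    moreover have "z \<in> {x, -x}" if "\<bar>z\<bar> = x" for z using that by (auto simp: abs_if split: if_splits)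
    ultimately show ?thesis by blast
  qed
  have "emeasure std_normal_distribution {x, -x} = 0"
    using AE_gauss_countable[of "{x, -x}"] AE_iff_null_sets[of "{x, -x}" std_normal_distribution] by auto
  then have "emeasure std_normal_distribution (frontier {z. x \<le> \<bar>z\<bar>}) = 0"
    using emeasure_mono[OF fr, of std_normal_distribution] by simp
  then have "(\<lambda>n. measure (?\<mu> n) {z. x \<le> \<bar>z\<bar>}) \<longlonglongrightarrow> measure std_normal_distribution {z. x \<le> \<bar>z\<bar>}"
    by (intro weak_conv_imp_continuity_set_conv[OF _ real_dist_normal_dist wc]) (auto intro!: real_distribution_distr)
  then show ?thesis
    unfolding gauss_tail_def
  proof (rule Lim_transform_eventually)
    show "\<forall>\<^sub>F n in sequentially. measure (?\<mu> n) {z. x \<le> \<bar>z\<bar>} = prob {\<omega> \<in> space M. x * sqrt (real n) \<le> \<bar>psum X n \<omega>\<bar>}"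
      using eventually_ge_at_top[of 1]
    proof eventually_elim
      case (elim n)
      then have "sqrt (real n) > 0" by simp
      then show ?case
        by (subst measure_distr) (auto simp: psum_def abs_divide pos_le_divide_eq intro!: arg_cong[where f = prob])
    qed
  qed
qed

end

section \<open>Precise rates\<close>

text \<open>Polya's argument: monotone functions converging pointwise to a continuous limit converge
  locally uniformly. The second point \<open>x'\<close> leaves room for a small shift of the
  argument, which absorbs the perturbation by \<open>a\<close>.\<close>

lemma antimono_locally_uniform:
  fixes F :: "nat \<Rightarrow> real \<Rightarrow> real" and G :: "real \<Rightarrow> real"
  assumes mono: "\<And>n x y. x \<le> y \<Longrightarrow> F n y \<le> F n x"
    and lim: "\<And>x. x > 0 \<Longrightarrow> (\<lambda>n. F n x) \<longlonglongrightarrow> G x"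
    and cont: "\<And>x. x > 0 \<Longrightarrow> isCont G x"
    and \<alpha>: "\<alpha> > 0" and \<eta>: "\<eta> > 0"
  obtains N \<delta> where "\<delta> > 0" "\<And>n x x'. n \<ge> N \<Longrightarrow> \<alpha> \<le> x \<Longrightarrow> x \<le> \<beta> \<Longrightarrow> \<bar>x' - x\<bar> \<le> \<delta> \<Longrightarrow> \<bar>F n x' - G x\<bar> \<le> \<eta>"
proof -
  have "\<exists>r N. r > 0 \<and> (\<forall>n\<ge>N. \<forall>x x'. \<bar>x - u\<bar> < r \<longrightarrow> \<bar>x' - x\<bar> \<le> r \<longrightarrow> \<bar>F n x' - G x\<bar> \<le> \<eta>)" if u: "u > 0" for u
  proof -
    obtain d where d: "d > 0" "\<And>y. \<bar>y - u\<bar> < d \<Longrightarrow> \<bar>G y - G u\<bar> < \<eta> / 3"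
      using cont[OF u] \<eta> unfolding continuous_at_eps_delta by (metis dist_real_def divide_pos_pos zero_less_numeral)
    \<comment> \<open>If \<open>x\<close> is within \<open>r\<close> of \<open>u\<close> and
      \<open>x'\<close> within \<open>r\<close> of \<open>x\<close>, then \<open>x'\<close> lies
      between \<open>u - 2 * r\<close> and \<open>u + 2 * r\<close>; both ends are positive and
      within \<open>d\<close> of \<open>u\<close>.\<close>
    define r where "r = min d u / 3"
    have r: "r > 0" "2 * r < d" "2 * r < u" using d u by (auto simp: r_def)
    have "\<forall>\<^sub>F n in sequentially. \<bar>F n (u - 2 * r) - G (u - 2 * r)\<bar> < \<eta> / 3"
      using tendstoD[OF lim[of "u - 2 * r"], of "\<eta> / 3"] r \<eta> by (simp add: dist_real_def)
    moreover have "\<forall>\<^sub>F n in sequentially. \<bar>F n (u + 2 * r) - G (u + 2 * r)\<bar> < \<eta> / 3"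
      using tendstoD[OF lim[of "u + 2 * r"], of "\<eta> / 3"] r u \<eta> by (simp add: dist_real_def)
    ultimately obtain N where N: "\<And>n. n \<ge> N \<Longrightarrow> \<bar>F n (u - 2 * r) - G (u - 2 * r)\<bar> < \<eta> / 3 \<and> \<bar>F n (u + 2 * r) - G (u + 2 * r)\<bar> < \<eta> / 3"
      unfolding eventually_sequentially by (metis (no_types) le_trans linear)
    have "\<bar>F n x' - G x\<bar> \<le> \<eta>" if "n \<ge> N" "\<bar>x - u\<bar> < r" "\<bar>x' - x\<bar> \<le> r" for n x x'
    proof -
      have "F n x' \<le> F n (u - 2 * r)" "F n (u + 2 * r) \<le> F n x'" using that by (auto intro!: mono)
      moreover have "\<bar>G (u - 2 * r) - G u\<bar> < \<eta> / 3" "\<bar>G (u + 2 * r) - G u\<bar> < \<eta> / 3" "\<bar>G x - G u\<bar> < \<eta> / 3"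
        using r that by (intro d(2); simp)+
      ultimately show ?thesis using N[OF that(1)] by linarith
    qed
    then show ?thesis using r by blast
  qed
  then obtain r N where rN: "\<And>u. u > 0 \<Longrightarrow> r u > 0"
    "\<And>u n x x'. u > 0 \<Longrightarrow> n \<ge> N u \<Longrightarrow> \<bar>x - u\<bar> < r u \<Longrightarrow> \<bar>x' - x\<bar> \<le> r u \<Longrightarrow> \<bar>F n x' - G x\<bar> \<le> \<eta>"
    by metis
  obtain D where D: "D \<subseteq> {\<alpha>..\<beta>}" "finite D" "{\<alpha>..\<beta>} \<subseteq> (\<Union>u\<in>D. ball u (r u))"
  proof (rule compactE_image[of "{\<alpha>..\<beta>}" "{\<alpha>..\<beta>}" "\<lambda>u. ball u (r u)"])
    show "{\<alpha>..\<beta>} \<subseteq> (\<Union>u\<in>{\<alpha>..\<beta>}. ball u (r u))" 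
    proof
      fix u assume "u \<in> {\<alpha>..\<beta>}"
      then show "u \<in> (\<Union>u\<in>{\<alpha>..\<beta>}. ball u (r u))" using rN(1)[of u] \<alpha> by (intro UN_I[of u]) auto
    qed
  qed auto
  define \<delta> where "\<delta> = Min (insert 1 (r ` D))"
  define N' where "N' = Max (insert 0 (N ` D))"
  have "\<delta> > 0" unfolding \<delta>_def using D \<alpha> rN(1) by (subst Min_gr_iff) auto
  moreover have "\<bar>F n x' - G x\<bar> \<le> \<eta>" if "n \<ge> N'" "\<alpha> \<le> x" "x \<le> \<beta>" "\<bar>x' - x\<bar> \<le> \<delta>" for n x x'
  proof -
    have "x \<in> {\<alpha>..\<beta>}" using that by simp
    then obtain u where u: "u \<in> D" "x \<in> ball u (r u)" using D(3) by blast
    have "N u \<le> N'" "\<delta> \<le> r u" unfolding N'_def \<delta>_def using D u by (auto intro!: Max_ge Min_le)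
    then show ?thesis using u that D \<alpha> by (intro rN(2)[of u]) (auto simp: dist_real_def abs_minus_commute)
  qed
  ultimately show ?thesis using that by blast
qed

text \<open>Common to both statistics: monotonicity and pointwise convergence provide the local
  uniformity, and an exponential tail at the unperturbed scale provides the polynomial tail bound
  demanded by the comparison.\<close>

lemma precise_rate_profile:
  fixes F :: "nat \<Rightarrow> real \<Rightarrow> real" and G :: "real \<Rightarrow> real" and a :: "nat \<Rightarrow> real"
  assumes b: "b > -1"
    and mono: "\<And>n x y. x \<le> y \<Longrightarrow> F n y \<le> F n x"
    and F0: "\<And>n x. 0 \<le> F n x" and F1: "\<And>n x. F n x \<le> 1"
    and lim: "\<And>x. x > 0 \<Longrightarrow> (\<lambda>n. F n x) \<longlonglongrightarrow> G x"
    and cont: "\<And>x. x > 0 \<Longrightarrow> isCont G x"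
    and G0: "\<And>x. x > 0 \<Longrightarrow> 0 \<le> G x" and Gtail: "\<And>x. x > 0 \<Longrightarrow> G x \<le> 2 * gauss_tail x"
    and r: "summable (\<lambda>m. weight b m * r m)" "\<And>m. 0 \<le> r m"
    and c: "c > 0" "D \<ge> 0"
    and tailF: "\<And>m y. y \<ge> y0 \<Longrightarrow> F m y \<le> D * exp (- (c * y)) + r m"
    and a: "a \<in> O(\<lambda>n. 1 / LLg (real n))"
    and q: "((\<lambda>\<epsilon>. \<epsilon> powr (2 * (b + 1)) * (\<Sum>m. weight b m * G (\<epsilon> * sqrt (2 * loglog m)))) \<longlongrightarrow> q) (at_right 0)"
  defines "P \<equiv> \<lambda>m \<epsilon>. F m (sqrt (2 * loglog m) * (\<epsilon> + a (Suc m)))"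
  shows "\<forall>\<^sub>F \<epsilon> in at_right 0. summable (\<lambda>m. weight b m * P m \<epsilon>)"
    and "((\<lambda>\<epsilon>. \<epsilon> powr (2 * (b + 1)) * (\<Sum>m. weight b m * P m \<epsilon>)) \<longlongrightarrow> q) (at_right 0)"
proof -
  obtain A where A: "A > 0" "\<forall>\<^sub>F n in sequentially. norm (a n) \<le> A * norm (1 / LLg (real n))"
    using landau_o.bigE[OF a] by blast
  then obtain N0 where N0: "\<And>n. n \<ge> N0 \<Longrightarrow> norm (a n) \<le> A * norm (1 / LLg (real n))"
    unfolding eventually_sequentially by blast
  have aA: "\<bar>a (Suc m)\<bar> \<le> A / loglog m" if "m \<ge> N0" for m
    using N0[of "Suc m"] that loglog_pos[of m] by (simp add: loglog_def del: loglog_pos)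
  have shift: "sqrt (2 * loglog m) * (\<epsilon> + a (Suc m)) - \<epsilon> * sqrt (2 * loglog m) = sqrt (2 * loglog m) * a (Suc m)" for m \<epsilon>
    by (simp add: algebra_simps)
  have close: "\<exists>N. \<forall>m\<ge>N. \<forall>\<epsilon>>0. \<alpha> \<le> \<epsilon> * sqrt (2 * loglog m) \<longrightarrow> \<epsilon> * sqrt (2 * loglog m) \<le> \<beta> \<longrightarrow> \<bar>P m \<epsilon> - G (\<epsilon> * sqrt (2 * loglog m))\<bar> \<le> \<eta>"
    if \<alpha>: "0 < \<alpha>" and \<eta>: "0 < \<eta>" for \<alpha> \<beta> \<eta>
  proof -
    obtain \<delta> N where N: "\<delta> > 0" "\<And>n x x'. n \<ge> N \<Longrightarrow> \<alpha> \<le> x \<Longrightarrow> x \<le> \<beta> \<Longrightarrow> \<bar>x' - x\<bar> \<le> \<delta> \<Longrightarrow> \<bar>F n x' - G x\<bar> \<le> \<eta>"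
      by (rule antimono_locally_uniform[where F = F and G = G and \<beta> = \<beta>, OF mono lim cont \<alpha> \<eta>]) (assumption | rule that)+
    have "((\<lambda>x::real. sqrt (2 * x) * (A / x)) \<longlongrightarrow> 0) at_top" by real_asymp
    from filterlim_compose[OF this loglog_at_top] have "(\<lambda>m. sqrt (2 * loglog m) * (A / loglog m)) \<longlonglongrightarrow> 0" .
    then have "\<forall>\<^sub>F m in sequentially. sqrt (2 * loglog m) * (A / loglog m) < \<delta>" using N(1) by (rule order_tendstoD)
    then obtain N1 where N1: "\<And>m. m \<ge> N1 \<Longrightarrow> sqrt (2 * loglog m) * (A / loglog m) < \<delta>" unfolding eventually_sequentially by blast
    show ?thesis
    proof (intro exI[of _ "max N (max N0 N1)"] allI impI)
      fix m \<epsilon> assume m: "max N (max N0 N1) \<le> m" and "0 < \<epsilon>" and x: "\<alpha> \<le> \<epsilon> * sqrt (2 * loglog m)" "\<epsilon> * sqrt (2 * loglog m) \<le> \<beta>"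
      have "\<bar>sqrt (2 * loglog m) * a (Suc m)\<bar> \<le> sqrt (2 * loglog m) * (A / loglog m)"
        using aA[of m] m by (simp only: abs_mult) (intro mult_mono, auto simp: less_imp_le)
      then have "\<bar>sqrt (2 * loglog m) * (\<epsilon> + a (Suc m)) - \<epsilon> * sqrt (2 * loglog m)\<bar> \<le> \<delta>"
        unfolding shift using N1[of m] m by linarith
      then show "\<bar>P m \<epsilon> - G (\<epsilon> * sqrt (2 * loglog m))\<bar> \<le> \<eta>" unfolding P_def using m x by (intro N(2)) auto
    qed
  qed
  have "\<forall>\<^sub>F v::real in at_top. exp (- (c * sqrt (v / 2))) \<le> v powr -(b + 2)" using c(1) by real_asymp
  then obtain v0 where v0: "\<And>v. v \<ge> v0 \<Longrightarrow> exp (- (c * sqrt (v / 2))) \<le> v powr -(b + 2)"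
    unfolding eventually_at_top_linorder by blast
  \<comment> \<open>The entries force, for \<epsilon> < 1, in turn \<open>m \<ge> N0\<close>, a
    perturbation of size at most \<open>\<epsilon> / 2\<close>, a level of at least
    \<open>y0\<close>, and domination of the exponential by the power.\<close>
  define T0 where "T0 = Max {loglog N0 + 1, 2 * A, 2 * y0\<^sup>2, v0}"
  have T0: "loglog N0 + 1 \<le> T0" "2 * A \<le> T0" "2 * y0\<^sup>2 \<le> T0" "v0 \<le> T0" by (auto simp: T0_def)
  have tailP: "P m \<epsilon> \<le> D * (\<epsilon>\<^sup>2 * loglog m) powr -(b + 2) + r m" if e: "0 < \<epsilon>" "\<epsilon> < 1" and t: "T0 \<le> \<epsilon>\<^sup>2 * loglog m" for m \<epsilon>
  proof -
    have "\<epsilon>\<^sup>2 \<le> 1" using e by (simp add: abs_square_le_1)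
    then have "\<epsilon>\<^sup>2 * loglog m \<le> 1 * loglog m" by (intro mult_right_mono) auto
    then have "loglog N0 < loglog m" using t T0(1) by linarith
    then have m: "m \<ge> N0" using loglog_mono[of m N0] by (meson linear not_le)
    have "A / loglog m \<le> \<epsilon> / 2"
    proof -
      have "2 * A \<le> \<epsilon> * (\<epsilon> * loglog m)" using t T0(2) by (simp add: power2_eq_square mult.assoc)
      also have "\<dots> \<le> 1 * (\<epsilon> * loglog m)" using e by (intro mult_right_mono) auto
      finally show ?thesis by (simp add: field_simps)
    qed
    then have h: "\<epsilon> / 2 \<le> \<epsilon> + a (Suc m)" using aA[OF m] by linarith
    \<comment> \<open>Half of the nominal level \<open>\<epsilon> * sqrt (2 * loglog m)\<close>; the
      perturbed level never falls below it.\<close>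
    define w where "w = sqrt (\<epsilon>\<^sup>2 * loglog m / 2)"
    have w: "w = sqrt (2 * loglog m) * (\<epsilon> / 2)"
    proof -
      have "\<epsilon>\<^sup>2 * loglog m / 2 = (2 * loglog m) * (\<epsilon> / 2)\<^sup>2" by (simp add: power_divide)
      then show ?thesis unfolding w_def using e by (simp only: real_sqrt_mult) simp
    qed
    have "y0 \<le> \<bar>y0\<bar>" by simp
    also have "\<dots> = sqrt (y0\<^sup>2)" by simp
    also have "\<dots> \<le> w" unfolding w_def using t T0(3) by (intro real_sqrt_le_mono) linarith
    finally have y0: "y0 \<le> w" .
    have "w \<le> sqrt (2 * loglog m) * (\<epsilon> + a (Suc m))" unfolding w using h by (intro mult_left_mono) auto
    then have "P m \<epsilon> \<le> F m w" unfolding P_def by (rule mono)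
    also have "\<dots> \<le> D * exp (- (c * w)) + r m" by (rule tailF[OF y0])
    also have "\<dots> \<le> D * (\<epsilon>\<^sup>2 * loglog m) powr -(b + 2) + r m"
      unfolding w_def using v0[of "\<epsilon>\<^sup>2 * loglog m"] t T0(4) c by (intro add_right_mono mult_left_mono) auto
    finally show ?thesis .
  qed
  let ?C = "2 * (Gamma (b + 2 + 1/2) / sqrt pi)"
  have C: "?C \<ge> 0" using b by (intro mult_nonneg_nonneg divide_nonneg_nonneg Gamma_real_nonneg) auto
  have tailG: "G (\<epsilon> * sqrt (2 * loglog m)) \<le> ?C * (\<epsilon>\<^sup>2 * loglog m) powr -(b + 2)" if e: "0 < \<epsilon>" for m \<epsilon>
    using Gtail[OF eps_sqrt_loglog_pos[OF e, of m]] gauss_tail_bound'[of "b + 2" \<epsilon> "loglog m"] e b by simp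
  have G2: "G x \<le> 2" if "x > 0" for x using Gtail[OF that] gauss_tail_le_1[of x] by linarith
  have P01: "0 \<le> P m \<epsilon>" "P m \<epsilon> \<le> 1" for m \<epsilon> unfolding P_def using F0 F1 by auto
  show "\<forall>\<^sub>F \<epsilon> in at_right 0. summable (\<lambda>m. weight b m * P m \<epsilon>)"
    by (rule precise_rate_comparison(1)[OF b P01 G0 G2 close r zero_less_one c(2) C tailP tailG q])
  show "((\<lambda>\<epsilon>. \<epsilon> powr (2 * (b + 1)) * (\<Sum>m. weight b m * P m \<epsilon>)) \<longlongrightarrow> q) (at_right 0)"
    by (rule precise_rate_comparison(2)[OF b P01 G0 G2 close r zero_less_one c(2) C tailP tailG q])
qed

context iid_unit_variance
begin

lemma psum_precise_rate:
  assumes b: "b > -1" and a: "a \<in> O(\<lambda>n. 1 / LLg (real n))"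
  defines "P \<equiv> \<lambda>m \<epsilon>. prob {\<omega> \<in> space M. sqrt (2 * loglog m) * (\<epsilon> + a (Suc m)) * sqrt (real (Suc m)) \<le> \<bar>psum X (Suc m) \<omega>\<bar>}"
  shows "\<forall>\<^sub>F \<epsilon> in at_right 0. summable (\<lambda>m. weight b m * P m \<epsilon>)"
    and "((\<lambda>\<epsilon>. \<epsilon> powr (2 * (b + 1)) * (\<Sum>m. weight b m * P m \<epsilon>)) \<longlongrightarrow> Gamma (b + 3/2) / ((b + 1) * sqrt pi)) (at_right 0)"
proof -
  define F where "F m x = prob {\<omega> \<in> space M. x * sqrt (real (Suc m)) \<le> \<bar>psum X (Suc m) \<omega>\<bar>}" for m x
  define r where "r m = real (Suc m) * prob {\<omega> \<in> space M. real (Suc m) < (X 0 \<omega>)\<^sup>2}" for m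
  have P: "P m \<epsilon> = F m (sqrt (2 * loglog m) * (\<epsilon> + a (Suc m)))" for m \<epsilon> by (simp only: P_def F_def)
  have mono: "F n y \<le> F n x" if "x \<le> y" for n x y
  proof -
    have *: "x * sqrt (real (Suc n)) \<le> y * sqrt (real (Suc n))" using that by (rule mult_right_mono) simp
    show ?thesis unfolding F_def by (intro finite_measure_mono) (auto intro: order_trans[OF *] simp del: of_nat_Suc)
  qed
  have lim: "(\<lambda>n. F n x) \<longlonglongrightarrow> gauss_tail x" if "x > 0" for x
    unfolding F_def using LIMSEQ_Suc[OF clt_abs_limit[OF that]] .
  have F01: "0 \<le> F n x" "F n x \<le> 1" for n x by (auto simp: F_def)
  have tail: "F m y \<le> 2 * exp 2 * exp (- (1 * y)) + r m" if "y \<ge> 0" for m y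
    using prob_abs_psum_ge_le[of "Suc m" y] by (simp add: F_def r_def)
  have r0: "0 \<le> r m" for m by (simp add: r_def)
  have gt: "gauss_tail x \<le> 2 * gauss_tail x" for x using gauss_tail_nonneg[of x] by simp
  have D: "0 \<le> 2 * exp (2::real)" by simp
  note * = precise_rate_profile[where F = F and G = gauss_tail and a = a, OF b mono F01 lim isCont_gauss_tail gauss_tail_nonneg gt
      summable_large_jumps[folded r_def] r0 zero_less_one D tail a gauss_tail_sum_limit[OF b]]
  show "\<forall>\<^sub>F \<epsilon> in at_right 0. summable (\<lambda>m. weight b m * P m \<epsilon>)"
    unfolding P by (rule *(1))
  show "((\<lambda>\<epsilon>. \<epsilon> powr (2 * (b + 1)) * (\<Sum>m. weight b m * P m \<epsilon>)) \<longlongrightarrow> Gamma (b + 3/2) / ((b + 1) * sqrt pi)) (at_right 0)"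
    unfolding P by (rule *(2))
qed

lemma maxpsum_precise_rate:
  assumes b: "b > -1" and a: "a \<in> O(\<lambda>n. 1 / LLg (real n))"
  defines "P \<equiv> \<lambda>m \<epsilon>. prob {\<omega> \<in> space M. sqrt (2 * loglog m) * (\<epsilon> + a (Suc m)) * sqrt (real (Suc m)) \<le> maxpsum X (Suc m) \<omega>}"
  shows "\<forall>\<^sub>F \<epsilon> in at_right 0. summable (\<lambda>m. weight b m * P m \<epsilon>)"
    and "((\<lambda>\<epsilon>. \<epsilon> powr (2 * (b + 1)) * (\<Sum>m. weight b m * P m \<epsilon>)) \<longlongrightarrow>
      2 / ((b + 1) * sqrt pi) * Gamma (b + 3/2) * (\<Sum>k. (-1) ^ k / (real (2 * k + 1)) powr (2 * b + 2))) (at_right 0)"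
proof -
  define F where "F m x = prob {\<omega> \<in> space M. x * sqrt (real (Suc m)) \<le> maxpsum X (Suc m) \<omega>}" for m x
  define r where "r m = 2 * (real (Suc m) * prob {\<omega> \<in> space M. real (Suc m) < (X 0 \<omega>)\<^sup>2})" for m
  have P: "P m \<epsilon> = F m (sqrt (2 * loglog m) * (\<epsilon> + a (Suc m)))" for m \<epsilon> by (simp only: P_def F_def)
  have [measurable]: "maxpsum X (Suc n) \<in> borel_measurable M" for n by (rule measurable_maxpsum) simp
  have mono: "F n y \<le> F n x" if "x \<le> y" for n x y
  proof -
    have *: "x * sqrt (real (Suc n)) \<le> y * sqrt (real (Suc n))" using that by (rule mult_right_mono) simp
    show ?thesis unfolding F_def by (intro finite_measure_mono) (auto intro: order_trans[OF *] simp del: of_nat_Suc)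
  qed
  have lim: "(\<lambda>n. F n x) \<longlonglongrightarrow> max_tail x" if "x > 0" for x
    unfolding F_def using LIMSEQ_Suc[OF erdos_kac_limit[OF that]] .
  have F01: "0 \<le> F n x" "F n x \<le> 1" for n x by (auto simp: F_def)
  \<comment> \<open>Ottaviani's inequality requires \<open>y\<^sup>2 \<ge> 8\<close>, which 3
    guarantees. It doubles the bound and halves the level, whence the constants 4 and 1/2 and the
    factor 2 in \<open>r\<close>.\<close>
  have tail: "F m y \<le> 4 * exp 2 * exp (- (1 / 2 * y)) + r m" if y: "y \<ge> 3" for m y
  proof -
    let ?n = "Suc m"
    have "8 \<le> y\<^sup>2" using power_mono[OF y, of 2] by simp
    then have "8 * real ?n \<le> y\<^sup>2 * real ?n" by (rule mult_right_mono) simp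
    then have n: "2 * real ?n \<le> (y * sqrt (real ?n) / 2)\<^sup>2" by (simp add: power_divide power_mult_distrib)
    have "F m y \<le> 2 * prob {\<omega> \<in> space M. y * sqrt (real ?n) / 2 \<le> \<bar>psum X ?n \<omega>\<bar>}"
      unfolding F_def using y by (intro prob_maxpsum_ge_le n) auto
    also have "y * sqrt (real ?n) / 2 = y / 2 * sqrt (real ?n)" by simp
    also have "2 * prob {\<omega> \<in> space M. y / 2 * sqrt (real ?n) \<le> \<bar>psum X ?n \<omega>\<bar>} \<le>
        2 * (real ?n * prob {\<omega> \<in> space M. real ?n < (X 0 \<omega>)\<^sup>2} + 2 * exp 2 * exp (- (y / 2)))"
      by (intro mult_left_mono prob_abs_psum_ge_le) auto
    finally show ?thesis by (simp add: r_def)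
  qed
  have r0: "0 \<le> r m" for m by (simp add: r_def)
  have D: "0 \<le> 4 * exp (2::real)" by simp
  have "summable (\<lambda>m. 2 * (weight b m * (real (Suc m) * prob {\<omega> \<in> space M. real (Suc m) < (X 0 \<omega>)\<^sup>2})))"
    by (rule summable_mult[OF summable_large_jumps])
  then have rs: "summable (\<lambda>m. weight b m * r m)" by (simp only: r_def mult.left_commute)
  have h: "(0::real) < 1 / 2" by simp
  note * = precise_rate_profile[where F = F and G = max_tail and a = a, OF b mono F01 lim isCont_max_tail max_tail_nonneg max_tail_le_gauss_tail
      rs r0 h D tail a max_tail_sum_limit[OF b]]
  show "\<forall>\<^sub>F \<epsilon> in at_right 0. summable (\<lambda>m. weight b m * P m \<epsilon>)"
    unfolding P by (rule *(1))
  show "((\<lambda>\<epsilon>. \<epsilon> powr (2 * (b + 1)) * (\<Sum>m. weight b m * P m \<epsilon>)) \<longlongrightarrow>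
      2 / ((b + 1) * sqrt pi) * Gamma (b + 3/2) * (\<Sum>k. (-1) ^ k / (real (2 * k + 1)) powr (2 * b + 2))) (at_right 0)"
    unfolding P by (rule *(2))
qed

end

lemma psum_scale: "psum (\<lambda>i \<omega>. X i \<omega> / \<sigma>) n \<omega> = psum X n \<omega> / \<sigma>"
  by (simp add: psum_def sum_divide_distrib)

lemma maxpsum_scale:
  assumes "\<sigma> > 0" "n \<ge> 1"
  shows "maxpsum (\<lambda>i \<omega>. X i \<omega> / \<sigma>) n \<omega> = maxpsum X n \<omega> / \<sigma>"
proof -
  have "mono (\<lambda>x::real. x / \<sigma>)" using assms by (intro monoI divide_right_mono) auto
  then have "maxpsum X n \<omega> / \<sigma> = Max ((\<lambda>x. x / \<sigma>) ` (\<lambda>k. \<bar>psum X k \<omega>\<bar>) ` {1..n})"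
    unfolding maxpsum_def using assms by (intro mono_Max_commute) auto
  then show ?thesis using assms by (simp add: maxpsum_def psum_scale image_image abs_divide)
qed

theorem theorem2:
  fixes M :: "'a measure" and X :: "nat \<Rightarrow> 'a \<Rightarrow> real"
    and \<sigma> b :: real and a :: "nat \<Rightarrow> real"
  assumes "prob_space M"
    and "\<And>i. X i \<in> borel_measurable M"
    and "prob_space.indep_vars M (\<lambda>_. borel) X UNIV"
    and "\<And>i. distr M borel (X i) = distr M borel (X 0)"
    and "integrable M (X 0)" and "(\<integral>\<omega>. X 0 \<omega> \<partial>M) = 0"
    and "integrable M (\<lambda>\<omega>. (X 0 \<omega>)\<^sup>2)" and "(\<integral>\<omega>. (X 0 \<omega>)\<^sup>2 \<partial>M) = \<sigma>\<^sup>2"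
    and "\<sigma> > 0"
    and "a \<in> O(\<lambda>n. 1 / LLg (real n))"
    and "b > -1"
  shows
   "(\<forall>\<^sub>F \<epsilon> in at_right 0. summable (\<lambda>m. let n = Suc m in
        (LLg (real n)) powr b / (real n * Lg (real n)) *
        measure M {\<omega> \<in> space M. maxpsum X n \<omega> \<ge> \<sigma> * phi (real n) * (\<epsilon> + a n)}))
    \<and> ((\<lambda>\<epsilon>. \<epsilon> powr (2 * (b + 1)) * (\<Sum>m. let n = Suc m in
        (LLg (real n)) powr b / (real n * Lg (real n)) *
        measure M {\<omega> \<in> space M. maxpsum X n \<omega> \<ge> \<sigma> * phi (real n) * (\<epsilon> + a n)}))
       \<longlongrightarrow> 2 / ((b + 1) * sqrt pi) * Gamma (b + 3/2) *
           (\<Sum>k. (-1) ^ k / (real (2 * k + 1)) powr (2 * b + 2))) (at_right 0)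
    \<and> (\<forall>\<^sub>F \<epsilon> in at_right 0. summable (\<lambda>m. let n = Suc m in
        (LLg (real n)) powr b / (real n * Lg (real n)) *
        measure M {\<omega> \<in> space M. \<bar>psum X n \<omega>\<bar> \<ge> \<sigma> * phi (real n) * (\<epsilon> + a n)}))
    \<and> ((\<lambda>\<epsilon>. \<epsilon> powr (2 * (b + 1)) * (\<Sum>m. let n = Suc m in
        (LLg (real n)) powr b / (real n * Lg (real n)) *
        measure M {\<omega> \<in> space M. \<bar>psum X n \<omega>\<bar> \<ge> \<sigma> * phi (real n) * (\<epsilon> + a n)}))
       \<longlongrightarrow> 1 / ((b + 1) * sqrt pi) * Gamma (b + 3/2)) (at_right 0)"
proof -
  interpret prob_space M by fact
  note [measurable] = assms(2)
  \<comment> \<open>Normalisation to unit variance; the events are unchanged because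
    \<open>phi (real n)\<close> factors as
    \<open>sqrt (2 * LLg (real n)) * sqrt (real n)\<close>.\<close>
  define Y where "Y i \<omega> = X i \<omega> / \<sigma>" for i \<omega>
  have Y_eq: "Y = (\<lambda>i \<omega>. X i \<omega> / \<sigma>)" by (simp add: Y_def fun_eq_iff)
  have dY: "distr M borel (Y i) = distr (distr M borel (X i)) borel (\<lambda>x. x / \<sigma>)" for i
    by (subst distr_distr) (auto simp: Y_def[abs_def] comp_def)
  interpret Y: iid_unit_variance M Y
  proof
    show "Y i \<in> borel_measurable M" for i unfolding Y_def[abs_def] by measurable
    show "indep_vars (\<lambda>_. borel) Y UNIV"
      unfolding Y_eq by (rule indep_vars_compose2[OF assms(3)]) auto
    show "distr M borel (Y i) = distr M borel (Y 0)" for i unfolding dY assms(4)[of i] ..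
    show "integrable M (Y 0)" "expectation (Y 0) = 0" unfolding Y_def[abs_def] using assms(5,6) by auto
    show "integrable M (\<lambda>\<omega>. (Y 0 \<omega>)\<^sup>2)" "expectation (\<lambda>\<omega>. (Y 0 \<omega>)\<^sup>2) = 1"
      unfolding Y_def power_divide using assms(7,8,9) by auto
  qed
  have w: "LLg (real (Suc m)) powr b / (real (Suc m) * Lg (real (Suc m))) = weight b m" for m
    by (simp only: weight_def loglog_def)
  have thr: "\<sigma> * phi (real (Suc m)) * (\<epsilon> + a (Suc m)) \<le> u \<longleftrightarrow>
      sqrt (2 * loglog m) * (\<epsilon> + a (Suc m)) * sqrt (real (Suc m)) \<le> u / \<sigma>" for m \<epsilon> u
  proof -
    have "phi (real (Suc m)) = sqrt (2 * loglog m) * sqrt (real (Suc m))"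
      unfolding phi_def loglog_def by (simp only: real_sqrt_mult[symmetric] mult_ac)
    then show ?thesis using \<open>\<sigma> > 0\<close> by (simp add: pos_le_divide_eq mult_ac)
  qed
  have mx: "maxpsum X (Suc m) \<omega> / \<sigma> = maxpsum Y (Suc m) \<omega>" for m \<omega>
    unfolding Y_eq using \<open>\<sigma> > 0\<close> by (subst maxpsum_scale) auto
  have ps: "\<bar>psum X (Suc m) \<omega>\<bar> / \<sigma> = \<bar>psum Y (Suc m) \<omega>\<bar>" for m \<omega>
    unfolding Y_eq psum_scale using \<open>\<sigma> > 0\<close> by simp
  show ?thesis
    unfolding Let_def w thr mx ps
    using Y.maxpsum_precise_rate[OF assms(11,10)] Y.psum_precise_rate[OF assms(11,10)]
    by simp
qed

end
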